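(* Let $(P,\{\cdot,\cdot\},H)$ be a Poisson dynamical system with an equilibrium at the point $z_e\in P$. Assume that there exists a regular Poisson ideal $\mathcal{I}$ generated by functions $G_1,\ldots,G_m\in C^\infty(P)$, with sub-Casimirs $F_1,\ldots,F_r\in C^\infty(P)$, such that $z_e\in\mathcal{V}_{\mathcal{I}}$. Suppose that the functions $C_0:=H,C_1,\ldots,C_n\in C^\infty(P)$ are conserved by the flow of $X_H$ and that, additionally, there exist real constants $\lambda_0,\lambda_1,\ldots,\lambda_n,\mu_1,\ldots,\mu_r,\nu_1,\ldots,\nu_m$ such that (i) $H_1:=\sum_{i=0}^n\lambda_iC_i+\sum_{j=1}^r\mu_jF_j+\sum_{k=1}^m\nu_kG_k$ has a critical point at $z_e$, and (ii) the Hessian of $H_1$ at $z_e$ is positive definite when restricted to the subspace $$W=\bigcap_{i=0}^n\ker(\mathbf{d}C_i(z_e))\ \cap\ \bigcap_{j=1}^r\ker(\mathbf{d}F_j(z_e))\ \cap\ \bigcap_{k=1}^m\ker(\mathbf{d}G_k(z_e)).$$ Then $z_e$ is an $\mathcal{I}$-stable equilibrium.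
   Context: A Poisson dynamical system $(P,\{\cdot,\cdot\},H)$ is a smooth finite dimensional Poisson manifold $(P,\{\cdot,\cdot\})$ with a Hamiltonian $H\in C^\infty(P)$; $X_H$ is defined by $X_H[F]=\{F,H\}$ for all $F\in C^\infty(P)$. For a critical point $z_e$ of $f$, the Hessian is $\mathbf{d}^2f(z_e)(v,w)=v[W[f]]$, where $W$ is any local vector field extending $w\in T_{z_e}P$. A finite family $\{G_1,\ldots,G_m\}\subset C^\infty(P)$ generates a Poisson ideal if for any $f\in C^\infty(P)$ and any $i$ there exist $h_{i1},\ldots,h_{im}\in C^\infty(P)$ with $\{f,G_i\}=\sum_jh_{ij}G_j$; the Poisson ideal generated is $\mathcal{I}=\{\sum_kg_kG_k\mid g_k\in C^\infty(P)\}$. Its vanishing set $\mathcal{V}_{\mathcal{I}}\subset P$ is the common zero set of all elements of $\mathcal{I}$ (equivalently of $G_1,\dots,G_m$). The ideal is regular if $\mathcal{V}_{\mathcal{I}}$ is a closed embedded submanifold of $P$. In that case $\mathcal{V}_{\mathcal{I}}$ carries a unique Poisson bracket $\{\cdot,\cdot\}_{\mathcal{V}_{\mathcal{I}}}$ making the inclusion $i:\mathcal{V}_{\mathcal{I}}\hookrightarrow P$ a Poisson map, given by $\{f,g\}_{\mathcal{V}_{\mathcal{I}}}(z)=\{F,G\}(z)$ with $F,G\in C^\infty(P)$ arbitrary local extensions of $f,g$ around $z$. The sub-Casimirs are the functions $F\in C^\infty(P)$ that extend Casimir functions of $(\mathcal{V}_{\mathcal{I}},\{\cdot,\cdot\}_{\mathcal{V}_{\mathcal{I}}})$,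 i.e. functions $F$ such that $F|_{\mathcal{V}_{\mathcal{I}}}$ lies in the center of the Poisson algebra $(C^\infty(\mathcal{V}_{\mathcal{I}}),\{\cdot,\cdot\}_{\mathcal{V}_{\mathcal{I}}})$. An equilibrium $z_e\in\mathcal{V}_{\mathcal{I}}$ of $X_H$ is $\mathcal{I}$-stable if it is a Lyapunov stable equilibrium of the reduced Poisson dynamical system $(\mathcal{V}_{\mathcal{I}},\{\cdot,\cdot\}_{\mathcal{V}_{\mathcal{I}}},H\circ i)$; equivalently, if for any open neighborhood $U$ of $z_e$ in $P$ there is an open neighborhood $V$ of $z_e$ in $P$ such that, with $F_t$ the flow of $X_H$, $F_t(z)\in U\cap\mathcal{V}_{\mathcal{I}}$ for any $z\in V\cap\mathcal{V}_{\mathcal{I}}$ and any $t>0$. *)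

theory Defs
  imports "HOL-Analysis.Analysis"
begin

section \<open>Smooth functions between Euclidean spaces\<close>

primrec higher_differentiable_on ::
  "nat \<Rightarrow> 'a::euclidean_space set \<Rightarrow> ('a \<Rightarrow> 'b::real_normed_vector) \<Rightarrow> bool" where
  "higher_differentiable_on 0 S f \<longleftrightarrow> continuous_on S f"
| "higher_differentiable_on (Suc k) S f \<longleftrightarrow>
     (\<forall>x\<in>S. f differentiable (at x)) \<and>
     (\<forall>v. higher_differentiable_on k S (\<lambda>x. frechet_derivative f (at x) v))"

text \<open>The set \<open>S\<close> need not be open: smoothness means local extendability to a smooth function on
  an open set. On open sets this is the usual notion; below it is applied to relatively open
  subsets of a linear subspace.\<close>

definition smooth_on :: "'a::euclidean_space set \<Rightarrow> ('a \<Rightarrow> 'b::real_normed_vector) \<Rightarrow> bool" where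
  "smooth_on S f \<longleftrightarrow>
     (\<forall>x\<in>S. \<exists>N F. open N \<and> x \<in> N \<and> (\<forall>k. higher_differentiable_on k N F) \<and>
        (\<forall>y\<in>S \<inter> N. F y = f y))"


section \<open>Smooth manifolds\<close>

text \<open>The underlying set of a manifold is a whole type, which is Hausdorff and second countable by
  its sort. The model space is a linear subspace \<open>E\<close> of the type \<open>'e\<close>, so that the dimension is
  \<open>dim E\<close>; taking \<open>E = UNIV\<close> only would exclude manifolds of dimension zero, because every type of
  class \<open>euclidean_space\<close> has positive dimension.\<close>

type_synonym ('a, 'e) chart = "'a set \<times> ('a \<Rightarrow> 'e)"

definition is_chart ::
  "'e::euclidean_space set \<Rightarrow> ('a::{t2_space,second_countable_topology}, 'e) chart \<Rightarrow> bool" where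
  "is_chart E = (\<lambda>(U, \<phi>). open U \<and> openin (top_of_set E) (\<phi> ` U) \<and>
     (\<exists>\<psi>. homeomorphism U (\<phi> ` U) \<phi> \<psi>))"

definition compatible_charts ::
  "('a::{t2_space,second_countable_topology}, 'e::euclidean_space) chart \<Rightarrow> ('a, 'e) chart \<Rightarrow> bool"
  where
  "compatible_charts = (\<lambda>(U, \<phi>) (U', \<phi>').
     smooth_on (\<phi> ` (U \<inter> U')) (\<phi>' \<circ> inv_into U \<phi>) \<and>
     smooth_on (\<phi>' ` (U \<inter> U')) (\<phi> \<circ> inv_into U' \<phi>'))"

definition smooth_manifold ::
  "'e::euclidean_space set \<Rightarrow> ('a::{t2_space,second_countable_topology}, 'e) chart set \<Rightarrow> bool" where
  "smooth_manifold E A \<longleftrightarrow>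
     subspace E \<and>
     (\<forall>c\<in>A. is_chart E c) \<and>
     (\<forall>c\<in>A. \<forall>c'\<in>A. compatible_charts c c') \<and>
     (\<Union>c\<in>A. fst c) = UNIV"

definition maximal_atlas ::
  "'e::euclidean_space set \<Rightarrow> ('a::{t2_space,second_countable_topology}, 'e) chart set \<Rightarrow>
   ('a, 'e) chart set" where
  "maximal_atlas E A = {c. is_chart E c \<and> (\<forall>c'\<in>A. compatible_charts c c')}"

definition smooth_functions ::
  "('a::{t2_space,second_countable_topology}, 'e::euclidean_space) chart set \<Rightarrow> ('a \<Rightarrow> real) set" where
  "smooth_functions A = {f. \<forall>(U, \<phi>)\<in>A. smooth_on (\<phi> ` U) (f \<circ> inv_into U \<phi>)}"


section \<open>Tangent vectors, differentials and Hessians\<close>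

text \<open>Tangent vectors are derivations \<open>v\<close> at \<open>z\<close>, so that \<open>v f\<close> is \<open>v[f]\<close>, and equivalently
  the value on \<open>v\<close> of the differential of \<open>f\<close> at \<open>z\<close>. The value \<open>0\<close> outside the algebra of smooth
  functions is a normalisation which makes equality of tangent vectors the intended one.\<close>

definition tangent_space ::
  "('a::{t2_space,second_countable_topology}, 'e::euclidean_space) chart set \<Rightarrow> 'a \<Rightarrow>
   (('a \<Rightarrow> real) \<Rightarrow> real) set" where
  "tangent_space A z = {v.
     (\<forall>f\<in>smooth_functions A. \<forall>g\<in>smooth_functions A. v (\<lambda>x. f x + g x) = v f + v g) \<and>
     (\<forall>c. \<forall>f\<in>smooth_functions A. v (\<lambda>x. c * f x) = c * v f) \<and>
     (\<forall>f\<in>smooth_functions A. \<forall>g\<in>smooth_functions A.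
        v (\<lambda>x. f x * g x) = v f * g z + f z * v g) \<and>
     (\<forall>f. f \<notin> smooth_functions A \<longrightarrow> v f = 0)}"

definition ker_differential ::
  "('a::{t2_space,second_countable_topology}, 'e::euclidean_space) chart set \<Rightarrow> ('a \<Rightarrow> real) \<Rightarrow> 'a \<Rightarrow>
   (('a \<Rightarrow> real) \<Rightarrow> real) set" where
  "ker_differential A f z = {v \<in> tangent_space A z. v f = 0}"

definition critical_point ::
  "('a::{t2_space,second_countable_topology}, 'e::euclidean_space) chart set \<Rightarrow> ('a \<Rightarrow> real) \<Rightarrow> 'a \<Rightarrow>
   bool" where
  "critical_point A f z \<longleftrightarrow> (\<forall>v\<in>tangent_space A z. v f = 0)"

definition vector_field ::
  "('a::{t2_space,second_countable_topology}, 'e::euclidean_space) chart set \<Rightarrow>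
   (('a \<Rightarrow> real) \<Rightarrow> 'a \<Rightarrow> real) \<Rightarrow> bool" where
  "vector_field A W \<longleftrightarrow>
     (\<forall>f\<in>smooth_functions A. W f \<in> smooth_functions A) \<and>
     (\<forall>f\<in>smooth_functions A. \<forall>g\<in>smooth_functions A. \<forall>x. W (\<lambda>y. f y + g y) x = W f x + W g x) \<and>
     (\<forall>c. \<forall>f\<in>smooth_functions A. \<forall>x. W (\<lambda>y. c * f y) x = c * W f x) \<and>
     (\<forall>f\<in>smooth_functions A. \<forall>g\<in>smooth_functions A. \<forall>x.
        W (\<lambda>y. f y * g y) x = W f x * g x + f x * W g x)"

text \<open>The Hessian \<open>v[W[f]]\<close>, for any vector field \<open>W\<close> extending \<open>w\<close>. It is only meaningful at
  a critical point \<open>z\<close> of \<open>f\<close>, where the value does not depend on the extension. Globally defined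
  extensions suffice: every vector field defined near \<open>z\<close> agrees near \<open>z\<close> with a global one.\<close>

definition hessian ::
  "('a::{t2_space,second_countable_topology}, 'e::euclidean_space) chart set \<Rightarrow> ('a \<Rightarrow> real) \<Rightarrow> 'a \<Rightarrow>
   (('a \<Rightarrow> real) \<Rightarrow> real) \<Rightarrow> (('a \<Rightarrow> real) \<Rightarrow> real) \<Rightarrow> real" where
  "hessian A f z v w =
     (THE r. \<exists>W. vector_field A W \<and> (\<forall>g\<in>smooth_functions A. W g z = w g) \<and> r = v (W f))"


section \<open>Dynamics\<close>

text \<open>The notions of this section are relative to a phase space \<open>M\<close> (a subset of the ambient type),
  its algebra \<open>S\<close> of smooth functions, and a vector field \<open>X\<close> on it, given as a derivation of \<open>S\<close>.
  They are used both for the given system and for the reduced one. The flow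
  is the maximal one, possibly incomplete; \<open>flow_defined M S X z t\<close> says that \<open>t\<close> lies in the
  maximal interval of existence of the integral curve through \<open>z\<close>.\<close>

definition integral_curve ::
  "'a::topological_space set \<Rightarrow> ('a \<Rightarrow> real) set \<Rightarrow> (('a \<Rightarrow> real) \<Rightarrow> 'a \<Rightarrow> real) \<Rightarrow>
   real set \<Rightarrow> (real \<Rightarrow> 'a) \<Rightarrow> bool" where
  "integral_curve M S X J c \<longleftrightarrow>
     open J \<and> is_interval J \<and> continuous_on J c \<and> c ` J \<subseteq> M \<and>
     (\<forall>f\<in>S. \<forall>t\<in>J. ((\<lambda>s. f (c s)) has_real_derivative X f (c t)) (at t))"

definition flow_defined ::
  "'a::topological_space set \<Rightarrow> ('a \<Rightarrow> real) set \<Rightarrow> (('a \<Rightarrow> real) \<Rightarrow> 'a \<Rightarrow> real) \<Rightarrow> 'a \<Rightarrow> real \<Rightarrow> bool"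
  where
  "flow_defined M S X z t \<longleftrightarrow>
     (\<exists>J c. integral_curve M S X J c \<and> 0 \<in> J \<and> t \<in> J \<and> c 0 = z)"

definition flow ::
  "'a::topological_space set \<Rightarrow> ('a \<Rightarrow> real) set \<Rightarrow> (('a \<Rightarrow> real) \<Rightarrow> 'a \<Rightarrow> real) \<Rightarrow> real \<Rightarrow> 'a \<Rightarrow> 'a"
  where
  "flow M S X t z =
     (THE w. \<exists>J c. integral_curve M S X J c \<and> 0 \<in> J \<and> t \<in> J \<and> c 0 = z \<and> c t = w)"

definition conserved ::
  "'a::topological_space set \<Rightarrow> ('a \<Rightarrow> real) set \<Rightarrow> (('a \<Rightarrow> real) \<Rightarrow> 'a \<Rightarrow> real) \<Rightarrow> ('a \<Rightarrow> real) \<Rightarrow> bool"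
  where
  "conserved M S X f \<longleftrightarrow> (\<forall>z\<in>M. \<forall>t. flow_defined M S X z t \<longrightarrow> f (flow M S X t z) = f z)"

definition equilibrium ::
  "('a \<Rightarrow> real) set \<Rightarrow> (('a \<Rightarrow> real) \<Rightarrow> 'a \<Rightarrow> real) \<Rightarrow> 'a \<Rightarrow> bool" where
  "equilibrium S X z \<longleftrightarrow> (\<forall>f\<in>S. X f z = 0)"

definition lyapunov_stable ::
  "'a::topological_space set \<Rightarrow> ('a \<Rightarrow> real) set \<Rightarrow> (('a \<Rightarrow> real) \<Rightarrow> 'a \<Rightarrow> real) \<Rightarrow> 'a \<Rightarrow> bool" where
  "lyapunov_stable M S X z \<longleftrightarrow>
     z \<in> M \<and> equilibrium S X z \<and>
     (\<forall>U. openin (top_of_set M) U \<and> z \<in> U \<longrightarrow>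
        (\<exists>V. openin (top_of_set M) V \<and> z \<in> V \<and>
           (\<forall>x\<in>V. \<forall>t>0. flow_defined M S X x t \<and> flow M S X t x \<in> U)))"


section \<open>Poisson manifolds and Poisson ideals\<close>

definition poisson_manifold ::
  "'e::euclidean_space set \<Rightarrow> ('a::{t2_space,second_countable_topology}, 'e) chart set \<Rightarrow>
   (('a \<Rightarrow> real) \<Rightarrow> ('a \<Rightarrow> real) \<Rightarrow> 'a \<Rightarrow> real) \<Rightarrow> bool" where
  "poisson_manifold E A B \<longleftrightarrow>
     smooth_manifold E A \<and>
     (\<forall>f\<in>smooth_functions A. \<forall>g\<in>smooth_functions A. B f g \<in> smooth_functions A) \<and>
     (\<forall>f\<in>smooth_functions A. \<forall>g\<in>smooth_functions A. \<forall>h\<in>smooth_functions A. \<forall>z.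
        B (\<lambda>x. f x + g x) h z = B f h z + B g h z) \<and>
     (\<forall>c. \<forall>f\<in>smooth_functions A. \<forall>g\<in>smooth_functions A. \<forall>z. B (\<lambda>x. c * f x) g z = c * B f g z) \<and>
     (\<forall>f\<in>smooth_functions A. \<forall>g\<in>smooth_functions A. \<forall>z. B f g z = - B g f z) \<and>
     (\<forall>f\<in>smooth_functions A. \<forall>g\<in>smooth_functions A. \<forall>h\<in>smooth_functions A. \<forall>z.
        B f (B g h) z + B g (B h f) z + B h (B f g) z = 0) \<and>
     (\<forall>f\<in>smooth_functions A. \<forall>g\<in>smooth_functions A. \<forall>h\<in>smooth_functions A. \<forall>z.
        B (\<lambda>x. f x * g x) h z = f z * B g h z + B f h z * g z)"

definition hamiltonian_field ::
  "(('a \<Rightarrow> real) \<Rightarrow> ('a \<Rightarrow> real) \<Rightarrow> 'a \<Rightarrow> real) \<Rightarrow> ('a \<Rightarrow> real) \<Rightarrow> ('a \<Rightarrow> real) \<Rightarrow> 'a \<Rightarrow> real" where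
  "hamiltonian_field B H = (\<lambda>f. B f H)"

definition generates_poisson_ideal ::
  "('a::{t2_space,second_countable_topology}, 'e::euclidean_space) chart set \<Rightarrow>
   (('a \<Rightarrow> real) \<Rightarrow> ('a \<Rightarrow> real) \<Rightarrow> 'a \<Rightarrow> real) \<Rightarrow> nat \<Rightarrow> (nat \<Rightarrow> 'a \<Rightarrow> real) \<Rightarrow> bool" where
  "generates_poisson_ideal A B m G \<longleftrightarrow>
     (\<forall>i\<in>{1..m}. G i \<in> smooth_functions A) \<and>
     (\<forall>f\<in>smooth_functions A. \<forall>i\<in>{1..m}. \<exists>h. (\<forall>j\<in>{1..m}. h j \<in> smooth_functions A) \<and>
        (\<forall>z. B f (G i) z = (\<Sum>j=1..m. h j z * G j z)))"

definition generated_ideal ::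
  "('a::{t2_space,second_countable_topology}, 'e::euclidean_space) chart set \<Rightarrow>
   nat \<Rightarrow> (nat \<Rightarrow> 'a \<Rightarrow> real) \<Rightarrow> ('a \<Rightarrow> real) set" where
  "generated_ideal A m G =
     {(\<lambda>z. \<Sum>k=1..m. g k z * G k z) | g. \<forall>k\<in>{1..m}. g k \<in> smooth_functions A}"

definition vanishing_set :: "('a \<Rightarrow> real) set \<Rightarrow> 'a set" where
  "vanishing_set I = {z. \<forall>f\<in>I. f z = 0}"

text \<open>Submanifolds are given by slice charts; the dimension \<open>dim F\<close> of the slice may a priori differ
  between connected components.\<close>

definition closed_embedded_submanifold ::
  "'e::euclidean_space set \<Rightarrow> ('a::{t2_space,second_countable_topology}, 'e) chart set \<Rightarrow> 'a set \<Rightarrow>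
   bool" where
  "closed_embedded_submanifold E A N \<longleftrightarrow>
     closed N \<and>
     (\<forall>z\<in>N. \<exists>(U, \<phi>)\<in>maximal_atlas E A. z \<in> U \<and>
        (\<exists>F. subspace F \<and> F \<subseteq> E \<and> \<phi> ` (U \<inter> N) = \<phi> ` U \<inter> F))"

definition regular_ideal ::
  "'e::euclidean_space set \<Rightarrow> ('a::{t2_space,second_countable_topology}, 'e) chart set \<Rightarrow>
   ('a \<Rightarrow> real) set \<Rightarrow> bool" where
  "regular_ideal E A I \<longleftrightarrow> closed_embedded_submanifold E A (vanishing_set I)"


section \<open>The reduced Poisson structure on an embedded submanifold\<close>

text \<open>Functions on a submanifold \<open>N\<close> are represented by functions on the ambient type whose values
  outside \<open>N\<close> are irrelevant; in particular, \<open>H\<close> also represents its restriction to \<open>N\<close>.\<close>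

definition local_extension ::
  "('a::{t2_space,second_countable_topology}, 'e::euclidean_space) chart set \<Rightarrow> 'a set \<Rightarrow>
   ('a \<Rightarrow> real) \<Rightarrow> 'a \<Rightarrow> ('a \<Rightarrow> real) \<Rightarrow> bool" where
  "local_extension A N f z F \<longleftrightarrow>
     F \<in> smooth_functions A \<and> (\<exists>U. open U \<and> z \<in> U \<and> (\<forall>x\<in>U \<inter> N. F x = f x))"

definition smooth_functions_on ::
  "('a::{t2_space,second_countable_topology}, 'e::euclidean_space) chart set \<Rightarrow> 'a set \<Rightarrow>
   ('a \<Rightarrow> real) set" where
  "smooth_functions_on A N = {f. \<forall>z\<in>N. \<exists>F. local_extension A N f z F}"

definition reduced_bracket ::
  "('a::{t2_space,second_countable_topology}, 'e::euclidean_space) chart set \<Rightarrow>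
   (('a \<Rightarrow> real) \<Rightarrow> ('a \<Rightarrow> real) \<Rightarrow> 'a \<Rightarrow> real) \<Rightarrow> 'a set \<Rightarrow>
   ('a \<Rightarrow> real) \<Rightarrow> ('a \<Rightarrow> real) \<Rightarrow> 'a \<Rightarrow> real" where
  "reduced_bracket A B N f g z =
     (THE r. \<exists>F G. local_extension A N f z F \<and> local_extension A N g z G \<and> r = B F G z)"

definition sub_casimir ::
  "('a::{t2_space,second_countable_topology}, 'e::euclidean_space) chart set \<Rightarrow>
   (('a \<Rightarrow> real) \<Rightarrow> ('a \<Rightarrow> real) \<Rightarrow> 'a \<Rightarrow> real) \<Rightarrow> ('a \<Rightarrow> real) set \<Rightarrow> ('a \<Rightarrow> real) \<Rightarrow> bool" where
  "sub_casimir A B I F \<longleftrightarrow>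
     F \<in> smooth_functions A \<and>
     (\<forall>g\<in>smooth_functions_on A (vanishing_set I). \<forall>z\<in>vanishing_set I.
        reduced_bracket A B (vanishing_set I) F g z = 0)"

definition ideal_stable ::
  "('a::{t2_space,second_countable_topology}, 'e::euclidean_space) chart set \<Rightarrow>
   (('a \<Rightarrow> real) \<Rightarrow> ('a \<Rightarrow> real) \<Rightarrow> 'a \<Rightarrow> real) \<Rightarrow> ('a \<Rightarrow> real) \<Rightarrow> ('a \<Rightarrow> real) set \<Rightarrow> 'a \<Rightarrow> bool" where
  "ideal_stable A B H I z \<longleftrightarrow>
     equilibrium (smooth_functions A) (hamiltonian_field B H) z \<and>
     lyapunov_stable (vanishing_set I) (smooth_functions_on A (vanishing_set I))
       (hamiltonian_field (reduced_bracket A B (vanishing_set I)) H) z"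

end

theory Submission
  imports Defs "HOL-Computational_Algebra.Polynomial"
begin

text \<open>Along a Hamiltonian curve the generators \<open>G k\<close> satisfy a homogeneous linear system, so by
  Gronwall's inequality the vanishing set is invariant under every Hamiltonian flow. Hence the reduced
  bracket is well defined, and the reduced integral curves are exactly the integral curves in \<open>P\<close>
  that start in the vanishing set; along them all the \<open>C i\<close>, \<open>F j\<close> and \<open>G k\<close> are constant.
  If their common level set through \<open>ze\<close> accumulated at \<open>ze\<close>, it would do so along a unit direction
  \<open>u\<close> in \<open>W\<close>, and the second-order expansion of \<open>H1\<close>, which is constant on that level set, would make
  the Hessian vanish on \<open>u\<close>. So \<open>ze\<close> is isolated in the level set, and
  \<open>\<Psi> = \<Sum> \<bar>k - k ze\<bar>\<close>, summed over these functions, is a conserved quantity with a strict local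
  minimum at \<open>ze\<close>: on a small sphere it is bounded below by some \<open>\<epsilon> > 0\<close>, which traps all curves
  starting near \<open>ze\<close> with \<open>\<Psi> < \<epsilon>\<close> and makes them complete.\<close>

section \<open>Calculus of smooth functions on Euclidean spaces\<close>

text \<open>Positivity on \<open>W\<close> does not make \<open>H1\<close> a Lyapunov function: off
  \<open>W\<close> its Hessian may be negative, even in directions tangent to the vanishing set. No
  penalty terms are added to repair this; a compactness argument on unit directions replaces them,
  and afterwards only continuity of \<open>\<Psi>\<close> matters, so absolute values do. Stability
  includes existence of the reduced flow for all positive times, although flows may be incomplete.
  Curves are therefore obtained from a globally Lipschitz field on the model space, whose solutions
  never end, and are then shown to stay where this field represents the Hamiltonian one. Tangent
  vectors and vector fields are abstract derivations of globally defined functions. Hadamard's lemma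
  makes them computable: near a point a smooth function is a combination of coordinate increments
  with smooth coefficients, so a derivation is fixed by finitely many values. The same expansion
  yields the chain rule along curves, the first-order limits on the level set and, applied twice,
  the Hessian.\<close>

lemma higher_differentiable_on_cong:
  assumes "open S" "\<And>x. x \<in> S \<Longrightarrow> f x = g x" "higher_differentiable_on k S f"
  shows "higher_differentiable_on k S g"
  using assms(2,3)
proof (induction k arbitrary: f g)
  case 0
  then show ?case using continuous_on_cong[OF refl 0(1)] by simp
next
  case (Suc k)
  have D: "(g has_derivative frechet_derivative f (at x)) (at x)" if "x \<in> S" for x
  proof (rule has_derivative_transform_within_open[OF _ assms(1) that Suc.prems(1)])
    show "(f has_derivative frechet_derivative f (at x)) (at x)"
      using Suc.prems(2) that frechet_derivative_works by auto
  qed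
  have "higher_differentiable_on k S (\<lambda>x. frechet_derivative g (at x) v)" for v
  proof (rule Suc.IH)
    show "higher_differentiable_on k S (\<lambda>x. frechet_derivative f (at x) v)"
      using Suc.prems(2) by simp
    show "frechet_derivative f (at x) v = frechet_derivative g (at x) v" if "x \<in> S" for x
      using frechet_derivative_at[OF D[OF that]] by simp
  qed
  moreover have "g differentiable (at x)" if "x \<in> S" for x
    using D[OF that] by (rule differentiableI)
  ultimately show ?case by simp
qed

lemma higher_differentiable_on_subset:
  "higher_differentiable_on k S f \<Longrightarrow> T \<subseteq> S \<Longrightarrow> higher_differentiable_on k T f"
  by (induction k arbitrary: f) (auto intro: continuous_on_subset)

lemma higher_differentiable_on_Suc:
  "higher_differentiable_on (Suc k) S f \<Longrightarrow> higher_differentiable_on k S f"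
proof (induction k arbitrary: f)
  case 0
  then show ?case
    by (auto intro!: continuous_at_imp_continuous_on differentiable_imp_continuous_within)
next
  case (Suc k)
  have "higher_differentiable_on k S (\<lambda>x. frechet_derivative f (at x) v)" for v
    using Suc.IH[of "\<lambda>x. frechet_derivative f (at x) v"] Suc.prems by simp
  then show ?case using Suc.prems by simp
qed

text \<open>Continuity and derivatives at a point depend only on a neighbourhood of it. This
  locality is what permits gluing functions that are smooth on different open sets.\<close>

lemma higher_differentiable_on_open_cover:
  assumes "\<And>x. x \<in> S \<Longrightarrow> \<exists>N. open N \<and> x \<in> N \<and> higher_differentiable_on k N f"
  shows "higher_differentiable_on k S f"
  using assms
proof (induction k arbitrary: f)
  case 0
  have "continuous (at x) f" if "x \<in> S" for x
    using 0[OF that] continuous_on_eq_continuous_at by auto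
  then show ?case by (simp add: continuous_at_imp_continuous_on)
next
  case (Suc k)
  have "f differentiable (at x)" if "x \<in> S" for x
    using Suc.prems[OF that] by auto
  moreover have "higher_differentiable_on k S (\<lambda>x. frechet_derivative f (at x) v)" for v
  proof (rule Suc.IH)
    show "\<exists>N. open N \<and> x \<in> N \<and> higher_differentiable_on k N (\<lambda>x. frechet_derivative f (at x) v)"
      if "x \<in> S" for x
      using Suc.prems[OF that] by auto
  qed
  ultimately show ?case by simp
qed

text \<open>In contrast to \<open>smooth_on\<close>, no local extension is involved:
  \<open>f\<close> itself has derivatives of all orders at the points of \<open>S\<close>. Local
  representatives are later cut off so as to satisfy this with \<open>S = UNIV\<close>, after which
  domains need no further care.\<close>

definition cinf_on :: "'a::euclidean_space set \<Rightarrow> ('a \<Rightarrow> 'b::real_normed_vector) \<Rightarrow> bool" where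
  "cinf_on S f \<longleftrightarrow> (\<forall>k. higher_differentiable_on k S f)"

lemma cinf_on_subset: "cinf_on S f \<Longrightarrow> T \<subseteq> S \<Longrightarrow> cinf_on T f"
  unfolding cinf_on_def using higher_differentiable_on_subset by blast

lemma cinf_on_cong:
  "open S \<Longrightarrow> (\<And>x. x \<in> S \<Longrightarrow> f x = g x) \<Longrightarrow> cinf_on S f \<Longrightarrow> cinf_on S g"
  unfolding cinf_on_def using higher_differentiable_on_cong by blast

lemma cinf_on_differentiable: "cinf_on S f \<Longrightarrow> x \<in> S \<Longrightarrow> f differentiable (at x)"
  using higher_differentiable_on.simps(2)[of 0 S f] unfolding cinf_on_def by blast

lemma cinf_on_has_derivative:
  "cinf_on S f \<Longrightarrow> x \<in> S \<Longrightarrow> (f has_derivative frechet_derivative f (at x)) (at x)"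
  using cinf_on_differentiable frechet_derivative_works by blast

lemma cinf_on_derivative: "cinf_on S f \<Longrightarrow> cinf_on S (\<lambda>x. frechet_derivative f (at x) v)"
  using higher_differentiable_on.simps(2)[of _ S f] unfolding cinf_on_def by blast

lemma cinf_on_continuous: "cinf_on S f \<Longrightarrow> continuous_on S f"
  using higher_differentiable_on.simps(1)[of S f] unfolding cinf_on_def by blast

lemma cinf_on_Un:
  "open S \<Longrightarrow> open T \<Longrightarrow> cinf_on S f \<Longrightarrow> cinf_on T f \<Longrightarrow> cinf_on (S \<union> T) f"
  unfolding cinf_on_def
  by (intro allI higher_differentiable_on_open_cover) blast

text \<open>For families given by a formula with parameters: if directional derivatives stay in the
  family, all orders follow at once, whereas an induction about one fixed member would not
  close.\<close>

lemma cinf_on_coinduct: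
  assumes "open S" "P f"
    and "\<And>g x. P g \<Longrightarrow> x \<in> S \<Longrightarrow> g differentiable (at x)"
    and "\<And>g v. P g \<Longrightarrow> \<exists>h. P h \<and> (\<forall>x\<in>S. frechet_derivative g (at x) v = h x)"
  shows "cinf_on S f"
proof -
  have "higher_differentiable_on k S g" if "P g" for k g
    using that
  proof (induction k arbitrary: g)
    case 0
    then show ?case using assms(3)
      by (auto intro!: continuous_at_imp_continuous_on differentiable_imp_continuous_within)
  next
    case (Suc k)
    have "higher_differentiable_on k S (\<lambda>x. frechet_derivative g (at x) v)" for v
    proof -
      obtain h where h: "P h" "\<forall>x\<in>S. frechet_derivative g (at x) v = h x"
        using assms(4)[OF Suc.prems] by blast
      show ?thesis
        by (rule higher_differentiable_on_cong[OF assms(1) _ Suc.IH[OF h(1)]]) (simp add: h(2))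
    qed
    then show ?case using Suc.prems assms(3) by simp
  qed
  then show ?thesis using assms(2) unfolding cinf_on_def by blast
qed

section \<open>Closure of smooth functions under algebraic operations and composition\<close>

lemma higher_differentiable_on_SucI:
  assumes "open S" "\<And>x. x \<in> S \<Longrightarrow> (f has_derivative f' x) (at x)"
    and "\<And>v. higher_differentiable_on k S (\<lambda>x. f' x v)"
  shows "higher_differentiable_on (Suc k) S f"
proof -
  have eq: "frechet_derivative f (at x) = f' x" if "x \<in> S" for x
    using assms(2)[OF that] frechet_derivative_at by fastforce
  have "higher_differentiable_on k S (\<lambda>x. frechet_derivative f (at x) v)" for v
    by (rule higher_differentiable_on_cong[OF assms(1) _ assms(3)]) (simp add: eq)
  then show ?thesis using assms(2) by (auto simp: differentiable_def)
qed

lemma higher_differentiable_on_has_derivative: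
  "higher_differentiable_on (Suc k) S f \<Longrightarrow> x \<in> S \<Longrightarrow>
    (f has_derivative frechet_derivative f (at x)) (at x)"
  using frechet_derivative_works by auto

lemma higher_differentiable_on_const: "open S \<Longrightarrow> higher_differentiable_on k S (\<lambda>x. c)"
proof (induction k arbitrary: c)
  case (Suc k)
  show ?case
    by (rule higher_differentiable_on_SucI[OF Suc.prems has_derivative_const]) (simp add: Suc)
qed simp

lemma higher_differentiable_on_bounded_linear:
  assumes "bounded_linear L" "open S"
  shows "higher_differentiable_on k S L"
proof (cases k)
  case 0
  then show ?thesis using assms by (simp add: linear_continuous_on)
next
  case (Suc j)
  show ?thesis
    unfolding Suc
    by (rule higher_differentiable_on_SucI[OF assms(2) bounded_linear_imp_has_derivative[OF assms(1)]
          higher_differentiable_on_const[OF assms(2)]])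
qed

lemma higher_differentiable_on_bounded_linear_compose:
  assumes "bounded_linear L" "open S"
  shows "higher_differentiable_on k S f \<Longrightarrow> higher_differentiable_on k S (\<lambda>x. L (f x))"
proof (induction k arbitrary: f)
  case 0
  then show ?case
    using bounded_linear.continuous_on[OF assms(1)] by simp
next
  case (Suc k)
  show ?case
  proof (rule higher_differentiable_on_SucI[OF assms(2)])
    show "((\<lambda>x. L (f x)) has_derivative (\<lambda>v. L (frechet_derivative f (at x) v))) (at x)"
      if "x \<in> S" for x
      using bounded_linear.has_derivative[OF assms(1)]
        higher_differentiable_on_has_derivative[OF Suc.prems that] by blast
    show "higher_differentiable_on k S (\<lambda>x. L (frechet_derivative f (at x) v))" for v
      using Suc by simp
  qed
qed

lemma higher_differentiable_on_add:
  assumes "open S"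
  shows "higher_differentiable_on k S f \<Longrightarrow> higher_differentiable_on k S g \<Longrightarrow>
    higher_differentiable_on k S (\<lambda>x. f x + g x)"
proof (induction k arbitrary: f g)
  case 0
  then show ?case by (simp add: continuous_on_add)
next
  case (Suc k)
  show ?case
  proof (rule higher_differentiable_on_SucI[OF assms])
    show "((\<lambda>x. f x + g x) has_derivative
        (\<lambda>v. frechet_derivative f (at x) v + frechet_derivative g (at x) v)) (at x)"
      if "x \<in> S" for x
      using Suc.prems[THEN higher_differentiable_on_has_derivative, OF that]
      by (rule has_derivative_add)
    show "higher_differentiable_on k S
        (\<lambda>x. frechet_derivative f (at x) v + frechet_derivative g (at x) v)" for v
      using Suc by simp
  qed
qed

lemma higher_differentiable_on_sum:
  assumes "open S" "finite A" "\<And>i. i \<in> A \<Longrightarrow> higher_differentiable_on k S (f i)"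
  shows "higher_differentiable_on k S (\<lambda>x. \<Sum>i\<in>A. f i x)"
  using assms(2,3)
  by (induction A rule: finite_induct)
    (simp_all add: higher_differentiable_on_const higher_differentiable_on_add assms(1))

lemma higher_differentiable_on_mult:
  fixes f g :: "'a::euclidean_space \<Rightarrow> real"
  assumes "open S"
  shows "higher_differentiable_on k S f \<Longrightarrow> higher_differentiable_on k S g \<Longrightarrow>
    higher_differentiable_on k S (\<lambda>x. f x * g x)"
proof (induction k arbitrary: f g)
  case 0
  then show ?case by (simp add: continuous_on_mult)
next
  case (Suc k)
  show ?case
  proof (rule higher_differentiable_on_SucI[OF assms])
    show "((\<lambda>x. f x * g x) has_derivative
        (\<lambda>v. f x * frechet_derivative g (at x) v + frechet_derivative f (at x) v * g x)) (at x)"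
      if "x \<in> S" for x
      using Suc.prems[THEN higher_differentiable_on_has_derivative, OF that]
      by (rule has_derivative_mult)
    show "higher_differentiable_on k S
        (\<lambda>x. f x * frechet_derivative g (at x) v + frechet_derivative f (at x) v * g x)" for v
      using Suc Suc.prems[THEN higher_differentiable_on_Suc]
      by (intro higher_differentiable_on_add assms Suc.IH) simp_all
  qed
qed

lemma higher_differentiable_on_compose:
  fixes T :: "'a::euclidean_space \<Rightarrow> 'b::euclidean_space" and F :: "'b \<Rightarrow> real"
  assumes "open S"
  shows "higher_differentiable_on k S T \<Longrightarrow> higher_differentiable_on k UNIV F \<Longrightarrow>
    higher_differentiable_on k S (\<lambda>x. F (T x))"
proof (induction k arbitrary: F)
  case 0
  then show ?case using continuous_on_compose2[of UNIV F S T] by simp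
next
  case (Suc k)
  note T = higher_differentiable_on_has_derivative[OF Suc.prems(1)]
  note F = higher_differentiable_on_has_derivative[OF Suc.prems(2) UNIV_I]
  have lin: "linear (frechet_derivative F (at y))" for y
    using F[of y] has_derivative_linear by blast
  show ?case
  proof (rule higher_differentiable_on_SucI[OF assms])
    show "((\<lambda>x. F (T x)) has_derivative
        (\<lambda>v. frechet_derivative F (at (T x)) (frechet_derivative T (at x) v))) (at x)"
      if "x \<in> S" for x
      using has_derivative_compose[OF T[OF that] F] .
    show "higher_differentiable_on k S
        (\<lambda>x. frechet_derivative F (at (T x)) (frechet_derivative T (at x) v))" for v
    proof -
      \<comment> \<open>The direction in which \<open>F\<close> is differentiated itself varies with
        \<open>x\<close>. Expanding it in \<open>Basis\<close> leaves sums of products of a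
        component of the derivative of \<open>T\<close> with a derivative of \<open>F\<close> in a
        fixed direction, composed with \<open>T\<close>; the induction hypothesis applies to the
        latter.\<close>
      have eq: "frechet_derivative F (at y) w =
          (\<Sum>b\<in>Basis. (w \<bullet> b) * frechet_derivative F (at y) b)" for y w
      proof -
        have "frechet_derivative F (at y) w =
            frechet_derivative F (at y) (\<Sum>b\<in>Basis. (w \<bullet> b) *\<^sub>R b)"
          by (simp add: euclidean_representation)
        also have "\<dots> = (\<Sum>b\<in>Basis. (w \<bullet> b) * frechet_derivative F (at y) b)"
          by (simp add: linear_sum[OF lin] linear_cmul[OF lin])
        finally show ?thesis .
      qed
      have TS: "higher_differentiable_on k S T"
        using Suc.prems(1) by (rule higher_differentiable_on_Suc)
      have dT: "higher_differentiable_on k S (\<lambda>x. frechet_derivative T (at x) v \<bullet> b)" for b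
        using Suc.prems(1)
        by (intro higher_differentiable_on_bounded_linear_compose[OF bounded_linear_inner_left assms])
          simp
      have dF: "higher_differentiable_on k S (\<lambda>x. frechet_derivative F (at (T x)) b)" for b
        using Suc.prems(2) by (intro Suc.IH[OF TS]) simp
      show ?thesis
        unfolding eq[of _ "frechet_derivative T (at _) v"]
        using dT dF by (intro higher_differentiable_on_sum higher_differentiable_on_mult assms) auto
    qed
  qed
qed

lemma higher_differentiable_on_inverse:
  fixes g :: "'a::euclidean_space \<Rightarrow> real"
  assumes "open S" "\<And>x. x \<in> S \<Longrightarrow> g x \<noteq> 0"
  shows "higher_differentiable_on k S g \<Longrightarrow> higher_differentiable_on k S (\<lambda>x. inverse (g x))"
proof (induction k)
  case 0
  then show ?case using assms by (auto intro: continuous_on_inverse)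
next
  case (Suc k)
  show ?case
  proof (rule higher_differentiable_on_SucI[OF assms(1)])
    show "((\<lambda>x. inverse (g x)) has_derivative
        (\<lambda>v. - (inverse (g x) * frechet_derivative g (at x) v * inverse (g x)))) (at x)"
      if "x \<in> S" for x
      using Deriv.has_derivative_inverse[OF assms(2)[OF that]
          higher_differentiable_on_has_derivative[OF Suc.prems that]] .
    show "higher_differentiable_on k S
        (\<lambda>x. - (inverse (g x) * frechet_derivative g (at x) v * inverse (g x)))" for v
      using Suc Suc.prems[THEN higher_differentiable_on_Suc]
      by (intro higher_differentiable_on_bounded_linear_compose[of uminus]
          higher_differentiable_on_mult assms(1) bounded_linear_minus bounded_linear_ident Suc.IH) simp_all
  qed
qed

lemma cinf_on_const: "open S \<Longrightarrow> cinf_on S (\<lambda>x. c)"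
  by (simp add: cinf_on_def higher_differentiable_on_const)

lemma cinf_on_bounded_linear: "bounded_linear L \<Longrightarrow> open S \<Longrightarrow> cinf_on S L"
  by (simp add: cinf_on_def higher_differentiable_on_bounded_linear)

lemma cinf_on_add:
  "open S \<Longrightarrow> cinf_on S f \<Longrightarrow> cinf_on S g \<Longrightarrow> cinf_on S (\<lambda>x. f x + g x)"
  by (simp add: cinf_on_def higher_differentiable_on_add)

lemma cinf_on_sum:
  "open S \<Longrightarrow> finite A \<Longrightarrow> (\<And>i. i \<in> A \<Longrightarrow> cinf_on S (f i)) \<Longrightarrow>
    cinf_on S (\<lambda>x. \<Sum>i\<in>A. f i x)"
  by (simp add: cinf_on_def higher_differentiable_on_sum)

lemma cinf_on_mult:
  fixes f g :: "'a::euclidean_space \<Rightarrow> real"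
  shows "open S \<Longrightarrow> cinf_on S f \<Longrightarrow> cinf_on S g \<Longrightarrow> cinf_on S (\<lambda>x. f x * g x)"
  by (simp add: cinf_on_def higher_differentiable_on_mult)

lemma cinf_on_compose:
  fixes T :: "'a::euclidean_space \<Rightarrow> 'b::euclidean_space" and F :: "'b \<Rightarrow> real"
  shows "open S \<Longrightarrow> cinf_on S T \<Longrightarrow> cinf_on UNIV F \<Longrightarrow> cinf_on S (\<lambda>x. F (T x))"
  by (simp add: cinf_on_def higher_differentiable_on_compose)

lemma cinf_on_inverse:
  fixes g :: "'a::euclidean_space \<Rightarrow> real"
  shows "open S \<Longrightarrow> (\<And>x. x \<in> S \<Longrightarrow> g x \<noteq> 0) \<Longrightarrow> cinf_on S g \<Longrightarrow>
    cinf_on S (\<lambda>x. inverse (g x))"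
  by (simp add: cinf_on_def higher_differentiable_on_inverse)

section \<open>Cutoff and bump functions\<close>

lemma smooth_cutoff_exists:
  "\<exists>h :: real \<Rightarrow> real. cinf_on UNIV h \<and> (\<forall>x\<le>0. h x = 0) \<and> (\<forall>x>0. h x > 0)"
proof -
  \<comment> \<open>The classical flat function is \<open>H 1\<close>. With
    \<open>s = 1 / x\<close>, differentiating \<open>p(s) exp(-s)\<close> gives
    \<open>s\<^sup>2 (p(s) - p'(s)) exp(-s)\<close>, so the polynomial prefactors make the family
    closed under derivatives.\<close>
  define H where "H p x = (if x \<le> 0 then 0 else poly p (inverse x) * exp (- inverse x))"
    for p and x :: real
  have lim: "((\<lambda>s. poly p s * exp (- s)) \<longlongrightarrow> 0) at_top" for p :: "real poly"
  proof -
    have "((\<lambda>s. \<Sum>i\<le>degree p. coeff p i * (s ^ i / exp s)) \<longlongrightarrow> (\<Sum>i\<le>degree p. coeff p i * 0)) at_top"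
      by (intro tendsto_sum tendsto_mult tendsto_const tendsto_power_div_exp_0)
    then show ?thesis
      by (simp add: poly_altdef sum_distrib_right exp_minus divide_inverse mult.assoc)
  qed
  have deriv: "(H p has_real_derivative H ([:0, 0, 1:] * (p - pderiv p)) x) (at x)" for p x
  proof -
    consider "x < 0" | "x = 0" | "x > 0" by linarith
    then show ?thesis
    proof cases
      case 1
      have "((\<lambda>x. 0) has_real_derivative 0) (at x)" by simp
      then have "(H p has_real_derivative 0) (at x)"
        by (rule has_field_derivative_transform_within_open[where S = "{..<0}"])
          (use 1 in \<open>auto simp: H_def\<close>)
      then show ?thesis using 1 by (simp add: H_def)
    next
      case 3
      have "((\<lambda>x. poly p (inverse x) * exp (- inverse x)) has_real_derivative
          H ([:0, 0, 1:] * (p - pderiv p)) x) (at x)"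
        using 3 by (auto intro!: derivative_eq_intros simp: H_def)
          (simp add: algebra_simps power2_eq_square)
      then show ?thesis
        by (rule has_field_derivative_transform_within_open[where S = "{0<..}"])
          (use 3 in \<open>auto simp: H_def\<close>)
    next
      case 2
      \<comment> \<open>The difference quotient from the right is \<open>s p(s) exp(-s)\<close>,
        which is the expression for \<open>pCons 0 p\<close>; exponential decay sends it to
        \<open>0\<close>, the value of the quotient from the left.\<close>
      have "((\<lambda>x. poly (pCons 0 p) (inverse x) * exp (- inverse x)) \<longlongrightarrow> 0) (at_right 0)"
        using filterlim_compose[OF lim filterlim_inverse_at_top_right] .
      then have R: "((\<lambda>y. (H p y - H p 0) / (y - 0)) \<longlongrightarrow> 0) (at_right 0)"
        by (rule Lim_transform_eventually)
          (auto simp: H_def field_simps intro!: eventually_at_right_less[THEN eventually_mono])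
      have L: "((\<lambda>y. (H p y - H p 0) / (y - 0)) \<longlongrightarrow> 0) (at_left 0)"
      proof (rule Lim_transform_eventually[OF tendsto_const])
        show "\<forall>\<^sub>F y in at_left 0. 0 = (H p y - H p 0) / (y - 0)"
          by (rule eventually_at_leftI[of "-1"]) (auto simp: H_def)
      qed
      have "((\<lambda>y. (H p y - H p 0) / (y - 0)) \<longlongrightarrow> 0) (at 0)"
        using L R by (simp add: filterlim_at_split)
      then show ?thesis using 2 by (simp add: has_field_derivative_iff H_def)
    qed
  qed
  have "cinf_on UNIV (H 1)"
  proof (rule cinf_on_coinduct[where P = "\<lambda>f. \<exists>p. f = H p"])
    show "\<exists>h. (\<exists>p. h = H p) \<and> (\<forall>x\<in>UNIV. frechet_derivative g (at x) v = h x)"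
      if ex: "\<exists>p. g = H p" for g v
    proof -
      obtain p where g: "g = H p" using ex by blast
      define q where "q = smult v ([:0, 0, 1:] * (p - pderiv p))"
      have "frechet_derivative g (at x) v = H q x" for x
      proof -
        have "frechet_derivative g (at x) v = H ([:0, 0, 1:] * (p - pderiv p)) x * v"
          using frechet_derivative_at[OF deriv[unfolded has_field_derivative_def], of p x] g
          by (metis (no_types))
        then show ?thesis by (simp add: H_def q_def algebra_simps)
      qed
      then show ?thesis by blast
    qed
    show "g differentiable at x" if "\<exists>p. g = H p" for g x
      using that deriv unfolding has_field_derivative_def by (metis differentiableI)
  qed auto
  then show ?thesis by (intro exI[of _ "H 1"]) (auto simp: H_def)
qed

text \<open>With \<open>d\<close> the distance to \<open>z\<close>, take \<open>h (R\<^sup>2 -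
  d\<^sup>2) / (h (R\<^sup>2 - d\<^sup>2) + h (d\<^sup>2 - r\<^sup>2))\<close>. Since
  \<open>r < R\<close>, the two terms of the denominator never vanish together. The squared distance
  is a polynomial and hence smooth at \<open>z\<close> too.\<close>

lemma smooth_bump_exists:
  fixes z :: "'a::euclidean_space"
  assumes "0 < r" "r < R"
  shows "\<exists>\<rho> :: 'a \<Rightarrow> real. cinf_on UNIV \<rho> \<and> (\<forall>x\<in>cball z r. \<rho> x = 1) \<and> (\<forall>x. x \<notin> ball z R \<longrightarrow> \<rho> x = 0)"
proof -
  obtain h :: "real \<Rightarrow> real" where h: "cinf_on UNIV h" "\<And>x. x \<le> 0 \<Longrightarrow> h x = 0" "\<And>x. x > 0 \<Longrightarrow> h x > 0"
    using smooth_cutoff_exists by blast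
  define q where "q x = (\<Sum>b\<in>Basis. (x \<bullet> b + - (z \<bullet> b)) * (x \<bullet> b + - (z \<bullet> b)))" for x :: 'a
  have q: "q x = (dist z x)\<^sup>2" for x
  proof -
    have "(x - z) \<bullet> (x - z) = (\<Sum>b\<in>Basis. ((x - z) \<bullet> b) * ((x - z) \<bullet> b))"
      by (rule euclidean_inner)
    then show ?thesis
      unfolding q_def dist_norm norm_minus_commute[of z x] power2_norm_eq_inner inner_diff_left[of x z "_ :: 'a"]
      by (simp only: diff_conv_add_uminus)
  qed
  have lin: "cinf_on UNIV (\<lambda>x :: 'a. x \<bullet> b)" for b
    by (intro cinf_on_bounded_linear bounded_linear_inner_left) auto
  have qs: "cinf_on UNIV q"
    unfolding q_def by (intro cinf_on_sum cinf_on_mult cinf_on_add cinf_on_const lin) auto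
  define u where "u x = h (R\<^sup>2 + - 1 * q x)" for x
  define w where "w x = h (q x + - (r\<^sup>2))" for x
  have us: "cinf_on UNIV u"
    unfolding u_def
    by (rule cinf_on_compose[OF _ _ h(1)], simp, intro cinf_on_add cinf_on_mult cinf_on_const qs) auto
  have ws: "cinf_on UNIV w"
    unfolding w_def
    by (rule cinf_on_compose[OF _ _ h(1)], simp, intro cinf_on_add cinf_on_const qs) auto
  have nonneg: "h t \<ge> 0" for t using h(2,3)[of t] by (cases "t \<le> 0") auto
  have u_pos: "u x > 0" if "x \<in> ball z R" for x
  proof -
    have "(dist z x)\<^sup>2 < R\<^sup>2" using that assms by (intro power_strict_mono) auto
    then show ?thesis unfolding u_def q by (intro h(3)) simp
  qed
  have w_pos: "w x > 0" if "x \<notin> cball z r" for x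
  proof -
    have "r\<^sup>2 < (dist z x)\<^sup>2" using that assms by (intro power_strict_mono) auto
    then show ?thesis unfolding w_def q by (intro h(3)) simp
  qed
  have pos: "u x + w x \<noteq> 0" for x
  proof (cases "x \<in> ball z R")
    case True
    then show ?thesis using u_pos[of x] nonneg[of "q x + - (r\<^sup>2)"] by (simp add: w_def)
  next
    case False
    then have "x \<notin> cball z r" using assms by auto
    then show ?thesis using w_pos[of x] nonneg[of "R\<^sup>2 + - 1 * q x"] by (simp add: u_def)
  qed
  define \<rho> where "\<rho> x = u x * inverse (u x + w x)" for x
  have "cinf_on UNIV \<rho>"
    unfolding \<rho>_def by (intro cinf_on_mult cinf_on_inverse cinf_on_add us ws pos) auto
  moreover have "\<rho> x = 1" if "x \<in> cball z r" for x
  proof -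
    have "(dist z x)\<^sup>2 \<le> r\<^sup>2" using that by (intro power_mono) auto
    then have "w x = 0" unfolding w_def q by (intro h(2)) simp
    then show ?thesis using pos[of x] by (simp add: \<rho>_def)
  qed
  moreover have "\<rho> x = 0" if "x \<notin> ball z R" for x
  proof -
    have "R\<^sup>2 \<le> (dist z x)\<^sup>2" using that assms by (intro power_mono) auto
    then have "u x = 0" unfolding u_def q by (intro h(2)) simp
    then show ?thesis by (simp add: \<rho>_def)
  qed
  ultimately show ?thesis by blast
qed

text \<open>The open sets \<open>S\<close> and \<open>- K\<close> cover the space; on the first the
  product is smooth, on the second it is \<open>0\<close>. Values of \<open>f\<close> outside
  \<open>S\<close> do not matter.\<close>

lemma cinf_on_bump_mult:
  fixes f \<rho> :: "'a::euclidean_space \<Rightarrow> real"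
  assumes "open S" "cinf_on S f" "cinf_on UNIV \<rho>" "closed K" "K \<subseteq> S" "\<And>x. x \<notin> K \<Longrightarrow> \<rho> x = 0"
  shows "cinf_on UNIV (\<lambda>x. \<rho> x * f x)"
proof -
  have "cinf_on (- K) (\<lambda>x. \<rho> x * f x)"
    by (rule cinf_on_cong[OF _ _ cinf_on_const[of _ 0]]) (use assms in auto)
  moreover have "cinf_on S (\<lambda>x. \<rho> x * f x)"
    using assms cinf_on_subset[OF assms(3)] by (intro cinf_on_mult) auto
  ultimately have "cinf_on (S \<union> - K) (\<lambda>x. \<rho> x * f x)"
    using assms by (intro cinf_on_Un) auto
  moreover have "S \<union> - K = UNIV" using assms(5) by blast
  ultimately show ?thesis by simp
qed

section \<open>Integral remainders and Hadamard's lemma\<close>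

lemma cinf_on_integral_segment:
  fixes f :: "'a::euclidean_space \<Rightarrow> real"
  assumes "cinf_on UNIV f"
  shows "cinf_on UNIV (\<lambda>x. integral {0..1} (\<lambda>t. t ^ j * f (z + t *\<^sub>R (x - z))))"
proof -
  \<comment> \<open>Differentiating in \<open>x\<close> under the integral produces one more factor
    \<open>t\<close>. Carrying the power \<open>t ^ j\<close> along closes the family under
    directional derivatives.\<close>
  define G where "G j f x = integral {0..1} (\<lambda>t :: real. t ^ j * f (z + t *\<^sub>R (x - z)))"
    for j and f :: "'a \<Rightarrow> real" and x
  have cont: "continuous_on A (\<lambda>p. snd p ^ i * f (z + snd p *\<^sub>R (fst p - z)))"
    if "cinf_on UNIV f" for A i and f :: "'a \<Rightarrow> real"
    by (intro continuous_intros continuous_on_compose2[OF cinf_on_continuous[OF that]]) auto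
  have int: "(\<lambda>t. t ^ i * f (z + t *\<^sub>R (x - z))) integrable_on {0..1}"
    if "cinf_on UNIV f" for x i and f :: "'a \<Rightarrow> real"
    by (intro integrable_continuous_real continuous_intros
        continuous_on_compose2[OF cinf_on_continuous[OF that]]) auto
  have deriv: "(G j f has_derivative (\<lambda>v. G (Suc j) (\<lambda>x. frechet_derivative f (at x) v) x)) (at x)"
    if "cinf_on UNIV f" for j x and f :: "'a \<Rightarrow> real"
  proof -
    \<comment> \<open>The Leibniz rule for integrals wants the derivative as a continuous family of
      bounded linear maps. In finite dimension this continuity can be tested on one vector at a
      time.\<close>
    define D where "D x t = Blinfun (\<lambda>v. t ^ Suc j * frechet_derivative f (at (z + t *\<^sub>R (x - z))) v)"
      for x and t :: real
    have bl: "bounded_linear (frechet_derivative f (at y))" for y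
      using cinf_on_has_derivative[OF that] has_derivative_bounded_linear by blast
    have D: "blinfun_apply (D x t) = (\<lambda>v. t ^ Suc j * frechet_derivative f (at (z + t *\<^sub>R (x - z))) v)"
      for x t
      unfolding D_def by (intro bounded_linear_Blinfun_apply bounded_linear_const_mult bl)
    have "((\<lambda>x. integral (cbox 0 1) (\<lambda>t. t ^ j * f (z + t *\<^sub>R (x - z)))) has_derivative
        integral (cbox 0 1) (D x)) (at x within UNIV)"
    proof (rule leibniz_rule)
      show "((\<lambda>x. t ^ j * f (z + t *\<^sub>R (x - z))) has_derivative blinfun_apply (D x t)) (at x within UNIV)"
        for x t
      proof -
        have "((\<lambda>x. z + t *\<^sub>R (x - z)) has_derivative (\<lambda>v. t *\<^sub>R v)) (at x)"
          by (auto intro!: derivative_eq_intros)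
        from has_derivative_compose[OF this cinf_on_has_derivative[OF that]]
        have "((\<lambda>x. f (z + t *\<^sub>R (x - z))) has_derivative
            (\<lambda>v. frechet_derivative f (at (z + t *\<^sub>R (x - z))) (t *\<^sub>R v))) (at x)" by simp
        then have "((\<lambda>x. t ^ j * f (z + t *\<^sub>R (x - z))) has_derivative
            (\<lambda>v. t ^ j * frechet_derivative f (at (z + t *\<^sub>R (x - z))) (t *\<^sub>R v))) (at x)"
          by (rule has_derivative_mult_right)
        then show ?thesis
          by (simp add: D linear_cmul[OF bounded_linear.linear[OF bl]] mult.assoc mult.left_commute)
      qed
      show "(\<lambda>t. t ^ j * f (z + t *\<^sub>R (x - z))) integrable_on cbox 0 1" for x
        using int[OF that] by simp
      show "continuous_on (UNIV \<times> cbox 0 1) (\<lambda>(x, t). D x t)"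
      proof (rule continuous_on_blinfun_componentwise)
        show "continuous_on (UNIV \<times> cbox 0 1) (\<lambda>p. blinfun_apply (case p of (x, t) \<Rightarrow> D x t) i)" for i
          using cont[OF cinf_on_derivative[OF that, of i], of _ "Suc j"]
          by (simp add: D split_beta)
      qed
    qed auto
    moreover have "blinfun_apply (integral (cbox 0 1) (D x)) =
        (\<lambda>v. G (Suc j) (\<lambda>x. frechet_derivative f (at x) v) x)"
    proof
      fix v
      have "D x integrable_on cbox 0 1"
      proof (rule integrable_continuous, rule continuous_on_blinfun_componentwise)
        show "continuous_on (cbox 0 1) (\<lambda>t. blinfun_apply (D x t) i)" for i
          unfolding D
          by (intro continuous_intros
              continuous_on_compose2[OF cinf_on_continuous[OF cinf_on_derivative[OF that, of i]]]) auto
      qed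
      then show "blinfun_apply (integral (cbox 0 1) (D x)) v =
          G (Suc j) (\<lambda>x. frechet_derivative f (at x) v) x"
        by (simp add: blinfun_apply_integral D G_def)
    qed
    ultimately show ?thesis by (simp add: G_def[abs_def])
  qed
  have "cinf_on UNIV (G j f)"
  proof (rule cinf_on_coinduct[where P = "\<lambda>g. \<exists>j f. cinf_on UNIV f \<and> g = G j f"])
    show "\<exists>h. (\<exists>j f. cinf_on UNIV f \<and> h = G j f) \<and> (\<forall>x\<in>UNIV. frechet_derivative g (at x) v = h x)"
      if ex: "\<exists>j f. cinf_on UNIV f \<and> g = G j f" for g v
    proof -
      obtain j f where g: "cinf_on UNIV f" "g = G j f" using ex by blast
      have "frechet_derivative g (at x) v = G (Suc j) (\<lambda>x. frechet_derivative f (at x) v) x" for x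
        unfolding g(2) frechet_derivative_at[OF deriv[OF g(1)], symmetric] ..
      then show ?thesis using cinf_on_derivative[OF g(1)] by blast
    qed
    show "g differentiable at x" if "\<exists>j f. cinf_on UNIV f \<and> g = G j f" for g x
      using that deriv differentiableI by blast
  qed (use assms in auto)
  then show ?thesis by (simp add: G_def[abs_def])
qed

text \<open>Integrate the derivative of \<open>f\<close> along the segment from \<open>z\<close> to
  \<open>x\<close> and expand \<open>x - z\<close> in the orthonormal set \<open>Bs\<close>; the
  coefficients are integrals of directional derivatives. The expansion is confined to
  \<open>span Bs\<close> because the model space of a manifold may be a proper subspace.\<close>

lemma Hadamard_lemma:
  fixes f :: "'a::euclidean_space \<Rightarrow> real"
  assumes "cinf_on UNIV f" "finite Bs" "pairwise orthogonal Bs" "\<And>b. b \<in> Bs \<Longrightarrow> norm b = 1"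
  shows "\<exists>g. (\<forall>b. cinf_on UNIV (g b)) \<and> (\<forall>x. x - z \<in> span Bs \<longrightarrow> f x = f z + (\<Sum>b\<in>Bs. ((x - z) \<bullet> b) * g b x))"
proof -
  define g where "g b x = integral {0..1} (\<lambda>t. t ^ 0 * frechet_derivative f (at (z + t *\<^sub>R (x - z))) b)" for b x
  have "cinf_on UNIV (g b)" for b
    unfolding g_def by (rule cinf_on_integral_segment[OF cinf_on_derivative[OF assms(1)]])
  moreover have "f x = f z + (\<Sum>b\<in>Bs. ((x - z) \<bullet> b) * g b x)" if "x - z \<in> span Bs" for x
  proof -
    have exp: "x - z = (\<Sum>b\<in>Bs. ((x - z) \<bullet> b) *\<^sub>R b)"
      using orthonormal_basis_expand[OF assms(3,4) that assms(2)] by simp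
    have lin: "linear (frechet_derivative f (at y))" for y
      using cinf_on_has_derivative[OF assms(1)] has_derivative_linear by blast
    have D: "frechet_derivative f (at y) (x - z) = (\<Sum>b\<in>Bs. ((x - z) \<bullet> b) * frechet_derivative f (at y) b)" for y
    proof -
      have "frechet_derivative f (at y) (x - z) =
          frechet_derivative f (at y) (\<Sum>b\<in>Bs. ((x - z) \<bullet> b) *\<^sub>R b)" using exp by simp
      also have "\<dots> = (\<Sum>b\<in>Bs. ((x - z) \<bullet> b) * frechet_derivative f (at y) b)"
        by (simp add: linear_sum[OF lin] linear_cmul[OF lin])
      finally show ?thesis .
    qed
    have "((\<lambda>t. f (z + t *\<^sub>R (x - z))) has_vector_derivative frechet_derivative f (at (z + t *\<^sub>R (x - z))) (x - z))
        (at t within {0..1})" for t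
    proof -
      have "((\<lambda>t. z + t *\<^sub>R (x - z)) has_derivative (\<lambda>s. s *\<^sub>R (x - z))) (at t within {0..1})"
        by (auto intro!: derivative_eq_intros)
      from has_derivative_compose[OF this cinf_on_has_derivative[OF assms(1) UNIV_I]]
      show ?thesis by (simp add: has_vector_derivative_def linear_cmul[OF lin])
    qed
    then have "((\<lambda>t. frechet_derivative f (at (z + t *\<^sub>R (x - z))) (x - z)) has_integral
        f (z + 1 *\<^sub>R (x - z)) - f (z + 0 *\<^sub>R (x - z))) {0..1}"
      by (intro fundamental_theorem_of_calculus) auto
    then have "f x - f z = integral {0..1} (\<lambda>t. \<Sum>b\<in>Bs. ((x - z) \<bullet> b) * frechet_derivative f (at (z + t *\<^sub>R (x - z))) b)"
      unfolding D by (simp add: integral_unique)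
    also have "\<dots> = (\<Sum>b\<in>Bs. ((x - z) \<bullet> b) * g b x)"
    proof -
      have "(\<lambda>t. frechet_derivative f (at (z + t *\<^sub>R (x - z))) b) integrable_on {0..1}" for b
        by (intro integrable_continuous_real continuous_intros
            continuous_on_compose2[OF cinf_on_continuous[OF cinf_on_derivative[OF assms(1), of b]]]) auto
      then show ?thesis
        by (subst integral_sum) (auto simp: assms(2) g_def intro!: integrable_on_mult_right)
    qed
    finally show ?thesis by simp
  qed
  ultimately show ?thesis by blast
qed

section \<open>Local structure of smooth manifolds\<close>

locale manifold =
  fixes E :: "'e::euclidean_space set"
    and A :: "('a::{t2_space,second_countable_topology}, 'e) chart set"
  assumes smooth_manifold: "smooth_manifold E A"
begin

abbreviation \<F> :: "('a \<Rightarrow> real) set" where "\<F> \<equiv> smooth_functions A"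

lemma subspace_E: "subspace E"
  using smooth_manifold by (simp add: smooth_manifold_def)

text \<open>Coordinates are taken with respect to an orthonormal basis of the model space
  \<open>E\<close>, not of the ambient type. In dimension zero \<open>Bs\<close> is empty and all
  coordinate sums vanish.\<close>

definition Bs :: "'e set" where
  "Bs = (SOME B. B \<subseteq> E \<and> pairwise orthogonal B \<and> (\<forall>x\<in>B. norm x = 1) \<and> finite B \<and> span B = E)"

lemma Bs: "Bs \<subseteq> E" "pairwise orthogonal Bs" "\<And>b. b \<in> Bs \<Longrightarrow> norm b = 1" "finite Bs" "span Bs = E"
proof -
  have "\<exists>B. B \<subseteq> E \<and> pairwise orthogonal B \<and> (\<forall>x\<in>B. norm x = 1) \<and> finite B \<and> span B = E"
    using orthonormal_basis_subspace[OF subspace_E] independent_imp_finite by metis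
  from someI_ex[OF this, folded Bs_def]
  show "Bs \<subseteq> E" "pairwise orthogonal Bs" "\<And>b. b \<in> Bs \<Longrightarrow> norm b = 1" "finite Bs" "span Bs = E"
    by auto
qed

lemma Bs_expand: "y \<in> E \<Longrightarrow> (\<Sum>b\<in>Bs. (y \<bullet> b) *\<^sub>R b) = y"
  using orthonormal_basis_expand[OF Bs(2,3) _ Bs(4)] Bs(5) by simp

lemma chart:
  assumes "(U, \<phi>) \<in> A"
  shows chart_open: "open U"
    and chart_openin: "openin (top_of_set E) (\<phi> ` U)"
    and chart_inj: "inj_on \<phi> U"
    and chart_cont: "continuous_on U \<phi>"
    and chart_cont_inv: "continuous_on (\<phi> ` U) (inv_into U \<phi>)"
    and chart_homeo: "homeomorphism U (\<phi> ` U) \<phi> (inv_into U \<phi>)"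
proof -
  have c: "is_chart E (U, \<phi>)" using assms smooth_manifold by (auto simp: smooth_manifold_def)
  then show "open U" "openin (top_of_set E) (\<phi> ` U)" by (auto simp: is_chart_def)
  obtain \<psi> where \<psi>: "homeomorphism U (\<phi> ` U) \<phi> \<psi>" using c by (auto simp: is_chart_def)
  show inj: "inj_on \<phi> U" using \<psi> by (metis homeomorphism_apply1 inj_onI)
  show cont: "continuous_on U \<phi>" using \<psi> homeomorphism_cont1 by blast
  have "inv_into U \<phi> y = \<psi> y" if "y \<in> \<phi> ` U" for y
    using \<psi> inj that by (auto simp: homeomorphism_apply1)
  then show inv: "continuous_on (\<phi> ` U) (inv_into U \<phi>)"
    using homeomorphism_cont2[OF \<psi>] by (simp cong: continuous_on_cong)
  show "homeomorphism U (\<phi> ` U) \<phi> (inv_into U \<phi>)"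
    using inj cont inv by (auto simp: homeomorphism_def f_inv_into_f)
qed

lemma chart_in_E: "(U, \<phi>) \<in> A \<Longrightarrow> x \<in> U \<Longrightarrow> \<phi> x \<in> E"
  using chart_openin openin_imp_subset by fastforce

lemma chart_inv: "(U, \<phi>) \<in> A \<Longrightarrow> x \<in> U \<Longrightarrow> inv_into U \<phi> (\<phi> x) = x"
  using chart_inj by simp

lemma chart_exists: "\<exists>U \<phi>. (U, \<phi>) \<in> A \<and> p \<in> U"
  using smooth_manifold unfolding smooth_manifold_def by (metis UNIV_I UN_E prod.collapse)

lemma chart_preimage_open: "(U, \<phi>) \<in> A \<Longrightarrow> open S \<Longrightarrow> open (U \<inter> \<phi> -` S)"
  using chart_cont chart_open continuous_open_preimage by blast

lemma chart_image_open:
  assumes "(U, \<phi>) \<in> A" "open V" "V \<subseteq> U"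
  shows "\<exists>S. open S \<and> \<phi> ` V = E \<inter> S"
proof -
  have "openin (top_of_set U) V" using assms chart_open[OF assms(1)] openin_open_eq by blast
  then have "openin (top_of_set (\<phi> ` U)) (\<phi> ` V)"
    using homeomorphism_imp_open_map[OF chart_homeo[OF assms(1)]] by blast
  then have "openin (top_of_set E) (\<phi> ` V)"
    using chart_openin[OF assms(1)] openin_trans by blast
  then show ?thesis by (auto simp: openin_open)
qed

lemma chart_image_ball:
  assumes "(U, \<phi>) \<in> A" "open V" "V \<subseteq> U" "p \<in> V"
  shows "\<exists>\<delta>>0. \<forall>y\<in>E. dist (\<phi> p) y \<le> \<delta> \<longrightarrow> y \<in> \<phi> ` V"
proof -
  obtain S where S: "open S" "\<phi> ` V = E \<inter> S" using chart_image_open[OF assms(1-3)] by blast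
  then have "\<phi> p \<in> S" using assms(4) by blast
  then obtain \<delta> where "\<delta> > 0" "cball (\<phi> p) \<delta> \<subseteq> S" using S(1) open_contains_cball by blast
  then show ?thesis using S(2) by (intro exI[of _ \<delta>]) auto
qed

text \<open>Multiplying the local extension by a bump makes it smooth on the whole model space, at
  the price of a smaller neighbourhood \<open>V\<close> of \<open>p\<close>.\<close>

lemma smooth_local_rep:
  assumes "f \<in> \<F>" "(U, \<phi>) \<in> A" "p \<in> U"
  obtains F V where "cinf_on UNIV F" "open V" "p \<in> V" "V \<subseteq> U" "\<And>x. x \<in> V \<Longrightarrow> f x = F (\<phi> x)"
proof -
  have "smooth_on (\<phi> ` U) (f \<circ> inv_into U \<phi>)" using assms by (auto simp: smooth_functions_def)
  then obtain N F where N: "open N" "\<phi> p \<in> N" "cinf_on N F"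
      "\<And>y. y \<in> \<phi> ` U \<inter> N \<Longrightarrow> F y = (f \<circ> inv_into U \<phi>) y"
    using assms(3) unfolding smooth_on_def cinf_on_def by (metis image_eqI)
  obtain \<delta> where \<delta>: "\<delta> > 0" "cball (\<phi> p) \<delta> \<subseteq> N" using N(1,2) open_contains_cball by blast
  obtain \<rho> :: "'e \<Rightarrow> real" where \<rho>: "cinf_on UNIV \<rho>" "\<And>y. y \<in> cball (\<phi> p) (\<delta>/2) \<Longrightarrow> \<rho> y = 1"
      "\<And>y. y \<notin> ball (\<phi> p) \<delta> \<Longrightarrow> \<rho> y = 0"
    using smooth_bump_exists[of "\<delta>/2" \<delta> "\<phi> p"] \<delta> by auto
  show thesis
  proof
    show "cinf_on UNIV (\<lambda>y. \<rho> y * F y)"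
      by (rule cinf_on_bump_mult[OF N(1,3) \<rho>(1) closed_cball \<delta>(2)]) (use \<rho>(3) in auto)
    show "open (U \<inter> \<phi> -` ball (\<phi> p) (\<delta>/2))"
      using chart_preimage_open[OF assms(2) open_ball] .
    show "p \<in> U \<inter> \<phi> -` ball (\<phi> p) (\<delta>/2)" using assms(3) \<delta> by simp
    show "f x = \<rho> (\<phi> x) * F (\<phi> x)" if "x \<in> U \<inter> \<phi> -` ball (\<phi> p) (\<delta>/2)" for x
    proof -
      have "\<phi> x \<in> N" using that \<delta> by auto
      then have "F (\<phi> x) = f x" using N(4)[of "\<phi> x"] that chart_inv[OF assms(2)] by auto
      moreover have "\<rho> (\<phi> x) = 1" using that by (intro \<rho>(2)) auto
      ultimately show ?thesis by simp
    qed
  qed auto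
qed

text \<open>One chart around each point is enough, since in any other chart the function is the
  given representative composed with a transition map, which is smooth by compatibility.\<close>

lemma smoothI:
  assumes "\<And>p. \<exists>U \<phi> F V. (U, \<phi>) \<in> A \<and> cinf_on UNIV F \<and> open V \<and> p \<in> V \<and> V \<subseteq> U \<and> (\<forall>x\<in>V. f x = F (\<phi> x))"
  shows "f \<in> \<F>"
proof -
  have "smooth_on (\<phi>' ` U') (f \<circ> inv_into U' \<phi>')" if c': "(U', \<phi>') \<in> A" for U' \<phi>'
    unfolding smooth_on_def
  proof
    fix y assume "y \<in> \<phi>' ` U'"
    then obtain p where p: "p \<in> U'" "y = \<phi>' p" by blast
    obtain U \<phi> F V where F: "(U, \<phi>) \<in> A" "cinf_on UNIV F" "open V" "p \<in> V" "V \<subseteq> U"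
        "\<And>x. x \<in> V \<Longrightarrow> f x = F (\<phi> x)"
      using assms[of p] by blast
    have "compatible_charts (U', \<phi>') (U, \<phi>)"
      using smooth_manifold c' F(1) unfolding smooth_manifold_def by blast
    then have "smooth_on (\<phi>' ` (U' \<inter> U)) (\<phi> \<circ> inv_into U' \<phi>')"
      by (simp add: compatible_charts_def)
    moreover have "y \<in> \<phi>' ` (U' \<inter> U)" using p F(4,5) by blast
    ultimately obtain N T where N: "open N" "y \<in> N" "cinf_on N T"
        "\<And>w. w \<in> \<phi>' ` (U' \<inter> U) \<inter> N \<Longrightarrow> T w = (\<phi> \<circ> inv_into U' \<phi>') w"
      unfolding smooth_on_def cinf_on_def by metis
    \<comment> \<open>Inside \<open>S\<close>, every point of the chart image comes from
      \<open>V\<close>. There \<open>T\<close> is the transition map and \<open>F\<close> represents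
      \<open>f\<close>.\<close>
    obtain S where S: "open S" "\<phi>' ` (V \<inter> U') = E \<inter> S"
      using chart_image_open[OF c', of "V \<inter> U'"] F(3) chart_open[OF c'] by auto
    have "y \<in> S" using S(2) p F(4) by blast
    moreover have "cinf_on (N \<inter> S) (\<lambda>w. F (T w))"
      using N(1) S(1) cinf_on_subset[OF N(3)] by (intro cinf_on_compose[OF _ _ F(2)]) auto
    moreover have "F (T w) = (f \<circ> inv_into U' \<phi>') w" if w: "w \<in> \<phi>' ` U' \<inter> (N \<inter> S)" for w
    proof -
      have "w \<in> E" using w chart_in_E[OF c'] by blast
      then obtain x where x: "x \<in> V \<inter> U'" "w = \<phi>' x" using S(2) w by blast
      then have "T w = \<phi> x" using N(4)[of w] w F(5) chart_inv[OF c'] by auto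
      then show ?thesis using x F(6) chart_inv[OF c'] by auto
    qed
    ultimately show "\<exists>N F. open N \<and> y \<in> N \<and> (\<forall>k. higher_differentiable_on k N F) \<and>
        (\<forall>w\<in>\<phi>' ` U' \<inter> N. F w = (f \<circ> inv_into U' \<phi>') w)"
      using N(1,2) S(1) unfolding cinf_on_def
      by (intro exI[of _ "N \<inter> S"] exI[of _ "\<lambda>w. F (T w)"]) auto
  qed
  then show ?thesis by (auto simp: smooth_functions_def)
qed

section \<open>The algebra of smooth functions and its bump functions\<close>

lemma smooth_const: "(\<lambda>x. c) \<in> \<F>"
proof (rule smoothI)
  fix p
  obtain U \<phi> where "(U, \<phi>) \<in> A" "p \<in> U" using chart_exists by blast
  then show "\<exists>U \<phi> F V. (U, \<phi>) \<in> A \<and> cinf_on UNIV F \<and> open V \<and> p \<in> V \<and> V \<subseteq> U \<and> (\<forall>x\<in>V. c = F (\<phi> x))"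
    using chart_open cinf_on_const[of UNIV c]
    by (intro exI[of _ U] exI[of _ \<phi>] exI[of _ "\<lambda>_. c"] exI[of _ U]) auto
qed

lemma smooth_binop:
  assumes bop: "\<And>F G :: 'e \<Rightarrow> real. cinf_on UNIV F \<Longrightarrow> cinf_on UNIV G \<Longrightarrow> cinf_on UNIV (\<lambda>y. bop (F y) (G y))"
    and f: "f \<in> \<F>" and g: "g \<in> \<F>"
  shows "(\<lambda>x. bop (f x) (g x)) \<in> \<F>"
proof (rule smoothI)
  fix p
  obtain U \<phi> where c: "(U, \<phi>) \<in> A" "p \<in> U" using chart_exists by blast
  obtain F V where F: "cinf_on UNIV F" "open V" "p \<in> V" "V \<subseteq> U" "\<And>x. x \<in> V \<Longrightarrow> f x = F (\<phi> x)"
    using smooth_local_rep[OF f c] by blast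
  obtain G V' where G: "cinf_on UNIV G" "open V'" "p \<in> V'" "V' \<subseteq> U" "\<And>x. x \<in> V' \<Longrightarrow> g x = G (\<phi> x)"
    using smooth_local_rep[OF g c] by blast
  show "\<exists>U \<phi> F V. (U, \<phi>) \<in> A \<and> cinf_on UNIV F \<and> open V \<and> p \<in> V \<and> V \<subseteq> U \<and>
      (\<forall>x\<in>V. bop (f x) (g x) = F (\<phi> x))"
    using c F G bop[OF F(1) G(1)]
    by (intro exI[of _ U] exI[of _ \<phi>] exI[of _ "\<lambda>y. bop (F y) (G y)"] exI[of _ "V \<inter> V'"]) auto
qed

lemma smooth_add: "f \<in> \<F> \<Longrightarrow> g \<in> \<F> \<Longrightarrow> (\<lambda>x. f x + g x) \<in> \<F>"
  using smooth_binop[of "(+)"] cinf_on_add by blast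

lemma smooth_mult: "f \<in> \<F> \<Longrightarrow> g \<in> \<F> \<Longrightarrow> (\<lambda>x. f x * g x) \<in> \<F>"
  using smooth_binop[of "(*)"] cinf_on_mult by blast

lemma smooth_diff: "f \<in> \<F> \<Longrightarrow> g \<in> \<F> \<Longrightarrow> (\<lambda>x. f x - g x) \<in> \<F>"
  using smooth_add[of f "\<lambda>x. - 1 * g x"] smooth_mult[OF smooth_const, of g "- 1"] by simp

lemma smooth_sum: "finite K \<Longrightarrow> (\<And>k. k \<in> K \<Longrightarrow> f k \<in> \<F>) \<Longrightarrow> (\<lambda>x. \<Sum>k\<in>K. f k x) \<in> \<F>"
  by (induction K rule: finite_induct) (auto intro: smooth_const smooth_add)

lemma smooth_continuous: "f \<in> \<F> \<Longrightarrow> continuous_on S f"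
proof -
  assume f: "f \<in> \<F>"
  have "continuous (at p) f" for p
  proof -
    obtain U \<phi> where c: "(U, \<phi>) \<in> A" "p \<in> U" using chart_exists by blast
    obtain F V where F: "cinf_on UNIV F" "open V" "p \<in> V" "V \<subseteq> U" "\<And>x. x \<in> V \<Longrightarrow> f x = F (\<phi> x)"
      using smooth_local_rep[OF f c] by blast
    have "continuous_on V (\<lambda>x. F (\<phi> x))"
      by (rule continuous_on_compose2[OF cinf_on_continuous[OF F(1)]])
        (use chart_cont[OF c(1)] F(4) continuous_on_subset in auto)
    then have "continuous_on V f" using F(5) by (simp cong: continuous_on_cong)
    then show ?thesis using F(2,3) continuous_on_eq_continuous_at by blast
  qed
  then show ?thesis by (simp add: continuous_at_imp_continuous_on)
qed

text \<open>The closed set \<open>K\<close> is the compact support of the bump; it is closed because the space is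
  Hausdorff, and this is what makes the extension by \<open>0\<close> smooth.\<close>

lemma bump_in_chart:
  assumes "(U, \<phi>) \<in> A" "open W" "p \<in> W" "W \<subseteq> U"
  obtains \<rho> :: "'e \<Rightarrow> real" and K V where "cinf_on UNIV \<rho>" "closed K" "K \<subseteq> W" "open V" "p \<in> V" "V \<subseteq> W"
    "\<And>x. x \<in> V \<Longrightarrow> \<rho> (\<phi> x) = 1" "\<And>x. x \<in> U - K \<Longrightarrow> \<rho> (\<phi> x) = 0"
proof -
  obtain \<delta> where \<delta>: "\<delta> > 0" "\<And>y. y \<in> E \<Longrightarrow> dist (\<phi> p) y \<le> \<delta> \<Longrightarrow> y \<in> \<phi> ` W"
    using chart_image_ball[OF assms(1,2,4,3)] by blast
  obtain \<rho> :: "'e \<Rightarrow> real" where \<rho>: "cinf_on UNIV \<rho>" "\<And>y. y \<in> cball (\<phi> p) (\<delta>/2) \<Longrightarrow> \<rho> y = 1"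
      "\<And>y. y \<notin> ball (\<phi> p) \<delta> \<Longrightarrow> \<rho> y = 0"
    using smooth_bump_exists[of "\<delta>/2" \<delta> "\<phi> p"] \<delta> by auto
  define K where "K = inv_into U \<phi> ` (cball (\<phi> p) \<delta> \<inter> E)"
  have sub: "cball (\<phi> p) \<delta> \<inter> E \<subseteq> \<phi> ` W" using \<delta>(2) by auto
  show thesis
  proof
    show "cinf_on UNIV \<rho>" by fact
    have "compact (cball (\<phi> p) \<delta> \<inter> E)"
      by (intro compact_Int_closed compact_cball closed_subspace subspace_E)
    moreover have "continuous_on (cball (\<phi> p) \<delta> \<inter> E) (inv_into U \<phi>)"
      using continuous_on_subset[OF chart_cont_inv[OF assms(1)]] sub assms(4) by blast
    ultimately show "closed K" unfolding K_def
      by (intro compact_imp_closed compact_continuous_image)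
    show "K \<subseteq> W"
    proof
      fix x assume "x \<in> K"
      then obtain w where "w \<in> W" "x = inv_into U \<phi> (\<phi> w)" using sub unfolding K_def by auto
      then show "x \<in> W" using chart_inv[OF assms(1)] assms(4) by auto
    qed
    show "open (W \<inter> (U \<inter> \<phi> -` ball (\<phi> p) (\<delta>/2)))"
      using chart_preimage_open[OF assms(1) open_ball] assms(2) by blast
    show "p \<in> W \<inter> (U \<inter> \<phi> -` ball (\<phi> p) (\<delta>/2))" using assms \<delta> by auto
    show "\<rho> (\<phi> x) = 1" if "x \<in> W \<inter> (U \<inter> \<phi> -` ball (\<phi> p) (\<delta>/2))" for x
      using that by (intro \<rho>(2)) auto
    show "\<rho> (\<phi> x) = 0" if "x \<in> U - K" for x
    proof (rule \<rho>(3), rule notI)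
      assume "\<phi> x \<in> ball (\<phi> p) \<delta>"
      then have "inv_into U \<phi> (\<phi> x) \<in> K"
        unfolding K_def using chart_in_E[OF assms(1)] that by (intro imageI) auto
      then show False using that chart_inv[OF assms(1)] by auto
    qed
  qed auto
qed

text \<open>A point outside \<open>U\<close> has the complement of the closed set \<open>K\<close>
  as a neighbourhood, and there the function is constantly \<open>0\<close>.\<close>

lemma smooth_extend_zero:
  assumes c: "(U, \<phi>) \<in> A" and K: "closed K" "K \<subseteq> U" and zero: "\<And>x. x \<notin> K \<Longrightarrow> g x = 0"
    and loc: "\<And>p. p \<in> U \<Longrightarrow> \<exists>F V. cinf_on UNIV F \<and> open V \<and> p \<in> V \<and> V \<subseteq> U \<and> (\<forall>x\<in>V. g x = F (\<phi> x))"
  shows "g \<in> \<F>"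
proof (rule smoothI)
  fix p
  show "\<exists>U \<phi> F V. (U, \<phi>) \<in> A \<and> cinf_on UNIV F \<and> open V \<and> p \<in> V \<and> V \<subseteq> U \<and> (\<forall>x\<in>V. g x = F (\<phi> x))"
  proof (cases "p \<in> U")
    case True
    then show ?thesis using loc[OF True] c by blast
  next
    case False
    obtain U' \<phi>' where "(U', \<phi>') \<in> A" "p \<in> U'" using chart_exists by blast
    then show ?thesis
      using chart_open zero K False cinf_on_const[of UNIV 0]
      by (intro exI[of _ U'] exI[of _ \<phi>'] exI[of _ "\<lambda>_. 0"] exI[of _ "U' \<inter> - K"]) auto
  qed
qed

text \<open>The neighbourhood \<open>V\<close> comes from the bump alone and precedes
  \<open>F\<close>. One \<open>V\<close> thus serves a whole family of functions, such as all
  coordinates at once.\<close>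

lemma smooth_globalize:
  assumes c: "(U, \<phi>) \<in> A" "open W" "p \<in> W" "W \<subseteq> U"
  obtains V where "open V" "p \<in> V" "V \<subseteq> W"
    "\<And>F. cinf_on UNIV F \<Longrightarrow> \<exists>g\<in>\<F>. (\<forall>x\<in>V. g x = F (\<phi> x)) \<and> (\<forall>x. x \<notin> W \<longrightarrow> g x = 0)"
proof -
  obtain \<rho> :: "'e \<Rightarrow> real" and K V where \<rho>: "cinf_on UNIV \<rho>" "closed K" "K \<subseteq> W" "open V" "p \<in> V" "V \<subseteq> W"
    "\<And>x. x \<in> V \<Longrightarrow> \<rho> (\<phi> x) = 1" "\<And>x. x \<in> U - K \<Longrightarrow> \<rho> (\<phi> x) = 0"
    using bump_in_chart[OF assms] by blast
  have "\<exists>g\<in>\<F>. (\<forall>x\<in>V. g x = F (\<phi> x)) \<and> (\<forall>x. x \<notin> W \<longrightarrow> g x = 0)" if F: "cinf_on UNIV F" for F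
  proof (intro bexI conjI)
    define g where "g x = (if x \<in> U then \<rho> (\<phi> x) * F (\<phi> x) else 0)" for x
    show "\<forall>x\<in>V. g x = F (\<phi> x)" using \<rho> assms by (auto simp: g_def)
    show "\<forall>x. x \<notin> W \<longrightarrow> g x = 0" using \<rho> by (auto simp: g_def)
    show "g \<in> \<F>"
    proof (rule smooth_extend_zero[OF c(1) \<rho>(2)])
      show "K \<subseteq> U" using \<rho> assms by blast
      show "g x = 0" if "x \<notin> K" for x using that \<rho> by (auto simp: g_def)
      show "\<exists>F V. cinf_on UNIV F \<and> open V \<and> p \<in> V \<and> V \<subseteq> U \<and> (\<forall>x\<in>V. g x = F (\<phi> x))" if "p \<in> U" for p
        using that chart_open[OF c(1)] cinf_on_mult[OF _ \<rho>(1) F]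
        by (intro exI[of _ "\<lambda>y. \<rho> y * F y"] exI[of _ U]) (auto simp: g_def)
    qed
  qed
  then show thesis using that \<rho> by blast
qed

lemma smooth_bump:
  assumes "open W" "p \<in> W"
  obtains \<theta> V where "\<theta> \<in> \<F>" "open V" "p \<in> V" "V \<subseteq> W" "\<And>x. x \<in> V \<Longrightarrow> \<theta> x = 1" "\<And>x. x \<notin> W \<Longrightarrow> \<theta> x = 0"
proof -
  obtain U \<phi> where c: "(U, \<phi>) \<in> A" "p \<in> U" using chart_exists by blast
  obtain V where V: "open V" "p \<in> V" "V \<subseteq> W \<inter> U"
    "\<And>F. cinf_on UNIV F \<Longrightarrow> \<exists>g\<in>\<F>. (\<forall>x\<in>V. g x = F (\<phi> x)) \<and> (\<forall>x. x \<notin> W \<inter> U \<longrightarrow> g x = 0)"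
    using smooth_globalize[OF c(1), of "W \<inter> U" p] assms c chart_open[OF c(1)] by auto
  then show thesis using that V(4)[OF cinf_on_const[of UNIV 1]] by force
qed

definition coordinates :: "'a set \<Rightarrow> ('a \<Rightarrow> 'e) \<Rightarrow> 'a set \<Rightarrow> ('e \<Rightarrow> 'a \<Rightarrow> real) \<Rightarrow> bool" where
  "coordinates U \<phi> V \<xi> \<longleftrightarrow> (U, \<phi>) \<in> A \<and> open V \<and> V \<subseteq> U \<and>
     (\<forall>b. \<xi> b \<in> \<F> \<and> (\<forall>x\<in>V. \<xi> b x = \<phi> x \<bullet> b))"

lemma coordinates_exist:
  obtains U \<phi> V \<xi> where "coordinates U \<phi> V \<xi>" "p \<in> V"
proof -
  obtain U \<phi> where c: "(U, \<phi>) \<in> A" "p \<in> U" using chart_exists by blast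
  obtain V where V: "open V" "p \<in> V" "V \<subseteq> U"
    "\<And>F. cinf_on UNIV F \<Longrightarrow> \<exists>g\<in>\<F>. (\<forall>x\<in>V. g x = F (\<phi> x)) \<and> (\<forall>x. x \<notin> U \<longrightarrow> g x = 0)"
    using smooth_globalize[OF c(1) chart_open[OF c(1)] c(2)] by auto
  have "\<forall>b. \<exists>g. g \<in> \<F> \<and> (\<forall>x\<in>V. g x = \<phi> x \<bullet> b)"
    using V(4)[OF cinf_on_bounded_linear[OF bounded_linear_inner_left open_UNIV]] by blast
  then obtain \<xi> where "\<forall>b. \<xi> b \<in> \<F> \<and> (\<forall>x\<in>V. \<xi> b x = \<phi> x \<bullet> b)" by metis
  then show thesis using that[of U \<phi> V \<xi>] V c by (auto simp: coordinates_def)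
qed

lemma coordinates_subset:
  "coordinates U \<phi> V \<xi> \<Longrightarrow> open V' \<Longrightarrow> V' \<subseteq> V \<Longrightarrow> coordinates U \<phi> V' \<xi>"
  by (auto simp: coordinates_def)

text \<open>The Euclidean lemma is applied to a chart representative and its coefficients are
  globalised, so that derivations can be applied to every term. The base point \<open>q\<close> may
  be any point of \<open>V\<close>.\<close>

lemma Hadamard_coordinates:
  assumes "coordinates U \<phi> V \<xi>" "q \<in> V" "f \<in> \<F>"
  obtains g V' where "\<And>b. g b \<in> \<F>" "open V'" "q \<in> V'" "V' \<subseteq> V"
    "\<And>x. x \<in> V' \<Longrightarrow> f x = f q + (\<Sum>b\<in>Bs. (\<xi> b x - \<xi> b q) * g b x)"
proof -
  have c: "(U, \<phi>) \<in> A" "open V" "V \<subseteq> U" and \<xi>: "\<And>b. \<xi> b \<in> \<F>" "\<And>b x. x \<in> V \<Longrightarrow> \<xi> b x = \<phi> x \<bullet> b"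
    using assms(1) by (auto simp: coordinates_def)
  obtain F V1 where F: "cinf_on UNIV F" "open V1" "q \<in> V1" "V1 \<subseteq> U" "\<And>x. x \<in> V1 \<Longrightarrow> f x = F (\<phi> x)"
    using smooth_local_rep[OF assms(3) c(1)] assms(2) c(3) by blast
  obtain G where G: "\<And>b. cinf_on UNIV (G b)"
      "\<And>y. y - \<phi> q \<in> span Bs \<Longrightarrow> F y = F (\<phi> q) + (\<Sum>b\<in>Bs. ((y - \<phi> q) \<bullet> b) * G b y)"
    using Hadamard_lemma[OF F(1) Bs(4,2,3), of "\<phi> q"] by blast
  obtain V2 where V2: "open V2" "q \<in> V2" "V2 \<subseteq> V1 \<inter> V"
    "\<And>F. cinf_on UNIV F \<Longrightarrow> \<exists>g\<in>\<F>. (\<forall>x\<in>V2. g x = F (\<phi> x)) \<and> (\<forall>x. x \<notin> V1 \<inter> V \<longrightarrow> g x = 0)"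
    using smooth_globalize[OF c(1), of "V1 \<inter> V" q] F assms(2) c by blast
  have "\<forall>b. \<exists>g. g \<in> \<F> \<and> (\<forall>x\<in>V2. g x = G b (\<phi> x))" using V2(4)[OF G(1)] by blast
  then obtain g where g: "\<And>b. g b \<in> \<F>" "\<And>b x. x \<in> V2 \<Longrightarrow> g b x = G b (\<phi> x)" by metis
  show thesis
  proof (rule that[OF g(1) V2(1,2)])
    show "V2 \<subseteq> V" using V2 by blast
    show "f x = f q + (\<Sum>b\<in>Bs. (\<xi> b x - \<xi> b q) * g b x)" if "x \<in> V2" for x
    proof -
      have x: "x \<in> V1" "x \<in> V" using that V2(3) by auto
      have "\<phi> x - \<phi> q \<in> span Bs"
        unfolding Bs(5) using chart_in_E[OF c(1)] x assms(2) c(3)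
        by (intro subspace_diff[OF subspace_E]) auto
      from G(2)[OF this] show ?thesis
        using x F(3,5) assms(2) by (simp add: g(2)[OF that] \<xi>(2) inner_diff_left)
    qed
  qed
qed

section \<open>Point derivations and their values in coordinates\<close>

definition derivation_at :: "(('a \<Rightarrow> real) \<Rightarrow> real) \<Rightarrow> 'a \<Rightarrow> bool" where
  "derivation_at v q \<longleftrightarrow>
     (\<forall>f\<in>\<F>. \<forall>g\<in>\<F>. v (\<lambda>x. f x + g x) = v f + v g) \<and>
     (\<forall>c. \<forall>f\<in>\<F>. v (\<lambda>x. c * f x) = c * v f) \<and>
     (\<forall>f\<in>\<F>. \<forall>g\<in>\<F>. v (\<lambda>x. f x * g x) = v f * g q + f q * v g)"

lemma derivation_at_vector_field: "vector_field A X \<Longrightarrow> derivation_at (\<lambda>f. X f q) q"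
  by (simp add: vector_field_def derivation_at_def)

lemma derivation_at_add: "derivation_at v q \<Longrightarrow> f \<in> \<F> \<Longrightarrow> g \<in> \<F> \<Longrightarrow> v (\<lambda>x. f x + g x) = v f + v g"
  by (simp add: derivation_at_def)

lemma derivation_at_mult:
  "derivation_at v q \<Longrightarrow> f \<in> \<F> \<Longrightarrow> g \<in> \<F> \<Longrightarrow> v (\<lambda>x. f x * g x) = v f * g q + f q * v g"
  by (simp add: derivation_at_def)

lemma derivation_at_cmult: "derivation_at v q \<Longrightarrow> f \<in> \<F> \<Longrightarrow> v (\<lambda>x. c * f x) = c * v f"
  by (simp add: derivation_at_def)

lemma derivation_at_const: "derivation_at v q \<Longrightarrow> v (\<lambda>x. c) = 0"
proof -
  assume v: "derivation_at v q"
  have "v (\<lambda>x. 1) = 0"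
    using derivation_at_mult[OF v smooth_const[of 1] smooth_const[of 1]] by simp
  then show ?thesis using derivation_at_cmult[OF v smooth_const[of 1], of c] by simp
qed

lemma derivation_at_diff: "derivation_at v q \<Longrightarrow> f \<in> \<F> \<Longrightarrow> g \<in> \<F> \<Longrightarrow> v (\<lambda>x. f x - g x) = v f - v g"
  using derivation_at_add[of v q f "\<lambda>x. - 1 * g x"] derivation_at_cmult[of v q g "- 1"]
    smooth_mult[OF smooth_const, of g "- 1"] by simp

lemma derivation_at_sum:
  assumes "derivation_at v q" "finite K" "\<And>k. k \<in> K \<Longrightarrow> f k \<in> \<F>"
  shows "v (\<lambda>x. \<Sum>k\<in>K. f k x) = (\<Sum>k\<in>K. v (f k))"
  using assms(2,3)
proof (induction K rule: finite_induct)
  case empty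
  then show ?case using derivation_at_const[OF assms(1)] by simp
next
  case (insert k K)
  then show ?case using derivation_at_add[OF assms(1), of "f k" "\<lambda>x. \<Sum>k\<in>K. f k x"] smooth_sum[of K f] by simp
qed

text \<open>With a bump \<open>\<theta>\<close> that is \<open>1\<close> near \<open>q\<close> and
  \<open>0\<close> off \<open>W\<close>, the difference \<open>f - g\<close> equals
  \<open>(f - g) * (1 - \<theta>)\<close>. Both factors vanish at \<open>q\<close>, so the Leibniz
  rule gives \<open>0\<close>.\<close>

lemma derivation_at_local:
  assumes "derivation_at v q" "f \<in> \<F>" "g \<in> \<F>" "open W" "q \<in> W" "\<And>x. x \<in> W \<Longrightarrow> f x = g x"
  shows "v f = v g"
proof -
  obtain \<theta> V where \<theta>: "\<theta> \<in> \<F>" "open V" "q \<in> V" "V \<subseteq> W" "\<And>x. x \<in> V \<Longrightarrow> \<theta> x = 1" "\<And>x. x \<notin> W \<Longrightarrow> \<theta> x = 0"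
    using smooth_bump[OF assms(4,5)] by blast
  have "(\<lambda>x. (f x - g x) * (1 - \<theta> x)) = (\<lambda>x. f x - g x)"
    using assms(6) \<theta>(6) by (intro ext) (metis diff_0_right diff_self mult.right_neutral mult_zero_left)
  then have "v (\<lambda>x. f x - g x) = 0"
    using derivation_at_mult[OF assms(1) smooth_diff[OF assms(2,3)] smooth_diff[OF smooth_const[of 1] \<theta>(1)]]
      \<theta>(3,5) assms(5,6) by simp
  then show ?thesis using derivation_at_diff[OF assms(1-3)] by simp
qed

text \<open>The increments \<open>\<xi> b x - \<xi> b q\<close> vanish at \<open>q\<close>, so the
  Leibniz rule keeps only the terms in which they are differentiated. A derivation is thereby
  determined by its values on the coordinates.\<close>

lemma derivation_at_Hadamard:
  assumes v: "derivation_at v q" and f: "f \<in> \<F>" and \<xi>: "\<And>b. \<xi> b \<in> \<F>" and g: "\<And>b. g b \<in> \<F>"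
    and V: "open V" "q \<in> V" "\<And>x. x \<in> V \<Longrightarrow> f x = f q + (\<Sum>b\<in>Bs. (\<xi> b x - \<xi> b q) * g b x)"
  shows "v f = (\<Sum>b\<in>Bs. v (\<xi> b) * g b q)"
proof -
  have d: "(\<lambda>x. \<xi> b x - \<xi> b q) \<in> \<F>" for b using smooth_diff[OF \<xi> smooth_const] .
  have s: "(\<lambda>x. \<Sum>b\<in>Bs. (\<xi> b x - \<xi> b q) * g b x) \<in> \<F>"
    by (intro smooth_sum Bs smooth_mult d g)
  have "v f = v (\<lambda>x. f q + (\<Sum>b\<in>Bs. (\<xi> b x - \<xi> b q) * g b x))"
    by (rule derivation_at_local[OF v f smooth_add[OF smooth_const s] V])
  also have "\<dots> = (\<Sum>b\<in>Bs. v (\<lambda>x. (\<xi> b x - \<xi> b q) * g b x))"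
    using derivation_at_add[OF v smooth_const s] derivation_at_const[OF v]
      derivation_at_sum[OF v Bs(4) smooth_mult[OF d g]] by simp
  also have "\<dots> = (\<Sum>b\<in>Bs. v (\<xi> b) * g b q)"
    using derivation_at_mult[OF v d g] derivation_at_diff[OF v \<xi> smooth_const] derivation_at_const[OF v]
    by simp
  finally show ?thesis .
qed

text \<open>The field is the directional derivative along the constant vector \<open>u\<close> in
  the chart, multiplied by a bump and extended by \<open>0\<close>. Since \<open>u \<in> E\<close>,
  short segments in direction \<open>u\<close> remain in the chart image.\<close>

lemma vector_field_with_value:
  assumes c: "coordinates U \<phi> V0 \<xi>" "p \<in> V0" and u: "u \<in> E"
  obtains W where "vector_field A W" "\<And>b. W (\<xi> b) p = u \<bullet> b"
proof -
  have ch: "(U, \<phi>) \<in> A" "p \<in> U" using c by (auto simp: coordinates_def)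
  \<comment> \<open>Defining the directional derivative through a curve makes it visibly independent
    of the local representative of \<open>f\<close>; the representatives are used only to compute
    it.\<close>
  define D where "D f x = deriv (\<lambda>t. f (inv_into U \<phi> (\<phi> x + t *\<^sub>R u))) 0" for f :: "'a \<Rightarrow> real" and x
  have D: "D f x = frechet_derivative F (at (\<phi> x)) u"
    if F: "cinf_on UNIV F" and V: "open V" "x \<in> V" "V \<subseteq> U" "\<And>x. x \<in> V \<Longrightarrow> f x = F (\<phi> x)"
    for f F V x
  proof -
    obtain S where S: "open S" "\<phi> ` V = E \<inter> S" using chart_image_open[OF ch(1) V(1,3)] by blast
    have lin: "linear (frechet_derivative F (at y))" for y
      using cinf_on_has_derivative[OF F] has_derivative_linear by blast
    have "((\<lambda>t. \<phi> x + t *\<^sub>R u) has_derivative (\<lambda>s. s *\<^sub>R u)) (at 0)"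
      by (auto intro!: derivative_eq_intros)
    from has_derivative_compose[OF this cinf_on_has_derivative[OF F UNIV_I]]
    have "((\<lambda>t. F (\<phi> x + t *\<^sub>R u)) has_derivative (\<lambda>s. frechet_derivative F (at (\<phi> x)) (s *\<^sub>R u))) (at 0)"
      by simp
    then have "((\<lambda>t. F (\<phi> x + t *\<^sub>R u)) has_real_derivative frechet_derivative F (at (\<phi> x)) u) (at 0)"
      by (simp add: has_field_derivative_def linear_cmul[OF lin] mult.commute[of _ "frechet_derivative F _ _"])
    then have "((\<lambda>t. f (inv_into U \<phi> (\<phi> x + t *\<^sub>R u))) has_real_derivative frechet_derivative F (at (\<phi> x)) u) (at 0)"
    proof (rule has_field_derivative_transform_within_open)
      show "open ((\<lambda>t. \<phi> x + t *\<^sub>R u) -` S)"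
        by (intro open_vimage S continuous_intros)
      show "0 \<in> (\<lambda>t. \<phi> x + t *\<^sub>R u) -` S" using S V(2) by auto
      show "F (\<phi> x + t *\<^sub>R u) = f (inv_into U \<phi> (\<phi> x + t *\<^sub>R u))" if t: "t \<in> (\<lambda>t. \<phi> x + t *\<^sub>R u) -` S" for t
      proof -
        have "\<phi> x + t *\<^sub>R u \<in> E"
          using chart_in_E[OF ch(1)] V(2,3) u
          by (intro subspace_add[OF subspace_E] subspace_scale[OF subspace_E]) auto
        then obtain w where "w \<in> V" "\<phi> x + t *\<^sub>R u = \<phi> w" using S t by blast
        then show ?thesis using chart_inv[OF ch(1)] V(3,4) by auto
      qed
    qed
    then show ?thesis unfolding D_def by (rule DERIV_imp_deriv)
  qed
  obtain \<rho> :: "'e \<Rightarrow> real" and K V where \<rho>: "cinf_on UNIV \<rho>" "closed K" "K \<subseteq> U" "open V" "p \<in> V" "V \<subseteq> U"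
    "\<And>x. x \<in> V \<Longrightarrow> \<rho> (\<phi> x) = 1" "\<And>x. x \<in> U - K \<Longrightarrow> \<rho> (\<phi> x) = 0"
    using bump_in_chart[OF ch(1) chart_open[OF ch(1)] ch(2) order_refl] by blast
  define W where "W f x = (if x \<in> U then \<rho> (\<phi> x) * D f x else 0)" for f x
  have sm: "W f \<in> \<F>" if f: "f \<in> \<F>" for f
  proof (rule smooth_extend_zero[OF ch(1) \<rho>(2,3)])
    show "W f x = 0" if "x \<notin> K" for x using that \<rho> by (auto simp: W_def)
    show "\<exists>F V. cinf_on UNIV F \<and> open V \<and> q \<in> V \<and> V \<subseteq> U \<and> (\<forall>x\<in>V. W f x = F (\<phi> x))" if q: "q \<in> U" for q
    proof -
      obtain F V where F: "cinf_on UNIV F" "open V" "q \<in> V" "V \<subseteq> U" "\<And>x. x \<in> V \<Longrightarrow> f x = F (\<phi> x)"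
        using smooth_local_rep[OF f ch(1) q] by blast
      show ?thesis
        using F D[OF F(1,2) _ F(4,5)] cinf_on_mult[OF _ \<rho>(1) cinf_on_derivative[OF F(1), of u]]
        by (intro exI[of _ "\<lambda>y. \<rho> y * frechet_derivative F (at y) u"] exI[of _ V]) (auto simp: W_def)
    qed
  qed
  have add: "D (\<lambda>y. f y + g y) x = D f x + D g x" (is ?add)
    and mult: "D (\<lambda>y. f y * g y) x = D f x * g x + f x * D g x" (is ?mult)
    if f: "f \<in> \<F>" and g: "g \<in> \<F>" and x: "x \<in> U" for f g x
  proof -
    obtain F V where F: "cinf_on UNIV F" "open V" "x \<in> V" "V \<subseteq> U" "\<And>x. x \<in> V \<Longrightarrow> f x = F (\<phi> x)"
      using smooth_local_rep[OF f ch(1) x] by blast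
    obtain G V' where G: "cinf_on UNIV G" "open V'" "x \<in> V'" "V' \<subseteq> U" "\<And>x. x \<in> V' \<Longrightarrow> g x = G (\<phi> x)"
      using smooth_local_rep[OF g ch(1) x] by blast
    note dF = cinf_on_has_derivative[OF F(1) UNIV_I] and dG = cinf_on_has_derivative[OF G(1) UNIV_I]
    have "D (\<lambda>y. f y + g y) x = frechet_derivative (\<lambda>y. F y + G y) (at (\<phi> x)) u"
      by (rule D[where V = "V \<inter> V'"]) (use F G in \<open>auto intro: cinf_on_add\<close>)
    also have "\<dots> = frechet_derivative F (at (\<phi> x)) u + frechet_derivative G (at (\<phi> x)) u"
      using frechet_derivative_at[OF has_derivative_add[OF dF dG], of "\<phi> x"] by (metis (no_types, lifting))
    finally show ?add
      using D[OF F] D[OF G] by simp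
    have "D (\<lambda>y. f y * g y) x = frechet_derivative (\<lambda>y. F y * G y) (at (\<phi> x)) u"
      by (rule D[where V = "V \<inter> V'"]) (use F G in \<open>auto intro: cinf_on_mult\<close>)
    also have "\<dots> = F (\<phi> x) * frechet_derivative G (at (\<phi> x)) u + frechet_derivative F (at (\<phi> x)) u * G (\<phi> x)"
      using frechet_derivative_at[OF has_derivative_mult[OF dF dG], of "\<phi> x"] by (metis (no_types, lifting))
    finally show ?mult
      using D[OF F] D[OF G] F(3,5) G(3,5) by simp
  qed
  have const: "D (\<lambda>y. c) x = 0" for c x
    unfolding D_def by simp
  have "vector_field A W"
    unfolding vector_field_def
  proof (intro conjI ballI allI)
    show "W (\<lambda>y. c * f y) x = c * W f x" if "f \<in> \<F>" for c f x
      using mult[OF smooth_const that, of x c] const by (auto simp: W_def)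
  qed (use sm add mult in \<open>auto simp: W_def algebra_simps\<close>)
  moreover have "W (\<xi> b) p = u \<bullet> b" for b
  proof -
    have "D (\<xi> b) p = frechet_derivative (\<lambda>y. y \<bullet> b) (at (\<phi> p)) u"
      by (rule D[where V = V0])
        (use c in \<open>auto simp: coordinates_def intro!: cinf_on_bounded_linear bounded_linear_inner_left\<close>)
    also have "\<dots> = u \<bullet> b"
      using frechet_derivative_at[OF bounded_linear_imp_has_derivative[OF bounded_linear_inner_left], of b "\<phi> p"]
      by metis
    finally show ?thesis using \<rho>(5,7) ch(2) by (simp add: W_def)
  qed
  ultimately show thesis using that by blast
qed

end

section \<open>Ordinary differential equations\<close>

lemma antiderivative_exists:
  fixes g :: "real \<Rightarrow> 'a::banach"
  assumes "continuous_on UNIV g"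
  shows "\<exists>G. G 0 = 0 \<and> (\<forall>t. (G has_vector_derivative g t) (at t))"
proof -
  \<comment> \<open>The oriented integral from \<open>0\<close> to \<open>t\<close>: one of the two
    intervals is empty or a single point.\<close>
  define G where "G t = integral {0..t} g - integral {t..0} g" for t
  have int: "g integrable_on {a..b}" for a b
    using assms by (meson continuous_on_subset integrable_continuous_real top_greatest)
  have "(G has_vector_derivative g t) (at t)" for t
  proof -
    \<comment> \<open>A base point strictly to the left of both \<open>0\<close> and
      \<open>t\<close> turns the oriented integral near \<open>t\<close> into an ordinary one,
      whatever the sign of \<open>t\<close>.\<close>
    define a where "a = min 0 t - 1"
    have eq: "G s = integral {a..s} g - integral {a..0} g" if "a \<le> s" for s
    proof (cases "0 \<le> s")
      case True
      then have "integral {a..0} g + integral {0..s} g = integral {a..s} g"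
        by (intro Henstock_Kurzweil_Integration.integral_combine int) (auto simp: a_def)
      moreover have "integral {s..0} g = 0"
        using True by (cases "s = 0") auto
      ultimately show ?thesis by (simp add: G_def algebra_simps)
    next
      case False
      then have "integral {a..s} g + integral {s..0} g = integral {a..0} g"
        using that by (intro Henstock_Kurzweil_Integration.integral_combine int) auto
      then show ?thesis using False by (simp add: G_def algebra_simps)
    qed
    have "((\<lambda>u. integral {a..u} g) has_vector_derivative g t) (at t within {a..t + 1})"
      by (rule integral_has_vector_derivative) (use assms continuous_on_subset in \<open>auto simp: a_def\<close>)
    moreover have "at t within {a..t + 1} = at t"
      by (rule at_within_interior) (auto simp: a_def)
    ultimately have "((\<lambda>u. integral {a..u} g - integral {a..0} g) has_vector_derivative g t) (at t)"
      by (auto intro!: derivative_eq_intros)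
    then show ?thesis
      by (rule has_vector_derivative_transform_within_open[where S = "{a<..}"])
        (auto simp: eq, simp add: a_def)
  qed
  moreover have "G 0 = 0" by (simp add: G_def)
  ultimately show ?thesis by blast
qed

text \<open>Integrating an exponential bound of rate \<open>L\<close> gains the factor
  \<open>1 / L\<close>, which is what makes the weighted Picard map contract. Negative times follow
  by reflection.\<close>

lemma exponential_growth_bound:
  fixes G :: "real \<Rightarrow> 'a::real_normed_vector"
  assumes "L > 0" "G 0 = 0" "\<And>t. (G has_vector_derivative g t) (at t)"
    and "\<And>t. norm (g t) \<le> K * exp (L * \<bar>t\<bar>)"
  shows "norm (G t) \<le> K / L * exp (L * \<bar>t\<bar>)"
proof -
  have K: "K \<ge> 0" using order_trans[OF norm_ge_zero assms(4)[of 0]] by simp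
  have pos: "norm (G t) \<le> K / L * exp (L * t)"
    if "t \<ge> 0" "G 0 = 0" "\<And>t. (G has_vector_derivative g t) (at t)" "\<And>t. norm (g t) \<le> K * exp (L * \<bar>t\<bar>)"
    for G :: "real \<Rightarrow> 'a" and g t
  proof (cases "t = 0")
    case True
    then show ?thesis using that K assms(1) by simp
  next
    case False
    have "norm (G t - G 0) \<le> K / L * exp (L * t) - K / L * exp (L * 0)"
    proof (rule differentiable_bound_general)
      show "0 < t" using False that by simp
      show "continuous_on {0..t} G"
        using that(3) has_vector_derivative_continuous continuous_at_imp_continuous_on by blast
      show "((\<lambda>t. K / L * exp (L * t)) has_vector_derivative K * exp (L * x)) (at x)" for x
        unfolding has_real_derivative_iff_has_vector_derivative[symmetric]
        using assms(1) by (auto intro!: derivative_eq_intros)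
      show "norm (g x) \<le> K * exp (L * x)" if "0 < x" for x
        using \<open>\<And>t. norm (g t) \<le> K * exp (L * \<bar>t\<bar>)\<close>[of x] that by simp
      show "continuous_on {0..t} (\<lambda>t. K / L * exp (L * t))"
        using assms(1) by (intro continuous_intros) auto
    qed (rule that(3))
    moreover have "K / L * exp (L * 0) \<ge> 0" using K assms(1) by simp
    ultimately show ?thesis using that(2) by simp
  qed
  show ?thesis
  proof (cases "t \<ge> 0")
    case True
    then show ?thesis using pos[OF True assms(2-4)] by simp
  next
    case False
    have "((\<lambda>s. G (- s)) has_vector_derivative - g (- s)) (at s)" for s
    proof -
      have "((G \<circ> uminus) has_vector_derivative (- 1) *\<^sub>R g (- s)) (at s)"
        by (rule vector_diff_chain_at) (use assms(3) in \<open>auto intro!: derivative_eq_intros\<close>)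
      then show ?thesis by (simp add: o_def)
    qed
    from pos[of "- t", OF _ _ this] show ?thesis using False assms(2) assms(4)[of "- _"] by simp
  qed
qed

text \<open>Picard iteration in the weighted supremum norm with weight \<open>exp (- 2 L \<bar>t\<bar>)\<close>, in which it is a
  contraction on the whole time axis: \<open>z\<close> is the weighted displacement from the initial value.\<close>

lemma global_solution_exists:
  fixes Y :: "'a::euclidean_space \<Rightarrow> 'a"
  assumes lip: "\<And>x y. dist (Y x) (Y y) \<le> L * dist x y" and bdd: "\<And>x. norm (Y x) \<le> M" and L: "L > 0"
  shows "\<exists>y. y 0 = y0 \<and> (\<forall>t. (y has_vector_derivative Y (y t)) (at t))"
proof -
  define w where "w t = exp (2 * L * \<bar>t\<bar>)" for t
  have w: "w t > 0" for t by (simp add: w_def)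
  have wc: "continuous_on UNIV w" unfolding w_def by (intro continuous_intros)
  define g where "g z t = Y (y0 + w t *\<^sub>R apply_bcontfun z t)" for z :: "real \<Rightarrow>\<^sub>C 'a" and t
  have Yc: "continuous_on S Y" for S
    using lip by (intro lipschitz_on_continuous_on[of L] lipschitz_onI) (use L in auto)
  have gc: "continuous_on UNIV (g z)" for z
    unfolding g_def
    by (intro continuous_on_compose2[OF Yc[of UNIV]] continuous_intros wc continuous_on_apply_bcontfun subset_UNIV)
  define G where "G z = (SOME G. G 0 = 0 \<and> (\<forall>t. (G has_vector_derivative g z t) (at t)))" for z
  have G: "G z 0 = 0" "(G z has_vector_derivative g z t) (at t)" for z t
    using someI_ex[OF antiderivative_exists[OF gc], of z, folded G_def] by auto
  define \<Phi> where "\<Phi> z = Bcontfun (\<lambda>t. inverse (w t) *\<^sub>R G z t)" for z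
  have M: "M \<ge> 0" using order_trans[OF norm_ge_zero bdd[of y0]] .
  have \<Phi>: "apply_bcontfun (\<Phi> z) t = inverse (w t) *\<^sub>R G z t" for z t
  proof -
    have "continuous_on UNIV (G z)"
      using G(2) has_vector_derivative_continuous continuous_at_imp_continuous_on by blast
    then have "continuous_on UNIV (\<lambda>t. inverse (w t) *\<^sub>R G z t)"
      using w by (intro continuous_intros wc) (auto simp: less_imp_neq[symmetric])
    \<comment> \<open>Boundedness of \<open>Y\<close> keeps the weighted iterate bounded, as
      membership in \<open>bcontfun\<close> requires.\<close>
    moreover have "norm (inverse (w t) *\<^sub>R G z t) \<le> M / (2 * L)" for t
    proof -
      have "norm (g z t) \<le> M * exp (2 * L * \<bar>t\<bar>)" for t
      proof -
        have "M * 1 \<le> M * exp (2 * L * \<bar>t\<bar>)" using M L by (intro mult_left_mono) auto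
        then show ?thesis using bdd[of "y0 + w t *\<^sub>R apply_bcontfun z t"] by (simp add: g_def)
      qed
      then have "norm (G z t) \<le> M / (2 * L) * w t"
        unfolding w_def using L G by (intro exponential_growth_bound[where g = "g z"]) auto
      then show ?thesis using w[of t] by (simp add: field_simps)
    qed
    ultimately have "(\<lambda>t. inverse (w t) *\<^sub>R G z t) \<in> bcontfun"
      unfolding bcontfun_def by (auto intro!: boundedI[of _ "M / (2 * L)"])
    then show ?thesis by (simp add: \<Phi>_def Bcontfun_inverse)
  qed
  have contr: "dist (\<Phi> z1) (\<Phi> z2) \<le> 1 / 2 * dist z1 z2" for z1 z2
  proof (rule dist_bound)
    fix t
    \<comment> \<open>The field contributes the factor \<open>L\<close>, and integration against a
      weight of rate \<open>2 * L\<close> divides by \<open>2 * L\<close>. This is the origin of the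
      contraction constant \<open>1 / 2\<close>.\<close>
    have "norm (G z1 t - G z2 t) \<le> (L * dist z1 z2) / (2 * L) * exp (2 * L * \<bar>t\<bar>)"
    proof (rule exponential_growth_bound[where g = "\<lambda>t. g z1 t - g z2 t"])
      show "((\<lambda>t. G z1 t - G z2 t) has_vector_derivative g z1 t - g z2 t) (at t)" for t
        by (intro has_vector_derivative_diff G)
      show "norm (g z1 t - g z2 t) \<le> L * dist z1 z2 * exp (2 * L * \<bar>t\<bar>)" for t
      proof -
        have "norm (g z1 t - g z2 t) \<le> L * dist (y0 + w t *\<^sub>R apply_bcontfun z1 t) (y0 + w t *\<^sub>R apply_bcontfun z2 t)"
          using lip unfolding g_def dist_norm[symmetric] by blast
        also have "\<dots> = L * (w t * dist (apply_bcontfun z1 t) (apply_bcontfun z2 t))"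
          using w[of t] by (simp add: dist_norm scaleR_diff_right[symmetric])
        also have "\<dots> \<le> L * (w t * dist z1 z2)"
          using L w[of t] dist_bounded by (intro mult_left_mono) auto
        finally show ?thesis by (simp add: w_def mult_ac)
      qed
    qed (use L G in auto)
    then have "norm (G z1 t - G z2 t) \<le> 1 / 2 * dist z1 z2 * w t"
      using L by (simp add: w_def)
    then have "inverse (w t) * norm (G z1 t - G z2 t) \<le> inverse (w t) * (1 / 2 * dist z1 z2 * w t)"
      using w[of t] by (intro mult_left_mono) auto
    also have "\<dots> = 1 / 2 * dist z1 z2" using w[of t] by simp
    finally have "norm (inverse (w t) *\<^sub>R (G z1 t - G z2 t)) \<le> 1 / 2 * dist z1 z2"
      using w[of t] by (simp only: norm_scaleR) simp
    then show "dist (apply_bcontfun (\<Phi> z1) t) (apply_bcontfun (\<Phi> z2) t) \<le> 1 / 2 * dist z1 z2"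
      by (simp only: \<Phi> dist_norm scaleR_diff_right)
  qed
  obtain z where z: "\<Phi> z = z"
    using banach_fix_type[of "1/2" \<Phi>] contr by auto
  have "y0 + w t *\<^sub>R apply_bcontfun z t = y0 + G z t" for t
  proof -
    have "apply_bcontfun z t = inverse (w t) *\<^sub>R G z t" using \<Phi>[of z t] z by simp
    then show ?thesis using w[of t] by simp
  qed
  then have "g z t = Y (y0 + G z t)" for t by (simp add: g_def)
  then have "((\<lambda>t. y0 + G z t) has_vector_derivative Y (y0 + G z t)) (at t)" for t
    using has_vector_derivative_add[OF has_vector_derivative_const[of y0] G(2)[of z t]] by simp
  then show ?thesis using G(1)[of z] by (intro exI[of _ "\<lambda>t. y0 + G z t"]) auto
qed

text \<open>The bound on \<open>u'\<close> makes \<open>u x * exp (- K * x)\<close> nonincreasing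
  and \<open>u x * exp (K * x)\<close> nondecreasing, so a zero of the nonnegative function
  \<open>u\<close> spreads from \<open>s\<close> in both time directions.\<close>

lemma Gronwall_zero:
  fixes u :: "real \<Rightarrow> real"
  assumes "\<And>t. t \<in> {a..b} \<Longrightarrow> (u has_real_derivative u' t) (at t)"
    and "\<And>t. t \<in> {a..b} \<Longrightarrow> \<bar>u' t\<bar> \<le> K * u t" "\<And>t. t \<in> {a..b} \<Longrightarrow> u t \<ge> 0"
    and "s \<in> {a..b}" "u s = 0" "t \<in> {a..b}"
  shows "u t = 0"
proof (cases "s \<le> t")
  case True
  have "u t * exp (- K * t) \<le> u s * exp (- K * s)"
  proof (rule DERIV_nonpos_imp_nonincreasing[OF True])
    fix x assume "s \<le> x" "x \<le> t"
    then have x: "x \<in> {a..b}" using assms(4,6) by auto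
    have "((\<lambda>x. u x * exp (- K * x)) has_real_derivative (u' x - K * u x) * exp (- K * x)) (at x)"
      using assms(1)[OF x] by (auto intro!: derivative_eq_intros simp: algebra_simps)
    moreover have "(u' x - K * u x) * exp (- K * x) \<le> 0"
      using assms(2)[OF x] by (simp add: mult_le_0_iff)
    ultimately show "\<exists>y. ((\<lambda>x. u x * exp (- K * x)) has_real_derivative y) (at x) \<and> y \<le> 0" by blast
  qed
  then have "u t \<le> 0" using assms(5) by (simp add: mult_le_0_iff)
  then show ?thesis using assms(3)[OF assms(6)] by simp
next
  case False
  then have "t \<le> s" by simp
  have "u t * exp (K * t) \<le> u s * exp (K * s)"
  proof (rule DERIV_nonneg_imp_nondecreasing[OF \<open>t \<le> s\<close>])
    fix x assume "t \<le> x" "x \<le> s"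
    then have x: "x \<in> {a..b}" using assms(4,6) by auto
    have "((\<lambda>x. u x * exp (K * x)) has_real_derivative (u' x + K * u x) * exp (K * x)) (at x)"
      using assms(1)[OF x] by (auto intro!: derivative_eq_intros simp: algebra_simps)
    moreover have "(u' x + K * u x) * exp (K * x) \<ge> 0"
      using assms(2)[OF x] by (simp add: zero_le_mult_iff)
    ultimately show "\<exists>y. ((\<lambda>x. u x * exp (K * x)) has_real_derivative y) (at x) \<and> y \<ge> 0" by blast
  qed
  then have "u t \<le> 0" using assms(5) by (simp add: mult_le_0_iff)
  then show ?thesis using assms(3)[OF assms(6)] by simp
qed

text \<open>The partial derivatives are bounded on the compact ball, and their bounds add up to a
  bound for the operator norm; convexity of the ball allows the mean value inequality.\<close>

lemma cinf_on_lipschitz_cball: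
  fixes F :: "'a::euclidean_space \<Rightarrow> real"
  assumes "cinf_on UNIV F"
  shows "\<exists>L\<ge>0. \<forall>x\<in>cball z \<epsilon>. \<forall>y\<in>cball z \<epsilon>. \<bar>F x - F y\<bar> \<le> L * dist x y"
proof -
  have "\<exists>B. \<forall>x\<in>cball z \<epsilon>. \<bar>frechet_derivative F (at x) i\<bar> \<le> B" for i
    using compact_imp_bounded[OF compact_continuous_image[OF
        continuous_on_subset[OF cinf_on_continuous[OF cinf_on_derivative[OF assms, of i]] subset_UNIV] compact_cball]]
    unfolding bounded_iff by auto
  then obtain B where B: "\<And>i x. x \<in> cball z \<epsilon> \<Longrightarrow> \<bar>frechet_derivative F (at x) i\<bar> \<le> B i" by metis
  have "\<bar>F x - F y\<bar> \<le> (\<Sum>i\<in>Basis. \<bar>B i\<bar>) * norm (x - y)" if "x \<in> cball z \<epsilon>" "y \<in> cball z \<epsilon>" for x y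
  proof -
    have "norm (F x - F y) \<le> (\<Sum>i\<in>Basis. \<bar>B i\<bar>) * norm (x - y)"
    proof (rule differentiable_bound[OF convex_cball _ _ that])
      show "(F has_derivative frechet_derivative F (at x)) (at x within cball z \<epsilon>)" for x
        using cinf_on_has_derivative[OF assms UNIV_I] has_derivative_at_withinI by blast
      show "onorm (frechet_derivative F (at x)) \<le> (\<Sum>i\<in>Basis. \<bar>B i\<bar>)" if x: "x \<in> cball z \<epsilon>" for x
      proof -
        have "bounded_linear (frechet_derivative F (at x))"
          using cinf_on_has_derivative[OF assms UNIV_I] has_derivative_bounded_linear by blast
        then have "onorm (frechet_derivative F (at x)) \<le> (\<Sum>i\<in>Basis. norm (frechet_derivative F (at x) i))"
          by (rule onorm_componentwise)
        also have "\<dots> \<le> (\<Sum>i\<in>Basis. \<bar>B i\<bar>)"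
        proof (rule sum_mono)
          show "norm (frechet_derivative F (at x) i) \<le> \<bar>B i\<bar>" for i
            using B[OF x, of i] by simp
        qed
        finally show ?thesis .
      qed
    qed
    then show ?thesis by simp
  qed
  then show ?thesis by (intro exI[of _ "\<Sum>i\<in>Basis. \<bar>B i\<bar>"]) (auto simp: dist_norm sum_nonneg)
qed

section \<open>Integral curves of vector fields\<close>

context manifold
begin

lemma Bs_inner_sum: "b \<in> Bs \<Longrightarrow> (\<Sum>c\<in>Bs. a c *\<^sub>R c) \<bullet> b = a b"
proof -
  assume b: "b \<in> Bs"
  have "(a c *\<^sub>R c) \<bullet> b = (if c = b then a b else 0)" if "c \<in> Bs" for c
  proof (cases "c = b")
    case True
    then show ?thesis using Bs(3)[OF b] by (simp add: norm_eq_1)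
  next
    case False
    then show ?thesis using pairwiseD[OF Bs(2) that b] by (simp add: orthogonal_def)
  qed
  then have "(\<Sum>c\<in>Bs. a c *\<^sub>R c) \<bullet> b = (\<Sum>c\<in>Bs. if c = b then a b else 0)"
    unfolding inner_sum_left by (rule sum.cong[OF refl])
  then show ?thesis using b Bs(4) by simp
qed

text \<open>\<open>Y\<close> represents \<open>X\<close> in the chart; it is extended from the ball to the whole model space as a
  bounded Lipschitz field, so that its solutions exist for all times.\<close>

definition flow_box where
  "flow_box X p U \<phi> V \<xi> \<epsilon> Y L M \<longleftrightarrow>
     vector_field A X \<and> coordinates U \<phi> V \<xi> \<and> p \<in> V \<and> \<epsilon> > 0 \<and> V = U \<inter> \<phi> -` ball (\<phi> p) \<epsilon> \<and>
     ball (\<phi> p) \<epsilon> \<inter> E \<subseteq> \<phi> ` V \<and>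
     L > 0 \<and> (\<forall>x y. dist (Y x) (Y y) \<le> L * dist x y) \<and> (\<forall>x. norm (Y x) \<le> M) \<and> (\<forall>y. Y y \<in> E) \<and>
     (\<forall>x\<in>V. \<forall>b\<in>Bs. X (\<xi> b) x = Y (\<phi> x) \<bullet> b)"

lemma flow_box_exists:
  assumes X: "vector_field A X"
  obtains U \<phi> V \<xi> \<epsilon> Y L M where "flow_box X p U \<phi> V \<xi> \<epsilon> Y L M"
proof -
  obtain U \<phi> V0 \<xi> where c: "coordinates U \<phi> V0 \<xi>" "p \<in> V0" using coordinates_exist by blast
  have ch: "(U, \<phi>) \<in> A" "open V0" "V0 \<subseteq> U" and \<xi>: "\<And>b. \<xi> b \<in> \<F>" "\<And>b x. x \<in> V0 \<Longrightarrow> \<xi> b x = \<phi> x \<bullet> b"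
    using c(1) by (auto simp: coordinates_def)
  have "\<exists>F V. cinf_on UNIV F \<and> open V \<and> p \<in> V \<and> V \<subseteq> U \<and> (\<forall>x\<in>V. X (\<xi> b) x = F (\<phi> x))" for b
  proof -
    have "X (\<xi> b) \<in> \<F>" using X \<xi>(1) by (auto simp: vector_field_def)
    moreover have "p \<in> U" using c(2) ch(3) by blast
    ultimately obtain F V where "cinf_on UNIV F" "open V" "p \<in> V" "V \<subseteq> U" "\<And>x. x \<in> V \<Longrightarrow> X (\<xi> b) x = F (\<phi> x)"
      using smooth_local_rep[OF _ ch(1)] by metis
    then show ?thesis by blast
  qed
  then obtain F VV where F: "\<And>b. cinf_on UNIV (F b)" "\<And>b. open (VV b)" "\<And>b. p \<in> VV b"
      "\<And>b. VV b \<subseteq> U" "\<And>b x. x \<in> VV b \<Longrightarrow> X (\<xi> b) x = F b (\<phi> x)"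
    by metis
  define V1 where "V1 = V0 \<inter> (\<Inter>b\<in>Bs. VV b)"
  have V1: "open V1" "V1 \<subseteq> U" "p \<in> V1"
    using ch F(2,3) c(2) Bs(4) by (auto simp: V1_def)
  obtain \<epsilon> where \<epsilon>: "\<epsilon> > 0" "\<And>y. y \<in> E \<Longrightarrow> dist (\<phi> p) y \<le> \<epsilon> \<Longrightarrow> y \<in> \<phi> ` V1"
    using chart_image_ball[OF ch(1) V1] by blast
  \<comment> \<open>\<open>V\<close> is the full chart preimage of a ball. Hence a curve of the
    model space that lies in this ball and in \<open>E\<close> can be pulled back to
    \<open>V\<close>.\<close>
  define V where "V = U \<inter> \<phi> -` ball (\<phi> p) \<epsilon>"
  have VV1: "V \<subseteq> V1"
  proof
    fix x assume x: "x \<in> V"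
    then have "\<phi> x \<in> \<phi> ` V1" using chart_in_E[OF ch(1)] by (intro \<epsilon>(2)) (auto simp: V_def)
    then show "x \<in> V1" using x V1(2) chart_inj[OF ch(1)] by (auto simp: V_def inj_on_def)
  qed
  have pV: "p \<in> V" using V1 \<epsilon>(1) by (auto simp: V_def)
  define B where "B = cball (\<phi> p) \<epsilon>"
  have B: "convex B" "closed B" "B \<noteq> {}" "compact B" using \<epsilon>(1) by (auto simp: B_def)
  \<comment> \<open>The nearest-point projection onto the closed ball does not increase distances
    and fixes the ball. Composing with it extends the coefficients to globally Lipschitz bounded
    functions.\<close>
  define P where "P = closest_point B"
  have P: "P y \<in> B" "dist (P x) (P y) \<le> dist x y" for x y
    unfolding P_def using closest_point_in_set[OF B(2,3)] closest_point_lipschitz[OF B(1-3)] by auto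
  define Y where "Y y = (\<Sum>b\<in>Bs. F b (P y) *\<^sub>R b)" for y
  have "\<exists>L. L \<ge> 0 \<and> (\<forall>x\<in>B. \<forall>y\<in>B. \<bar>F b x - F b y\<bar> \<le> L * dist x y)" for b
    unfolding B_def using cinf_on_lipschitz_cball[OF F(1)] by blast
  then obtain l where l: "\<And>b. l b \<ge> 0" "\<And>b x y. x \<in> B \<Longrightarrow> y \<in> B \<Longrightarrow> \<bar>F b x - F b y\<bar> \<le> l b * dist x y"
    by metis
  have "\<exists>M. \<forall>x\<in>B. \<bar>F b x\<bar> \<le> M" for b
    using compact_imp_bounded[OF compact_continuous_image[OF
        continuous_on_subset[OF cinf_on_continuous[OF F(1)[of b]] subset_UNIV] B(4)]]
    unfolding bounded_iff by auto
  then obtain m where m: "\<And>b x. x \<in> B \<Longrightarrow> \<bar>F b x\<bar> \<le> m b" by metis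
  \<comment> \<open>The summand \<open>1\<close> keeps the constant positive even if
    \<open>Bs\<close> is empty or all \<open>l b\<close> vanish.\<close>
  define L where "L = (\<Sum>b\<in>Bs. l b) + 1"
  have lip: "dist (Y x) (Y y) \<le> L * dist x y" for x y
  proof -
    have "dist (Y x) (Y y) = norm (\<Sum>b\<in>Bs. (F b (P x) - F b (P y)) *\<^sub>R b)"
      by (simp add: Y_def dist_norm sum_subtractf scaleR_left_diff_distrib)
    also have "\<dots> \<le> (\<Sum>b\<in>Bs. norm ((F b (P x) - F b (P y)) *\<^sub>R b))" by (rule norm_sum)
    also have "\<dots> \<le> (\<Sum>b\<in>Bs. l b * dist x y)"
    proof (rule sum_mono)
      fix b assume b: "b \<in> Bs"
      have "\<bar>F b (P x) - F b (P y)\<bar> \<le> l b * dist (P x) (P y)" using l(2) P(1) by blast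
      also have "\<dots> \<le> l b * dist x y" using P(2) l(1) by (intro mult_left_mono) auto
      finally show "norm ((F b (P x) - F b (P y)) *\<^sub>R b) \<le> l b * dist x y" using Bs(3)[OF b] by simp
    qed
    also have "\<dots> \<le> L * dist x y" by (simp add: L_def sum_distrib_right[symmetric] distrib_right)
    finally show ?thesis .
  qed
  have bdd: "norm (Y x) \<le> (\<Sum>b\<in>Bs. m b)" for x
  proof -
    have "norm (Y x) \<le> (\<Sum>b\<in>Bs. norm (F b (P x) *\<^sub>R b))" unfolding Y_def by (rule norm_sum)
    also have "\<dots> \<le> (\<Sum>b\<in>Bs. m b)" by (rule sum_mono) (use m[OF P(1)] Bs(3) in auto)
    finally show ?thesis .
  qed
  have YE: "Y y \<in> E" for y
    unfolding Y_def using Bs(1) by (intro subspace_sum[OF subspace_E] subspace_scale[OF subspace_E]) auto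
  have val: "X (\<xi> b) x = Y (\<phi> x) \<bullet> b" if "x \<in> V" "b \<in> Bs" for x b
  proof -
    have "\<phi> x \<in> B" using that(1) by (auto simp: V_def B_def)
    then have "P (\<phi> x) = \<phi> x" unfolding P_def by (rule closest_point_self)
    moreover have "x \<in> VV b" using that VV1 by (auto simp: V1_def)
    ultimately show ?thesis using F(5) Bs_inner_sum[OF that(2)] by (simp add: Y_def)
  qed
  have img: "ball (\<phi> p) \<epsilon> \<inter> E \<subseteq> \<phi> ` V"
  proof
    fix y assume y: "y \<in> ball (\<phi> p) \<epsilon> \<inter> E"
    then obtain x where "x \<in> V1" "y = \<phi> x" using \<epsilon>(2)[of y] by auto
    then show "y \<in> \<phi> ` V" using y V1(2) by (auto simp: V_def)
  qed
  have "L > 0" using sum_nonneg[of Bs l] l(1) by (simp add: L_def)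
  moreover have "coordinates U \<phi> V \<xi>"
    using coordinates_subset[OF c(1), of V] chart_preimage_open[OF ch(1) open_ball] VV1
    by (auto simp: V_def V1_def)
  ultimately show thesis
    using that[of U \<phi> V \<xi> \<epsilon> Y L "\<Sum>b\<in>Bs. m b"] X pV \<epsilon>(1) V_def img lip bdd YE val
    unfolding flow_box_def by blast
qed

lemma derivation_chain_rule:
  assumes c: "coordinates U \<phi> V \<xi>" "\<gamma> t \<in> V" and v: "derivation_at v (\<gamma> t)"
    and \<gamma>: "isCont \<gamma> t" "\<And>b. b \<in> Bs \<Longrightarrow> ((\<lambda>s. \<xi> b (\<gamma> s)) has_real_derivative v (\<xi> b)) (at t)"
    and f: "f \<in> \<F>"
  shows "((\<lambda>s. f (\<gamma> s)) has_real_derivative v f) (at t)"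
proof -
  obtain g V' where g: "\<And>b. g b \<in> \<F>" "open V'" "\<gamma> t \<in> V'" "V' \<subseteq> V"
    "\<And>x. x \<in> V' \<Longrightarrow> f x = f (\<gamma> t) + (\<Sum>b\<in>Bs. (\<xi> b x - \<xi> b (\<gamma> t)) * g b x)"
    using Hadamard_coordinates[OF c f] by blast
  have \<xi>: "\<xi> b \<in> \<F>" for b using c(1) by (simp add: coordinates_def)
  have summand: "((\<lambda>s. (\<xi> b (\<gamma> s) - \<xi> b (\<gamma> t)) * g b (\<gamma> s)) has_real_derivative v (\<xi> b) * g b (\<gamma> t)) (at t)"
    if b: "b \<in> Bs" for b
  proof -
    have "isCont (\<lambda>s. g b (\<gamma> s)) t"
      using isCont_o2[OF \<gamma>(1), of "g b"] smooth_continuous[OF g(1)[of b], of UNIV]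
      by (simp add: continuous_on_eq_continuous_at)
    then have "((\<lambda>s. (\<xi> b (\<gamma> s) - \<xi> b (\<gamma> t)) / (s - t) * g b (\<gamma> s)) \<longlongrightarrow> v (\<xi> b) * g b (\<gamma> t)) (at t)"
      using \<gamma>(2)[OF b] by (intro tendsto_mult) (auto simp: has_field_derivative_iff isCont_def)
    then show ?thesis by (simp add: has_field_derivative_iff mult_ac)
  qed
  have "((\<lambda>s. f (\<gamma> t) + (\<Sum>b\<in>Bs. (\<xi> b (\<gamma> s) - \<xi> b (\<gamma> t)) * g b (\<gamma> s))) has_real_derivative
      0 + (\<Sum>b\<in>Bs. v (\<xi> b) * g b (\<gamma> t))) (at t)"
    by (intro DERIV_add DERIV_const DERIV_sum summand)
  moreover have "v f = (\<Sum>b\<in>Bs. v (\<xi> b) * g b (\<gamma> t))"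
    by (rule derivation_at_Hadamard[OF v f \<xi> g(1,2,3,5)])
  ultimately have D: "((\<lambda>s. f (\<gamma> t) + (\<Sum>b\<in>Bs. (\<xi> b (\<gamma> s) - \<xi> b (\<gamma> t)) * g b (\<gamma> s))) has_real_derivative v f) (at t)"
    by simp
  have "eventually (\<lambda>s. \<gamma> s \<in> V') (at t)"
    using \<gamma>(1) g(2,3) unfolding isCont_def by (rule topological_tendstoD)
  then have "eventually (\<lambda>s. f (\<gamma> t) + (\<Sum>b\<in>Bs. (\<xi> b (\<gamma> s) - \<xi> b (\<gamma> t)) * g b (\<gamma> s)) = f (\<gamma> s)) (nhds t)"
    unfolding eventually_at_filter using g(5) 
    by (auto elim!: eventually_mono)
  from DERIV_cong_ev[OF refl this refl, of "v f"] D show ?thesis by simp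
qed

text \<open>The component of \<open>y\<close> orthogonal to \<open>E\<close> has derivative
  \<open>0\<close>, since the field takes values in \<open>E\<close>, and it starts at
  \<open>0\<close>.\<close>

lemma solution_in_subspace:
  assumes "\<And>t. (y has_vector_derivative Y (y t)) (at t)" "y 0 \<in> E" "\<And>z. Y z \<in> E"
  shows "y t \<in> E"
proof -
  define r where "r t = y t - (\<Sum>b\<in>Bs. (y t \<bullet> b) *\<^sub>R b)" for t
  have "(r has_derivative (\<lambda>h. 0)) (at t within UNIV)" for t
  proof -
    have "((\<lambda>t. y t - (\<Sum>b\<in>Bs. (y t \<bullet> b) *\<^sub>R b)) has_vector_derivative
        Y (y t) - (\<Sum>b\<in>Bs. (Y (y t) \<bullet> b) *\<^sub>R b)) (at t)"
      unfolding has_vector_derivative_def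
      by (rule has_derivative_eq_rhs,
          (rule has_derivative_diff has_derivative_sum has_derivative_scaleR_left has_derivative_inner_left
            assms(1)[unfolded has_vector_derivative_def])+)
        (simp add: scaleR_diff_right scaleR_sum_right)
    then show ?thesis
      using Bs_expand[OF assms(3)] by (simp add: r_def[abs_def] has_vector_derivative_def)
  qed
  then have "r t = r 0" by (rule has_derivative_zero_unique[OF convex_UNIV]) auto
  also have "\<dots> = 0" using Bs_expand[OF assms(2)] by (simp add: r_def)
  finally have "y t = (\<Sum>b\<in>Bs. (y t \<bullet> b) *\<^sub>R b)" by (simp add: r_def)
  moreover have "(\<Sum>b\<in>Bs. (y t \<bullet> b) *\<^sub>R b) \<in> E"
    using Bs(1) by (intro subspace_sum[OF subspace_E] subspace_scale[OF subspace_E]) auto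
  ultimately show ?thesis by simp
qed

text \<open>An integral curve must be tested against every smooth function. The chain rule for
  derivations reduces this to the coordinates, where the test is the differential equation for
  \<open>y\<close>.\<close>

lemma integral_curve_of_solution:
  assumes fb: "flow_box X p U \<phi> V \<xi> \<epsilon> Y L M"
    and y: "\<And>t. (y has_vector_derivative Y (y t)) (at t)" "y 0 \<in> E"
    and J: "open J" "is_interval J" "\<And>t. t \<in> J \<Longrightarrow> dist (\<phi> p) (y t) < \<epsilon>"
  shows "integral_curve UNIV \<F> X J (\<lambda>t. inv_into U \<phi> (y t))"
    and "\<And>t. t \<in> J \<Longrightarrow> inv_into U \<phi> (y t) \<in> V \<and> \<phi> (inv_into U \<phi> (y t)) = y t"
proof -
  have X: "vector_field A X" and c: "coordinates U \<phi> V \<xi>" and img: "ball (\<phi> p) \<epsilon> \<inter> E \<subseteq> \<phi> ` V"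
    and YE: "\<And>y. Y y \<in> E" and val: "\<And>x b. x \<in> V \<Longrightarrow> b \<in> Bs \<Longrightarrow> X (\<xi> b) x = Y (\<phi> x) \<bullet> b"
    using fb by (auto simp: flow_box_def)
  have ch: "(U, \<phi>) \<in> A" "V \<subseteq> U" and \<xi>: "\<And>b. \<xi> b \<in> \<F>" "\<And>b x. x \<in> V \<Longrightarrow> \<xi> b x = \<phi> x \<bullet> b"
    using c by (auto simp: coordinates_def)
  let ?c = "\<lambda>t. inv_into U \<phi> (y t)"
  show cV: "?c t \<in> V \<and> \<phi> (?c t) = y t" if "t \<in> J" for t
  proof -
    have "y t \<in> ball (\<phi> p) \<epsilon> \<inter> E" using J(3)[OF that] solution_in_subspace[OF y YE] by simp
    then obtain x where "x \<in> V" "y t = \<phi> x" using img by blast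
    then show ?thesis using chart_inv[OF ch(1)] ch(2) by auto
  qed
  have yc: "continuous_on J y"
    using y(1) has_vector_derivative_continuous continuous_at_imp_continuous_on by blast
  have cc: "continuous_on J ?c"
  proof (rule continuous_on_compose2[OF chart_cont_inv[OF ch(1)] yc])
    show "y ` J \<subseteq> \<phi> ` U" using cV ch(2) by (metis image_subset_iff image_eqI subsetD)
  qed
  have "((\<lambda>s. f (?c s)) has_real_derivative X f (?c t)) (at t)" if f: "f \<in> \<F>" and t: "t \<in> J" for f t
  proof (rule derivation_chain_rule[OF c _ derivation_at_vector_field[OF X] _ _ f])
    show "?c t \<in> V" using cV[OF t] by blast
    show "isCont ?c t" using cc t J(1) continuous_on_eq_continuous_at by blast
    fix b assume b: "b \<in> Bs"
    have "((\<lambda>s. y s \<bullet> b) has_real_derivative Y (y t) \<bullet> b) (at t)"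
      using has_derivative_inner_left[OF y(1)[unfolded has_vector_derivative_def], of b t]
      by (simp add: has_field_derivative_def mult.commute[of _ "Y _ \<bullet> _"])
    then have "((\<lambda>s. \<xi> b (?c s)) has_real_derivative Y (y t) \<bullet> b) (at t)"
      by (rule has_field_derivative_transform_within_open[OF _ J(1) t]) (use cV \<xi>(2) in auto)
    then show "((\<lambda>s. \<xi> b (?c s)) has_real_derivative X (\<xi> b) (?c t)) (at t)"
      using val[OF _ b] cV[OF t] by auto
  qed
  then show "integral_curve UNIV \<F> X J ?c"
    using J cc by (auto simp: integral_curve_def)
qed

lemma flow_box_solution:
  assumes fb: "flow_box X p U \<phi> V \<xi> \<epsilon> Y L M"
  obtains y where "y 0 = y0" "\<And>t. (y has_vector_derivative Y (y t)) (at t)"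
  using global_solution_exists[of Y L M y0] fb by (auto simp: flow_box_def)

section \<open>Existence and uniqueness of integral curves\<close>

lemma integral_curve_exists:
  assumes X: "vector_field A X"
  obtains J c where "integral_curve UNIV \<F> X J c" "0 \<in> J" "c 0 = p"
proof -
  obtain U \<phi> V \<xi> \<epsilon> Y L M where fb: "flow_box X p U \<phi> V \<xi> \<epsilon> Y L M"
    using flow_box_exists[OF X] by blast
  then have ch: "(U, \<phi>) \<in> A" "p \<in> U" "\<epsilon> > 0" by (auto simp: flow_box_def coordinates_def)
  obtain y where y: "y 0 = \<phi> p" "\<And>t. (y has_vector_derivative Y (y t)) (at t)"
    using flow_box_solution[OF fb] by blast
  have "continuous_on UNIV y"
    using y(2) has_vector_derivative_continuous continuous_at_imp_continuous_on by blast
  then have "open (y -` ball (\<phi> p) \<epsilon>)" using open_vimage by blast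
  moreover have "0 \<in> y -` ball (\<phi> p) \<epsilon>" using y ch by simp
  ultimately obtain d where d: "d > 0" "ball 0 d \<subseteq> y -` ball (\<phi> p) \<epsilon>"
    using open_contains_ball by blast
  have "integral_curve UNIV \<F> X (ball 0 d) (\<lambda>t. inv_into U \<phi> (y t))"
    by (rule integral_curve_of_solution[OF fb y(2)])
      (use y ch d chart_in_E[OF ch(1)] in \<open>auto simp: is_interval_ball_real\<close>)
  then show thesis
    using that[of "ball 0 d" "\<lambda>t. inv_into U \<phi> (y t)"] d y chart_inv[OF ch(1,2)] by simp
qed

lemma integral_curve_preimage_open:
  "integral_curve M S X J c \<Longrightarrow> open V \<Longrightarrow> open (J \<inter> c -` V)"
  unfolding integral_curve_def by (intro continuous_open_preimage) auto

lemma integral_curve_unique_local: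
  assumes X: "vector_field A X" and c1: "integral_curve UNIV \<F> X J1 c1" and c2: "integral_curve UNIV \<F> X J2 c2"
    and s: "s \<in> J1" "s \<in> J2" "c1 s = c2 s"
  obtains d where "d > 0" "\<And>t. t \<in> ball s d \<Longrightarrow> c1 t = c2 t"
proof -
  obtain U \<phi> V \<xi> \<epsilon> Y L M where fb: "flow_box X (c1 s) U \<phi> V \<xi> \<epsilon> Y L M"
    using flow_box_exists[OF X] by blast
  have c: "coordinates U \<phi> V \<xi>" and pV: "c1 s \<in> V" 
    and lip: "\<And>x y. dist (Y x) (Y y) \<le> L * dist x y" and L: "L > 0"
    and YE: "\<And>y. Y y \<in> E" and val: "\<And>x b. x \<in> V \<Longrightarrow> b \<in> Bs \<Longrightarrow> X (\<xi> b) x = Y (\<phi> x) \<bullet> b"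
    using fb by (auto simp: flow_box_def)
  have ch: "(U, \<phi>) \<in> A" "V \<subseteq> U" "open V" and \<xi>: "\<And>b. \<xi> b \<in> \<F>" "\<And>b x. x \<in> V \<Longrightarrow> \<xi> b x = \<phi> x \<bullet> b"
    using c by (auto simp: coordinates_def)
  define I where "I = (J1 \<inter> c1 -` V) \<inter> (J2 \<inter> c2 -` V)"
  have "open I"
    unfolding I_def by (intro open_Int integral_curve_preimage_open[OF c1 ch(3)] integral_curve_preimage_open[OF c2 ch(3)])
  moreover have "s \<in> I" using s pV by (auto simp: I_def)
  ultimately obtain d where d: "d > 0" "cball s d \<subseteq> I" using open_contains_cball by blast
  \<comment> \<open>Conversely, testing an integral curve against the coordinates recovers the chart
    equation, because the chart map is the sum of its coordinates times the vectors of
    \<open>Bs\<close>.\<close>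
  have vd: "((\<lambda>t. \<phi> (\<gamma> t)) has_vector_derivative Y (\<phi> (\<gamma> t))) (at t)"
    if \<gamma>: "integral_curve UNIV \<F> X J \<gamma>" and t: "t \<in> J \<inter> \<gamma> -` V" for \<gamma> J t
  proof -
    have op: "open (J \<inter> \<gamma> -` V)"
      using integral_curve_preimage_open[OF \<gamma> ch(3)] .
    have "((\<lambda>t. \<Sum>b\<in>Bs. \<xi> b (\<gamma> t) *\<^sub>R b) has_vector_derivative (\<Sum>b\<in>Bs. X (\<xi> b) (\<gamma> t) *\<^sub>R b)) (at t)"
    proof (intro has_vector_derivative_sum)
      fix b assume "b \<in> Bs"
      have "((\<lambda>t. \<xi> b (\<gamma> t)) has_real_derivative X (\<xi> b) (\<gamma> t)) (at t)"
        using \<gamma> \<xi>(1) t unfolding integral_curve_def by blast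
      then show "((\<lambda>t. \<xi> b (\<gamma> t) *\<^sub>R b) has_vector_derivative X (\<xi> b) (\<gamma> t) *\<^sub>R b) (at t)"
        using has_vector_derivative_scaleR[OF _ has_vector_derivative_const[of b]] by fastforce
    qed
    moreover have "(\<Sum>b\<in>Bs. X (\<xi> b) (\<gamma> t) *\<^sub>R b) = Y (\<phi> (\<gamma> t))"
      using val[of "\<gamma> t"] t Bs_expand[OF YE] by simp
    ultimately have "((\<lambda>t. \<Sum>b\<in>Bs. \<xi> b (\<gamma> t) *\<^sub>R b) has_vector_derivative Y (\<phi> (\<gamma> t))) (at t)"
      by simp
    then show ?thesis
    proof (rule has_vector_derivative_transform_within_open[OF _ op t])
      fix x assume x: "x \<in> J \<inter> \<gamma> -` V"
      show "(\<Sum>b\<in>Bs. \<xi> b (\<gamma> x) *\<^sub>R b) = \<phi> (\<gamma> x)"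
        using \<xi>(2)[of "\<gamma> x"] x Bs_expand[OF chart_in_E[OF ch(1)]] ch(2) by auto
    qed
  qed
  define w where "w t = \<phi> (c1 t) - \<phi> (c2 t)" for t
  define w' where "w' t = Y (\<phi> (c1 t)) - Y (\<phi> (c2 t))" for t
  \<comment> \<open>The squared distance is used because it is differentiable at its zeros as well;
    its derivative turns the Lipschitz constant \<open>L\<close> into the Gronwall constant
    \<open>2 * L\<close>.\<close>
  have "w t \<bullet> w t = 0" if t: "t \<in> {s - d..s + d}" for t
  proof (rule Gronwall_zero[where u = "\<lambda>t. w t \<bullet> w t" and u' = "\<lambda>t. 2 * (w t \<bullet> w' t)" and K = "2 * L" and s = s])
    fix t assume "t \<in> {s - d..s + d}"
    then have t: "t \<in> J1 \<inter> c1 -` V" "t \<in> J2 \<inter> c2 -` V"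
      using d(2) by (auto simp: I_def cball_eq_atLeastAtMost)
    have "(w has_vector_derivative w' t) (at t)"
      unfolding w_def w'_def by (intro has_vector_derivative_diff vd[OF c1 t(1)] vd[OF c2 t(2)])
    from has_derivative_inner[OF this[unfolded has_vector_derivative_def] this[unfolded has_vector_derivative_def]]
    show "((\<lambda>t. w t \<bullet> w t) has_real_derivative 2 * (w t \<bullet> w' t)) (at t)"
      unfolding has_field_derivative_def
      by (rule has_derivative_eq_rhs) (auto simp: inner_commute algebra_simps)
    have "\<bar>w t \<bullet> w' t\<bar> \<le> norm (w t) * norm (w' t)" by (rule Cauchy_Schwarz_ineq2)
    also have "\<dots> \<le> norm (w t) * (L * norm (w t))"
      using lip by (intro mult_left_mono) (auto simp: w_def w'_def dist_norm[symmetric])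
    finally show "\<bar>2 * (w t \<bullet> w' t)\<bar> \<le> 2 * L * (w t \<bullet> w t)"
      by (simp add: power2_norm_eq_inner[symmetric] power2_eq_square abs_mult mult.left_commute)
  qed (use t d(1) s in \<open>auto simp: w_def\<close>)
  moreover have "c1 t \<in> U" "c2 t \<in> U" if "t \<in> ball s d" for t
  proof -
    have "t \<in> I" using that d(2) by auto
    then show "c1 t \<in> U" "c2 t \<in> U" using ch(2) by (auto simp: I_def)
  qed
  ultimately have "c1 t = c2 t" if "t \<in> ball s d" for t
    using that chart_inj[OF ch(1)] by (auto simp: ball_eq_greaterThanLessThan w_def inj_on_def)
  then show thesis using that d(1) by blast
qed

text \<open>On the connected common interval, the set of agreement is open by local uniqueness and
  the set of disagreement is open by the Hausdorff property.\<close>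

lemma integral_curve_unique:
  assumes X: "vector_field A X" and c1: "integral_curve UNIV \<F> X J1 c1" and c2: "integral_curve UNIV \<F> X J2 c2"
    and s: "s \<in> J1" "s \<in> J2" "c1 s = c2 s" and t: "t \<in> J1" "t \<in> J2"
  shows "c1 t = c2 t"
proof (rule ccontr)
  assume ne: "c1 t \<noteq> c2 t"
  define I where "I = J1 \<inter> J2"
  define P where "P = {t \<in> I. c1 t = c2 t}"
  define Q where "Q = {t \<in> I. c1 t \<noteq> c2 t}"
  have I: "open I" "connected I"
    using c1 c2 unfolding I_def integral_curve_def is_interval_connected_1[symmetric]
    by (auto intro: open_Int is_interval_Int)
  have cont: "continuous_on I c1" "continuous_on I c2"
    using c1 c2 unfolding I_def integral_curve_def by (auto intro: continuous_on_subset)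
  have "open P"
    unfolding open_contains_ball
  proof
    fix x assume x: "x \<in> P"
    obtain d where d: "d > 0" "\<And>t. t \<in> ball x d \<Longrightarrow> c1 t = c2 t"
      using integral_curve_unique_local[OF X c1 c2, of x] x by (auto simp: P_def I_def)
    obtain e where "e > 0" "ball x e \<subseteq> I" using I(1) x open_contains_ball by (metis (lifting) P_def mem_Collect_eq)
    then show "\<exists>e>0. ball x e \<subseteq> P"
      using d by (intro exI[of _ "min d e"]) (auto simp: P_def)
  qed
  moreover have "open Q"
  proof (subst open_subopen, rule ballI)
    fix x assume x: "x \<in> Q"
    then obtain S1 S2 where S: "open S1" "open S2" "c1 x \<in> S1" "c2 x \<in> S2" "S1 \<inter> S2 = {}"
      using hausdorff[of "c1 x" "c2 x"] by (auto simp: Q_def)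
    have "open ((I \<inter> c1 -` S1) \<inter> (I \<inter> c2 -` S2))"
      using cont I(1) S by (intro open_Int continuous_open_preimage)
    then show "\<exists>T. open T \<and> x \<in> T \<and> T \<subseteq> Q"
      using S x by (intro exI[of _ "(I \<inter> c1 -` S1) \<inter> (I \<inter> c2 -` S2)"]) (auto simp: Q_def)
  qed
  moreover have "P \<inter> Q \<inter> I = {}" "I \<subseteq> P \<union> Q" "P \<inter> I \<noteq> {}" "Q \<inter> I \<noteq> {}"
    using s t ne by (auto simp: P_def Q_def I_def)
  ultimately show False using connectedD[OF I(2)] by blast
qed

text \<open>Uniqueness of integral curves is what makes the definite description in
  \<open>flow\<close> denote.\<close>

lemma flow_eq:
  assumes X: "vector_field A X" and c: "integral_curve UNIV \<F> X J c" "0 \<in> J" "t \<in> J"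
  shows "flow_defined UNIV \<F> X (c 0) t" "flow UNIV \<F> X t (c 0) = c t"
proof -
  show "flow_defined UNIV \<F> X (c 0) t" unfolding flow_defined_def using c by blast
  show "flow UNIV \<F> X t (c 0) = c t"
    unfolding flow_def
  proof (rule the_equality)
    show "\<exists>J' c'. integral_curve UNIV \<F> X J' c' \<and> 0 \<in> J' \<and> t \<in> J' \<and> c' 0 = c 0 \<and> c' t = c t"
      using c by blast
    show "w = c t" if "\<exists>J' c'. integral_curve UNIV \<F> X J' c' \<and> 0 \<in> J' \<and> t \<in> J' \<and> c' 0 = c 0 \<and> c' t = w" for w
      using that integral_curve_unique[OF X _ c(1) _ c(2) _ _ c(3)] by blast
  qed
qed

end

section \<open>Hessians at critical points\<close>

context manifold
begin

lemma vector_field_smooth: "vector_field A W \<Longrightarrow> f \<in> \<F> \<Longrightarrow> W f \<in> \<F>"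
  by (simp add: vector_field_def)

lemma vector_field_add: "vector_field A W \<Longrightarrow> f \<in> \<F> \<Longrightarrow> g \<in> \<F> \<Longrightarrow> W (\<lambda>y. f y + g y) = (\<lambda>x. W f x + W g x)"
  by (auto simp: vector_field_def)

lemma vector_field_cmult: "vector_field A W \<Longrightarrow> f \<in> \<F> \<Longrightarrow> W (\<lambda>y. c * f y) = (\<lambda>x. c * W f x)"
  by (auto simp: vector_field_def)

lemma vector_field_mult:
  "vector_field A W \<Longrightarrow> f \<in> \<F> \<Longrightarrow> g \<in> \<F> \<Longrightarrow> W (\<lambda>y. f y * g y) = (\<lambda>x. W f x * g x + f x * W g x)"
  by (auto simp: vector_field_def)

text \<open>A \<open>derivation_at\<close> is unconstrained outside the smooth functions, whereas
  \<open>tangent_space\<close> demands the value \<open>0\<close> there; the truncation passes from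
  the former to the latter.\<close>

lemma tangent_vectorI:
  assumes "derivation_at v q"
  shows "(\<lambda>f. if f \<in> \<F> then v f else 0) \<in> tangent_space A q"
  using assms smooth_add smooth_mult smooth_mult[OF smooth_const]
  by (auto simp: tangent_space_def derivation_at_def)

text \<open>Two extensions \<open>W\<close>, \<open>W'\<close> of \<open>v\<close> give the same value \<open>v[W[f]]\<close> because the commutator of \<open>W\<close>
  and \<open>W'\<close> at \<open>z\<close> is a tangent vector and hence kills \<open>f\<close>.\<close>

lemma hessian_eq:
  assumes f: "f \<in> \<F>" "critical_point A f z" and W: "vector_field A W" "\<And>g. g \<in> \<F> \<Longrightarrow> W g z = v g"
  shows "hessian A f z v v = W (W f) z"
  unfolding hessian_def
proof (rule the_equality)
  note sm = vector_field_smooth[OF W(1)]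
  show "\<exists>W'. vector_field A W' \<and> (\<forall>g\<in>\<F>. W' g z = v g) \<and> W (W f) z = v (W' f)"
    using W sm[OF f(1)] by (intro exI[of _ W]) auto
  fix r assume "\<exists>W'. vector_field A W' \<and> (\<forall>g\<in>\<F>. W' g z = v g) \<and> r = v (W' f)"
  then obtain W' where W': "vector_field A W'" "\<And>g. g \<in> \<F> \<Longrightarrow> W' g z = v g" "r = v (W' f)" by blast
  note sm' = vector_field_smooth[OF W'(1)]
  note expand = vector_field_add[OF W(1)] vector_field_add[OF W'(1)] vector_field_cmult[OF W(1)]
    vector_field_cmult[OF W'(1)] vector_field_mult[OF W(1)] vector_field_mult[OF W'(1)]
  define u where "u g = W (W' g) z - W' (W g) z" for g
  have "derivation_at u z"
    unfolding derivation_at_def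
  proof (intro conjI ballI allI)
    fix g h assume gh: "g \<in> \<F>" "h \<in> \<F>"
    show "u (\<lambda>x. g x + h x) = u g + u h"
      using gh by (simp add: u_def expand sm sm')
    show "u (\<lambda>x. g x * h x) = u g * h z + g z * u h"
      using gh by (simp add: u_def expand smooth_mult sm sm')
        (simp add: algebra_simps)
  next
    fix c g assume "g \<in> \<F>"
    then show "u (\<lambda>x. c * g x) = c * u g"
      by (simp add: u_def expand sm sm' algebra_simps)
  qed
  from tangent_vectorI[OF this] have "u f = 0"
    using f unfolding critical_point_def by fastforce
  then show "r = W (W f) z"
    using W W' sm sm' f(1) by (simp add: u_def)
qed

text \<open>Since \<open>a\<close> and \<open>b\<close> vanish at \<open>p\<close>, only the two
  terms in which each of them is differentiated exactly once survive.\<close>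

lemma second_derivative_product:
  assumes W: "vector_field A W" and F: "a \<in> \<F>" "b \<in> \<F>" "g \<in> \<F>" and z: "a p = 0" "b p = 0"
  shows "W (W (\<lambda>x. a x * b x * g x)) p = 2 * (W a p * W b p * g p)"
  using F z by (simp add: vector_field_add[OF W] vector_field_mult[OF W] smooth_mult smooth_add vector_field_smooth[OF W])

lemma second_derivative_sum:
  assumes W: "vector_field A W" and "finite K" "\<And>k. k \<in> K \<Longrightarrow> f k \<in> \<F>"
  shows "W (W (\<lambda>x. \<Sum>k\<in>K. f k x)) p = (\<Sum>k\<in>K. W (W (f k)) p)"
proof -
  have "W (\<lambda>x. \<Sum>k\<in>K. f k x) = (\<lambda>x. \<Sum>k\<in>K. W (f k) x)"
    using derivation_at_sum[OF derivation_at_vector_field[OF W] assms(2), of f] assms(3) by auto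
  then show ?thesis
    using derivation_at_sum[OF derivation_at_vector_field[OF W] assms(2), of "\<lambda>k. W (f k)"]
      vector_field_smooth[OF W assms(3)] by simp
qed

text \<open>At a critical point the first-order coefficients vanish at \<open>p\<close>, so each of
  them can be expanded once more. The second derivative along any field is then read off from the
  resulting quadratic form.\<close>

lemma critical_point_expansion:
  assumes c: "coordinates U \<phi> V \<xi>" "p \<in> V" and f: "f \<in> \<F>" "critical_point A f p"
  obtains g V' where "\<And>b c. g b c \<in> \<F>" "open V'" "p \<in> V'" "V' \<subseteq> V"
    "\<And>x. x \<in> V' \<Longrightarrow> f x = f p + (\<Sum>(b, c)\<in>Bs \<times> Bs. (\<xi> b x - \<xi> b p) * (\<xi> c x - \<xi> c p) * g b c x)"
    "\<And>W. vector_field A W \<Longrightarrow> W (W f) p = 2 * (\<Sum>(b, c)\<in>Bs \<times> Bs. W (\<xi> b) p * W (\<xi> c) p * g b c p)"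
proof -
  have \<xi>: "\<xi> b \<in> \<F>" for b using c(1) by (simp add: coordinates_def)
  have d: "(\<lambda>x. \<xi> b x - \<xi> b p) \<in> \<F>" for b using smooth_diff[OF \<xi> smooth_const] .
  obtain g V1 where g: "\<And>b. g b \<in> \<F>" "open V1" "p \<in> V1" "V1 \<subseteq> V"
      "\<And>x. x \<in> V1 \<Longrightarrow> f x = f p + (\<Sum>b\<in>Bs. (\<xi> b x - \<xi> b p) * g b x)"
    using Hadamard_coordinates[OF c f(1)] by blast
  have g0: "g b p = 0" if b: "b \<in> Bs" for b
  proof -
    \<comment> \<open>A field pointing in the basis direction \<open>b\<close> isolates the single
      coefficient \<open>g b p\<close>.\<close>
    obtain W where W: "vector_field A W" "\<And>c. W (\<xi> c) p = b \<bullet> c"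
      using vector_field_with_value[OF c, of b] b Bs(1) by blast
    have "0 = W f p"
      using tangent_vectorI[OF derivation_at_vector_field[OF W(1)], of p] f unfolding critical_point_def by fastforce
    also have "\<dots> = (\<Sum>c\<in>Bs. W (\<xi> c) p * g c p)"
      by (rule derivation_at_Hadamard[OF derivation_at_vector_field[OF W(1)] f(1) \<xi> g(1,2,3,5)])
    also have "\<dots> = (\<Sum>c\<in>Bs. g c p *\<^sub>R c) \<bullet> b"
      by (simp add: W(2) inner_sum_left inner_commute[of b] mult.commute[of "g _ p"])
    also have "\<dots> = g b p" by (rule Bs_inner_sum[OF b])
    finally show ?thesis by simp
  qed
  define P where "P b G V' \<longleftrightarrow> (\<forall>c. G c \<in> \<F>) \<and> open V' \<and> p \<in> V' \<and>
      (\<forall>x\<in>V'. g b x = g b p + (\<Sum>c\<in>Bs. (\<xi> c x - \<xi> c p) * G c x))" for b G V'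
  have "\<exists>G V'. P b G V'" for b
  proof -
    obtain G V' where G: "\<And>c. G c \<in> \<F>" "open V'" "p \<in> V'" "V' \<subseteq> V"
        "\<And>x. x \<in> V' \<Longrightarrow> g b x = g b p + (\<Sum>c\<in>Bs. (\<xi> c x - \<xi> c p) * G c x)"
      using Hadamard_coordinates[OF c g(1)[of b]] by blast
    show ?thesis unfolding P_def
      by (intro exI[of _ G] exI[of _ V'] conjI allI ballI G(1,2,3,5))
  qed
  then obtain G VV where "\<And>b. P b (G b) (VV b)" by metis
  then have G: "\<And>b c. G b c \<in> \<F>" "\<And>b. open (VV b)" "\<And>b. p \<in> VV b"
      "\<And>b x. x \<in> VV b \<Longrightarrow> g b x = g b p + (\<Sum>c\<in>Bs. (\<xi> c x - \<xi> c p) * G b c x)"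
    unfolding P_def by blast+
  define V' where "V' = V1 \<inter> (\<Inter>b\<in>Bs. VV b)"
  have V': "open V'" "p \<in> V'" "V' \<subseteq> V" using g(2-4) G(2,3) Bs(4) by (auto simp: V'_def)
  define q where "q = (\<lambda>(b, c) x. (\<xi> b x - \<xi> b p) * (\<xi> c x - \<xi> c p) * G b c x)"
  have q: "q k \<in> \<F>" for k
    by (cases k) (auto simp: q_def intro!: smooth_mult d G)
  have exp: "f x = f p + (\<Sum>k\<in>Bs \<times> Bs. q k x)" if x: "x \<in> V'" for x
  proof -
    have "f x = f p + (\<Sum>b\<in>Bs. (\<xi> b x - \<xi> b p) * g b x)" using g(5) x by (simp add: V'_def)
    also have "(\<Sum>b\<in>Bs. (\<xi> b x - \<xi> b p) * g b x) = (\<Sum>b\<in>Bs. \<Sum>c\<in>Bs. q (b, c) x)"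
    proof (rule sum.cong[OF refl])
      fix b assume b: "b \<in> Bs"
      then have "g b x = (\<Sum>c\<in>Bs. (\<xi> c x - \<xi> c p) * G b c x)"
        using G(4)[of x b] x b unfolding g0[OF b] by (simp add: V'_def)
      then show "(\<xi> b x - \<xi> b p) * g b x = (\<Sum>c\<in>Bs. q (b, c) x)"
        by (simp add: q_def sum_distrib_left mult.assoc)
    qed
    finally show ?thesis by (simp add: sum.cartesian_product)
  qed
  have s: "(\<lambda>x. \<Sum>k\<in>Bs \<times> Bs. q k x) \<in> \<F>" using Bs(4) q by (intro smooth_sum) auto
  have WW: "W (W f) p = 2 * (\<Sum>(b, c)\<in>Bs \<times> Bs. W (\<xi> b) p * W (\<xi> c) p * G b c p)"
    if W: "vector_field A W" for W
  proof -
    note v = derivation_at_vector_field[OF W]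
    have "W f x = W (\<lambda>x. \<Sum>k\<in>Bs \<times> Bs. q k x) x" if "x \<in> V'" for x
    proof -
      have "W f x = W (\<lambda>x. f p + (\<Sum>k\<in>Bs \<times> Bs. q k x)) x"
        by (rule derivation_at_local[OF v f(1) smooth_add[OF smooth_const s] V'(1) that exp])
      then show ?thesis using derivation_at_add[OF v smooth_const s] derivation_at_const[OF v] by simp
    qed
    then have "W (W f) p = W (W (\<lambda>x. \<Sum>k\<in>Bs \<times> Bs. q k x)) p"
      by (intro derivation_at_local[OF v _ _ V'(1,2)] vector_field_smooth[OF W] f(1) s)
    also have "\<dots> = (\<Sum>k\<in>Bs \<times> Bs. W (W (q k)) p)"
      using Bs(4) q by (intro second_derivative_sum[OF W]) auto
    also have "\<dots> = (\<Sum>(b, c)\<in>Bs \<times> Bs. 2 * (W (\<xi> b) p * W (\<xi> c) p * G b c p))"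
    proof (rule sum.cong[OF refl])
      fix k assume "k \<in> Bs \<times> Bs"
      obtain b c where k: "k = (b, c)" by (cases k)
      have Wd: "W (\<lambda>x. \<xi> b x - \<xi> b p) p = W (\<xi> b) p" for b
        using derivation_at_diff[OF v \<xi> smooth_const] derivation_at_const[OF v] by simp
      show "W (W (q k)) p = (case k of (b, c) \<Rightarrow> 2 * (W (\<xi> b) p * W (\<xi> c) p * G b c p))"
        using second_derivative_product[OF W d[of b] d[of c] G(1)[of b c]] by (simp add: k q_def Wd)
    qed
    finally show ?thesis by (simp add: sum_distrib_left split_beta)
  qed
  show thesis
    using that[OF G(1) V'] exp WW unfolding q_def by (simp add: split_beta)
qed

lemma coordinates_tendsto:
  assumes c: "coordinates U \<phi> V \<xi>" "p \<in> V" and x: "\<And>n. x n \<in> V" "(\<lambda>n. \<phi> (x n)) \<longlonglongrightarrow> \<phi> p"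
  shows "x \<longlonglongrightarrow> p"
proof (rule topological_tendstoI)
  fix S assume S: "open S" "p \<in> S"
  have ch: "(U, \<phi>) \<in> A" "V \<subseteq> U" "open V" using c by (auto simp: coordinates_def)
  obtain \<delta> where \<delta>: "\<delta> > 0" "\<And>y. y \<in> E \<Longrightarrow> dist (\<phi> p) y \<le> \<delta> \<Longrightarrow> y \<in> \<phi> ` (S \<inter> V)"
    using chart_image_ball[OF ch(1), of "S \<inter> V" p] S ch(2,3) c(2) by blast
  have "eventually (\<lambda>n. dist (\<phi> (x n)) (\<phi> p) < \<delta>) sequentially"
    using x(2) \<delta>(1) by (rule tendstoD)
  then show "eventually (\<lambda>n. x n \<in> S) sequentially"
  proof eventually_elim
    case (elim n)
    have "\<phi> (x n) \<in> \<phi> ` (S \<inter> V)"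
      using elim x(1)[of n] ch(2) chart_in_E[OF ch(1)] by (intro \<delta>(2)) (auto simp: dist_commute)
    then show "x n \<in> S" using x(1)[of n] ch(2) chart_inj[OF ch(1)] by (auto simp: inj_on_def)
  qed
qed

lemma isolated_in_level_set:
  assumes K: "K \<subseteq> \<F>" and h: "h \<in> \<F>" "critical_point A h p"
    and level: "\<And>x. \<forall>k\<in>K. k x = k p \<Longrightarrow> h x = h p"
    and pos: "\<And>v. v \<in> tangent_space A p \<Longrightarrow> v \<noteq> (\<lambda>f. 0) \<Longrightarrow> \<forall>k\<in>K. v k = 0 \<Longrightarrow> hessian A h p v v > 0"
  shows "\<exists>S. open S \<and> p \<in> S \<and> (\<forall>x\<in>S. (\<forall>k\<in>K. k x = k p) \<longrightarrow> x = p)"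
proof (rule ccontr)
  assume nonisol: "\<not> ?thesis"
  obtain U \<phi> V \<xi> where c: "coordinates U \<phi> V \<xi>" "p \<in> V" using coordinates_exist by blast
  have ch: "(U, \<phi>) \<in> A" "V \<subseteq> U" "open V" and \<xi>: "\<And>b. \<xi> b \<in> \<F>" "\<And>b x. x \<in> V \<Longrightarrow> \<xi> b x = \<phi> x \<bullet> b"
    using c by (auto simp: coordinates_def)
  have "\<exists>x. x \<in> V \<and> \<phi> x \<in> ball (\<phi> p) (1 / Suc n) \<and> x \<noteq> p \<and> (\<forall>k\<in>K. k x = k p)" for n
  proof -
    have "open (V \<inter> (U \<inter> \<phi> -` ball (\<phi> p) (1 / Suc n)))"
      using chart_preimage_open[OF ch(1) open_ball] ch(3) by blast
    moreover have "p \<in> V \<inter> (U \<inter> \<phi> -` ball (\<phi> p) (1 / Suc n))" using c(2) ch(2) by auto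
    ultimately obtain x where "x \<in> V \<inter> (U \<inter> \<phi> -` ball (\<phi> p) (1 / Suc n))" "\<forall>k\<in>K. k x = k p" "x \<noteq> p"
      using nonisol by metis
    then show ?thesis by blast
  qed
  then obtain x where x: "\<And>n. x n \<in> V" "\<And>n. \<phi> (x n) \<in> ball (\<phi> p) (1 / Suc n)" "\<And>n. x n \<noteq> p"
      "\<And>n k. k \<in> K \<Longrightarrow> k (x n) = k p"
    by metis
  have lim\<phi>: "(\<lambda>n. \<phi> (x n)) \<longlonglongrightarrow> \<phi> p"
  proof (rule metric_LIMSEQ_I)
    fix r :: real assume "r > 0"
    then obtain N where N: "inverse (real (Suc N)) < r" using reals_Archimedean by blast
    have "dist (\<phi> (x n)) (\<phi> p) < r" if "n \<ge> N" for n
    proof -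
      have "dist (\<phi> (x n)) (\<phi> p) < 1 / Suc n" using x(2)[of n] by (simp add: dist_commute)
      also have "\<dots> \<le> 1 / Suc N" using that by (intro divide_left_mono) auto
      finally show ?thesis using N by (simp add: inverse_eq_divide)
    qed
    then show "\<exists>N. \<forall>n\<ge>N. dist (\<phi> (x n)) (\<phi> p) < r" by blast
  qed
  have lim: "x \<longlonglongrightarrow> p" by (rule coordinates_tendsto[OF c x(1) lim\<phi>])
  \<comment> \<open>Approaching points of the level set are written in polar form around
    \<open>p\<close>. Normalising in the chart puts the directions on the compact unit sphere of
    \<open>E\<close>, from which a convergent subsequence can be drawn.\<close>
  define d where "d n = norm (\<phi> (x n) - \<phi> p)" for n
  define u where "u n = (1 / d n) *\<^sub>R (\<phi> (x n) - \<phi> p)" for n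
  have d: "d n > 0" for n
    using x(1,3)[of n] c(2) ch(2) chart_inj[OF ch(1)] by (auto simp: d_def inj_on_def)
  have uS: "u n \<in> sphere 0 1 \<inter> E" for n
    using d[of n] chart_in_E[OF ch(1)] ch(2) x(1)[of n] c(2)
    by (auto simp: u_def d_def intro!: subspace_scale[OF subspace_E] subspace_diff[OF subspace_E])
  have \<xi>u: "\<xi> b (x n) - \<xi> b p = d n * (u n \<bullet> b)" for b n
    using d[of n] \<xi>(2) x(1) c(2) by (simp add: u_def inner_diff_left)
  have "compact (sphere 0 1 \<inter> E)"
    by (intro compact_Int_closed compact_sphere closed_subspace subspace_E)
  then obtain u0 r where u0: "u0 \<in> sphere 0 1 \<inter> E" "strict_mono r" "(u \<circ> r) \<longlonglongrightarrow> u0"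
    using uS unfolding compact_def by metis
  have gl: "(\<lambda>n. g (x (r n))) \<longlonglongrightarrow> g p" if "g \<in> \<F>" for g
  proof -
    have "isCont g p" using smooth_continuous[OF that, of UNIV] by (simp add: continuous_on_eq_continuous_at)
    then have "(\<lambda>n. g (x n)) \<longlonglongrightarrow> g p" using lim isCont_tendsto_compose by blast
    from LIMSEQ_subseq_LIMSEQ[OF this u0(2)] show ?thesis by (simp add: o_def)
  qed
  have ul: "(\<lambda>n. u (r n) \<bullet> b) \<longlonglongrightarrow> u0 \<bullet> b" for b
    using tendsto_inner[OF u0(3) tendsto_const, of b] by (simp add: o_def)
  have ev: "eventually (\<lambda>n. x (r n) \<in> S) sequentially" if "open S" "p \<in> S" for S
    using topological_tendstoD[OF LIMSEQ_subseq_LIMSEQ[OF lim u0(2)] that] by (simp add: o_def)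
  obtain W where W: "vector_field A W" "\<And>b. W (\<xi> b) p = u0 \<bullet> b"
    using vector_field_with_value[OF c] u0(1) by blast
  define v where "v f = (if f \<in> \<F> then W f p else 0)" for f
  have v: "v \<in> tangent_space A p"
    unfolding v_def by (rule tangent_vectorI[OF derivation_at_vector_field[OF W(1)]])
  have "v k = 0" if k: "k \<in> K" for k
  proof -
    have kF: "k \<in> \<F>" using K k by blast
    obtain g V' where g: "\<And>b. g b \<in> \<F>" "open V'" "p \<in> V'" "V' \<subseteq> V"
        "\<And>x. x \<in> V' \<Longrightarrow> k x = k p + (\<Sum>b\<in>Bs. (\<xi> b x - \<xi> b p) * g b x)"
      using Hadamard_coordinates[OF c kF] by blast
    have "(\<lambda>n. \<Sum>b\<in>Bs. (u (r n) \<bullet> b) * g b (x (r n))) \<longlonglongrightarrow> (\<Sum>b\<in>Bs. (u0 \<bullet> b) * g b p)"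
      by (intro tendsto_sum tendsto_mult ul gl g(1))
    moreover have "eventually (\<lambda>n. (\<Sum>b\<in>Bs. (u (r n) \<bullet> b) * g b (x (r n))) = 0) sequentially"
      using ev[OF g(2,3)]
    proof eventually_elim
      case (elim n)
      \<comment> \<open>Equal values of \<open>k\<close> cancel the constant term of the expansion,
        and each increment carries one factor \<open>d\<close>. Dividing by it leaves a relation
        that passes to the limit direction \<open>u0\<close>.\<close>
      have "d (r n) * (\<Sum>b\<in>Bs. (u (r n) \<bullet> b) * g b (x (r n))) = 0"
        using g(5)[OF elim] x(4)[OF k] by (simp add: \<xi>u sum_distrib_left mult.assoc)
      then show ?case using d[of "r n"] by simp
    qed
    then have "(\<lambda>n. \<Sum>b\<in>Bs. (u (r n) \<bullet> b) * g b (x (r n))) \<longlonglongrightarrow> 0" by (rule tendsto_eventually)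
    ultimately have "(\<Sum>b\<in>Bs. (u0 \<bullet> b) * g b p) = 0" by (rule LIMSEQ_unique)
    then show ?thesis
      using derivation_at_Hadamard[OF derivation_at_vector_field[OF W(1)] kF \<xi>(1) g(1,2,3,5)] W(2) kF
      by (simp add: v_def)
  qed
  moreover have "v \<noteq> (\<lambda>f. 0)"
  proof
    assume "v = (\<lambda>f. 0)"
    \<comment> \<open>The coordinates are available for every \<open>b\<close>, so a vanishing
      tangent vector would make the unit vector \<open>u0\<close> orthogonal to itself.\<close>
    then have "u0 \<bullet> b = 0" for b using W(2)[of b] \<xi>(1)[of b] v_def by (metis)
    then have "u0 = 0" using inner_eq_zero_iff by blast
    then show False using u0(1) by simp
  qed
  ultimately have "hessian A h p v v > 0" using pos[OF v] by blast
  then have pos': "W (W h) p > 0"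
    using hessian_eq[OF h W(1), of v] by (simp add: v_def)
  obtain g V' where g: "\<And>b c. g b c \<in> \<F>" "open V'" "p \<in> V'" "V' \<subseteq> V"
    "\<And>x. x \<in> V' \<Longrightarrow> h x = h p + (\<Sum>(b, c)\<in>Bs \<times> Bs. (\<xi> b x - \<xi> b p) * (\<xi> c x - \<xi> c p) * g b c x)"
    "\<And>W. vector_field A W \<Longrightarrow> W (W h) p = 2 * (\<Sum>(b, c)\<in>Bs \<times> Bs. W (\<xi> b) p * W (\<xi> c) p * g b c p)"
    using critical_point_expansion[OF c h] by blast
  have "(\<lambda>n. \<Sum>k\<in>Bs \<times> Bs. (u (r n) \<bullet> fst k) * (u (r n) \<bullet> snd k) * g (fst k) (snd k) (x (r n))) \<longlonglongrightarrow>
      (\<Sum>k\<in>Bs \<times> Bs. (u0 \<bullet> fst k) * (u0 \<bullet> snd k) * g (fst k) (snd k) p)"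
    by (intro tendsto_sum tendsto_mult ul gl g(1))
  moreover have "eventually (\<lambda>n. (\<Sum>k\<in>Bs \<times> Bs. (u (r n) \<bullet> fst k) * (u (r n) \<bullet> snd k) * g (fst k) (snd k) (x (r n))) = 0)
      sequentially"
    using ev[OF g(2,3)]
  proof eventually_elim
    case (elim n)
    have "h (x (r n)) = h p" using level x(4) by blast
    \<comment> \<open>At second order each product of increments carries two factors
      \<open>d\<close>; after division the limit is half the second derivative along
      \<open>W\<close>, which was shown to be positive.\<close>
    then have "(d (r n))\<^sup>2 * (\<Sum>k\<in>Bs \<times> Bs. (u (r n) \<bullet> fst k) * (u (r n) \<bullet> snd k) * g (fst k) (snd k) (x (r n))) = 0"
      using g(5)[OF elim] by (simp add: \<xi>u sum_distrib_left split_beta power2_eq_square mult_ac)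
    then show ?case using d[of "r n"] by simp
  qed
  then have "(\<lambda>n. \<Sum>k\<in>Bs \<times> Bs. (u (r n) \<bullet> fst k) * (u (r n) \<bullet> snd k) * g (fst k) (snd k) (x (r n))) \<longlonglongrightarrow> 0"
    by (rule tendsto_eventually)
  ultimately have "(\<Sum>k\<in>Bs \<times> Bs. (u0 \<bullet> fst k) * (u0 \<bullet> snd k) * g (fst k) (snd k) p) = 0"
    by (rule LIMSEQ_unique)
  then show False using pos' g(6)[OF W(1)] by (simp add: W(2) split_beta)
qed

section \<open>Trapping of integral curves by conserved functions\<close>

text \<open>The model-space solution exists for all times from the outset. What has to be shown is
  that it never reaches the sphere on which \<open>\<Psi>\<close> exceeds its initial value, for
  only inside does it represent an integral curve of \<open>X\<close>.\<close>

lemma trapped_integral_curves: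
  assumes X: "vector_field A X" and \<Psi>: "continuous_on UNIV \<Psi>" "\<Psi> p = 0" "\<And>x. \<Psi> x \<ge> (0 :: real)"
    and isol: "open S" "p \<in> S" "\<And>x. x \<in> S \<Longrightarrow> \<Psi> x = 0 \<Longrightarrow> x = p"
    and cons: "\<And>J c t. integral_curve UNIV \<F> X J c \<Longrightarrow> 0 \<in> J \<Longrightarrow> c 0 \<in> N \<Longrightarrow> t \<in> J \<Longrightarrow> \<Psi> (c t) = \<Psi> (c 0)"
    and O: "open O'" "p \<in> O'"
  shows "\<exists>V. open V \<and> p \<in> V \<and> (\<forall>x\<in>V \<inter> N. \<exists>c. integral_curve UNIV \<F> X UNIV c \<and> c 0 = x \<and> (\<forall>t. c t \<in> O'))"
proof -
  obtain U \<phi> V \<xi> \<epsilon> Y L M where fb: "flow_box X p U \<phi> V \<xi> \<epsilon> Y L M"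
    using flow_box_exists[OF X] by blast
  then have ch: "(U, \<phi>) \<in> A" "V \<subseteq> U" "open V" "p \<in> V" "\<epsilon> > 0" and YE: "\<And>y. Y y \<in> E"
    by (auto simp: flow_box_def coordinates_def)
  obtain \<delta>0 where \<delta>0: "\<delta>0 > 0" "\<And>y. y \<in> E \<Longrightarrow> dist (\<phi> p) y \<le> \<delta>0 \<Longrightarrow> y \<in> \<phi> ` (V \<inter> S \<inter> O')"
    using chart_image_ball[OF ch(1), of "V \<inter> S \<inter> O'" p] ch isol(1,2) O by blast
  define \<delta> where "\<delta> = min \<delta>0 (\<epsilon> / 2)"
  have \<delta>: "\<delta> > 0" "\<delta> < \<epsilon>" using \<delta>0(1) ch(5) by (auto simp: \<delta>_def)
  let ?\<psi> = "inv_into U \<phi>"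
  have \<psi>: "?\<psi> y \<in> V \<inter> S \<inter> O' \<and> \<phi> (?\<psi> y) = y \<and> y \<in> \<phi> ` U" if "y \<in> E" "y \<in> cball (\<phi> p) \<delta>" for y
  proof -
    have "y \<in> \<phi> ` (V \<inter> S \<inter> O')" using that by (intro \<delta>0(2)) (auto simp: \<delta>_def)
    then obtain x where "x \<in> V \<inter> S \<inter> O'" "y = \<phi> x" by blast
    then show ?thesis using chart_inv[OF ch(1)] ch(2) by auto
  qed
  have \<Psi>c: "continuous_on T (\<lambda>y. \<Psi> (?\<psi> y))" if "T \<subseteq> cball (\<phi> p) \<delta> \<inter> E" for T
  proof -
    have "T \<subseteq> \<phi> ` U" using that \<psi> by blast
    then show ?thesis
      by (intro continuous_on_compose2[OF \<Psi>(1)] continuous_on_subset[OF chart_cont_inv[OF ch(1)]]) auto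
  qed
  define K where "K = sphere (\<phi> p) \<delta> \<inter> E"
  have K: "compact K" unfolding K_def by (intro compact_Int_closed compact_sphere closed_subspace subspace_E)
  have \<Psi>K: "\<Psi> (?\<psi> y) > 0" if "y \<in> K" for y
  proof -
    have y: "?\<psi> y \<in> S" "\<phi> (?\<psi> y) = y" using \<psi>[of y] that by (auto simp: K_def)
    have "?\<psi> y \<noteq> p" using y(2) that \<delta>(1) by (auto simp: K_def)
    then show ?thesis using isol(3)[OF y(1)] \<Psi>(3)[of "?\<psi> y"] by fastforce
  qed
  obtain m where m: "m > 0" "\<And>y. y \<in> K \<Longrightarrow> m \<le> \<Psi> (?\<psi> y)"
  \<comment> \<open>If the model space has dimension zero, the sphere is empty and any positive
    bound will do.\<close>
  proof (cases "K = {}")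
    case False
    have "continuous_on K (\<lambda>y. \<Psi> (?\<psi> y))" by (rule \<Psi>c) (auto simp: K_def)
    then obtain y0 where "y0 \<in> K" "\<forall>y\<in>K. \<Psi> (?\<psi> y0) \<le> \<Psi> (?\<psi> y)"
      using continuous_attains_inf[OF K False] by blast
    then show thesis using that \<Psi>K by blast
  qed (use that[of 1] in auto)
  define V' where "V' = (U \<inter> \<phi> -` ball (\<phi> p) \<delta>) \<inter> \<Psi> -` {..<m}"
  have "open V'"
    unfolding V'_def
    by (intro open_Int chart_preimage_open[OF ch(1)] open_ball open_vimage[OF open_lessThan] \<Psi>(1))
  moreover have "p \<in> V'" using ch \<delta> m(1) \<Psi>(2) by (auto simp: V'_def)
  moreover have "\<exists>c. integral_curve UNIV \<F> X UNIV c \<and> c 0 = x \<and> (\<forall>t. c t \<in> O')" if x: "x \<in> V' \<inter> N" for x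
  proof -
    have xU: "x \<in> U" and xd: "\<phi> x \<in> ball (\<phi> p) \<delta>" and xm: "\<Psi> x < m" using x by (auto simp: V'_def)
    obtain y where y: "y 0 = \<phi> x" "\<And>t. (y has_vector_derivative Y (y t)) (at t)"
      using flow_box_solution[OF fb] by blast
    have y0E: "y 0 \<in> E" using y(1) chart_in_E[OF ch(1) xU] by simp
    have yE: "y t \<in> E" for t using solution_in_subspace[OF y(2) y0E YE] .
    have yc: "continuous_on T y" for T
      using y(2) has_vector_derivative_continuous continuous_at_imp_continuous_on by blast
    let ?c = "\<lambda>t. ?\<psi> (y t)"
    have c0: "?c 0 = x" using y(1) chart_inv[OF ch(1) xU] by simp
    define R where "R = y -` ball (\<phi> p) \<delta>"
    have R: "open R" unfolding R_def by (intro open_vimage open_ball yc)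
    \<comment> \<open>Conservation applies only while the curve is known to be an integral curve,
      that is on the component of time \<open>0\<close>. Showing this open component to be closed
      makes it the whole line.\<close>
    define J where "J = connected_component_set R 0"
    have "0 \<in> R" using xd y(1) by (simp add: R_def)
    then have J: "open J" "connected J" "0 \<in> J" "J \<subseteq> R"
      using R by (auto simp: J_def open_connected_component connected_component_subset)
    have ic: "integral_curve UNIV \<F> X J ?c"
    proof (rule integral_curve_of_solution(1)[OF fb y(2) y0E J(1)])
      show "is_interval J" using J(2) by (simp add: is_interval_connected_1)
      show "dist (\<phi> p) (y t) < \<epsilon>" if "t \<in> J" for t using that J(4) \<delta>(2) by (auto simp: R_def)
    qed
    have inv: "\<Psi> (?c t) = \<Psi> x" if "t \<in> J" for t
      using cons[OF ic J(3) _ that] c0 x by simp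
    \<comment> \<open>The inverse chart is meaningful only over the chart image, so continuity of
      \<open>\<Psi>\<close> along the curve is claimed just for times in the closed ball. These form
      a closed set, hence the level relation extends to the closure of \<open>J\<close>.\<close>
    define Z where "Z = y -` cball (\<phi> p) \<delta>"
    have Z: "closed Z" unfolding Z_def by (intro closed_vimage closed_cball yc)
    have "continuous_on Z (\<lambda>t. \<Psi> (?c t))"
      by (rule continuous_on_compose2[OF \<Psi>c[OF order_refl] yc]) (auto simp: Z_def yE)
    then have "closed {t \<in> Z. \<Psi> (?c t) = \<Psi> x}"
      using Z by (intro continuous_closed_preimage_constant)
    moreover have "J \<subseteq> {t \<in> Z. \<Psi> (?c t) = \<Psi> x}"
      using inv J(4) by (auto simp: Z_def R_def)
    ultimately have cl: "closure J \<subseteq> {t \<in> Z. \<Psi> (?c t) = \<Psi> x}" by (rule closure_minimal[rotated])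
    have "closure J \<subseteq> R"
    proof
      fix t assume t: "t \<in> closure J"
      then have tz: "y t \<in> cball (\<phi> p) \<delta>" "\<Psi> (?c t) = \<Psi> x" using cl by (auto simp: Z_def)
      then have "y t \<notin> K" using m(2)[of "y t"] xm by auto
      then show "t \<in> R" using tz(1) yE[of t] by (auto simp: K_def R_def)
    qed
    moreover have "connected (closure J)" using J(2) by (rule connected_imp_connected_closure)
    moreover have "0 \<in> closure J" using J(3) closure_subset by blast
    ultimately have "closure J \<subseteq> J" using connected_component_maximal[of 0 "closure J" R] by (simp add: J_def)
    then have "closed J" using closure_subset_eq by blast
    then have JU: "J = UNIV" using J(1,3) clopen by blast
    have "?c t \<in> O'" for t
    proof -
      have "t \<in> R" using J(4) JU by blast
      then show ?thesis using \<psi>[OF yE, of t] by (simp add: R_def)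
    qed
    then show ?thesis using ic c0 unfolding JU by (intro exI[of _ ?c]) auto
  qed
  ultimately show ?thesis by blast
qed

end

section \<open>Hamiltonian flows and Poisson ideals\<close>

locale poisson_ideal = manifold E A
  for E :: "'e::euclidean_space set"
    and A :: "('a::{t2_space,second_countable_topology}, 'e) chart set" +
  fixes B :: "('a \<Rightarrow> real) \<Rightarrow> ('a \<Rightarrow> real) \<Rightarrow> 'a \<Rightarrow> real" and m :: nat and G :: "nat \<Rightarrow> 'a \<Rightarrow> real"
  assumes poisson: "poisson_manifold E A B" and gen: "generates_poisson_ideal A B m G"
begin

abbreviation N :: "'a set" where "N \<equiv> vanishing_set (generated_ideal A m G)"

lemma G_smooth: "i \<in> {1..m} \<Longrightarrow> G i \<in> \<F>"
  using gen by (simp add: generates_poisson_ideal_def)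

lemma vanishing_set_iff: "z \<in> N \<longleftrightarrow> (\<forall>i\<in>{1..m}. G i z = 0)"
proof
  assume z: "z \<in> N"
  show "\<forall>i\<in>{1..m}. G i z = 0"
  proof
    fix i assume i: "i \<in> {1..m}"
    \<comment> \<open>Constant Kronecker coefficients exhibit the generator \<open>G i\<close> as an
      element of the ideal.\<close>
    have "(\<lambda>z. \<Sum>k=1..m. (if k = i then 1 else 0) * G k z) \<in> generated_ideal A m G"
      unfolding generated_ideal_def
      using smooth_const by (intro CollectI exI[of _ "\<lambda>k z. if k = i then 1 else 0"]) auto
    then have "(\<Sum>k=1..m. (if k = i then 1 else 0) * G k z) = 0"
      using z by (auto simp: vanishing_set_def)
    moreover have "(\<Sum>k=1..m. (if k = i then 1 else 0) * G k z) = (\<Sum>k=1..m. if k = i then G k z else 0)"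
      by (intro sum.cong) auto
    ultimately show "G i z = 0" using i by simp
  qed
qed (auto simp: vanishing_set_def generated_ideal_def)

lemma bracket_skew: "f \<in> \<F> \<Longrightarrow> g \<in> \<F> \<Longrightarrow> B f g z = - B g f z"
  using poisson unfolding poisson_manifold_def by blast

lemma hamiltonian_vector_field: "H \<in> \<F> \<Longrightarrow> vector_field A (hamiltonian_field B H)"
proof -
  assume H: "H \<in> \<F>"
  have "(\<forall>f\<in>\<F>. \<forall>g\<in>\<F>. B f g \<in> \<F>) \<and>
    (\<forall>f\<in>\<F>. \<forall>g\<in>\<F>. \<forall>h\<in>\<F>. \<forall>z. B (\<lambda>x. f x + g x) h z = B f h z + B g h z) \<and>
    (\<forall>c. \<forall>f\<in>\<F>. \<forall>g\<in>\<F>. \<forall>z. B (\<lambda>x. c * f x) g z = c * B f g z) \<and>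
    (\<forall>f\<in>\<F>. \<forall>g\<in>\<F>. \<forall>h\<in>\<F>. \<forall>z. B (\<lambda>x. f x * g x) h z = f z * B g h z + B f h z * g z)"
    using poisson unfolding poisson_manifold_def by (elim conjE, intro conjI)
  then show ?thesis
    using H unfolding vector_field_def hamiltonian_field_def by (simp add: add.commute)
qed

lemma vanishing_set_invariant:
  assumes H: "H \<in> \<F>" and c: "integral_curve UNIV \<F> (hamiltonian_field B H) J c"
    and s: "s \<in> J" "c s \<in> N" and t: "t \<in> J"
  shows "c t \<in> N"
proof -
  \<comment> \<open>The ideal condition has the generator in the second slot of the bracket. Skew
    symmetry later converts this into the derivative of \<open>G i\<close> along the curve, which
    accounts for the minus signs below.\<close>
  have "\<exists>h. (\<forall>j\<in>{1..m}. h j \<in> \<F>) \<and> (\<forall>z. B H (G i) z = (\<Sum>j=1..m. h j z * G j z))" if "i \<in> {1..m}" for i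
    using gen H that unfolding generates_poisson_ideal_def by blast
  then obtain h where h: "\<And>i j. i \<in> {1..m} \<Longrightarrow> j \<in> {1..m} \<Longrightarrow> h i j \<in> \<F>"
      "\<And>i z. i \<in> {1..m} \<Longrightarrow> B H (G i) z = (\<Sum>j=1..m. h i j z * G j z)"
    by metis
  define a where "a = min s t"
  define b where "b = max s t"
  have J: "{a..b} \<subseteq> J"
  proof
    fix x assume "x \<in> {a..b}"
    then have "s \<le> x \<and> x \<le> t \<or> t \<le> x \<and> x \<le> s" by (auto simp: a_def b_def min_def max_def split: if_splits)
    then show "x \<in> J" using c s(1) t unfolding integral_curve_def is_interval_1 by blast
  qed
  have cc: "continuous_on {a..b} c" using c J continuous_on_subset by (auto simp: integral_curve_def)
  have "\<exists>M. \<forall>x\<in>{a..b}. \<bar>h i j (c x)\<bar> \<le> M" if "i \<in> {1..m}" "j \<in> {1..m}" for i j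
  proof -
    have "continuous_on {a..b} (\<lambda>x. h i j (c x))"
      by (rule continuous_on_compose2[OF smooth_continuous[OF h(1)[OF that]] cc]) (rule subset_UNIV)
    then have "bounded ((\<lambda>x. h i j (c x)) ` {a..b})"
      by (intro compact_imp_bounded compact_continuous_image) auto
    then show ?thesis by (auto simp: bounded_iff)
  qed
  then obtain M where M: "\<And>i j x. i \<in> {1..m} \<Longrightarrow> j \<in> {1..m} \<Longrightarrow> x \<in> {a..b} \<Longrightarrow> \<bar>h i j (c x)\<bar> \<le> M i j"
    by metis
  define K where "K = (\<Sum>i=1..m. \<Sum>j=1..m. \<bar>M i j\<bar>)"
  have MK: "\<bar>h i j (c x)\<bar> \<le> K" if "i \<in> {1..m}" "j \<in> {1..m}" "x \<in> {a..b}" for i j x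
  proof -
    have "\<bar>h i j (c x)\<bar> \<le> \<bar>M i j\<bar>" using M[OF that] by simp
    also have "\<dots> \<le> (\<Sum>j=1..m. \<bar>M i j\<bar>)" using that by (intro member_le_sum) auto
    also have "\<dots> \<le> K" unfolding K_def
      using that by (intro member_le_sum[of i _ "\<lambda>i. \<Sum>j=1..m. \<bar>M i j\<bar>"]) (auto intro: sum_nonneg)
    finally show ?thesis .
  qed
  define u where "u x = (\<Sum>i=1..m. (G i (c x))\<^sup>2)" for x
  define u' where "u' x = (\<Sum>i=1..m. 2 * G i (c x) * - (\<Sum>j=1..m. h i j (c x) * G j (c x)))" for x
  have "u t = 0"
  proof (rule Gronwall_zero[where u = u and u' = u' and K = "2 * m * K" and a = a and b = b and s = s])
    fix x assume x: "x \<in> {a..b}"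
    have dG: "((\<lambda>x. G i (c x)) has_real_derivative - (\<Sum>j=1..m. h i j (c x) * G j (c x))) (at x)"
      if i: "i \<in> {1..m}" for i
    proof -
      have "((\<lambda>x. G i (c x)) has_real_derivative B (G i) H (c x)) (at x)"
        using c G_smooth[OF i] J x unfolding integral_curve_def hamiltonian_field_def by blast
      then show ?thesis using bracket_skew[OF G_smooth[OF i] H] h(2)[OF i] by simp
    qed
    show "(u has_real_derivative u' x) (at x)"
      unfolding u_def u'_def
      by (rule DERIV_sum) (use DERIV_power[OF dG, of _ 2] in \<open>simp add: mult_ac\<close>)
    have "\<bar>u' x\<bar> \<le> (\<Sum>i=1..m. \<bar>2 * G i (c x) * - (\<Sum>j=1..m. h i j (c x) * G j (c x))\<bar>)"
      unfolding u'_def by (rule sum_abs)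
    also have "\<dots> \<le> (\<Sum>i=1..m. \<Sum>j=1..m. K * ((G i (c x))\<^sup>2 + (G j (c x))\<^sup>2))"
    proof (rule sum_mono)
      fix i assume i: "i \<in> {1..m}"
      have "\<bar>2 * G i (c x) * - (\<Sum>j=1..m. h i j (c x) * G j (c x))\<bar> =
          \<bar>\<Sum>j=1..m. 2 * G i (c x) * (h i j (c x) * G j (c x))\<bar>"
        by (simp add: sum_distrib_left)
      also have "\<dots> \<le> (\<Sum>j=1..m. \<bar>2 * G i (c x) * (h i j (c x) * G j (c x))\<bar>)" by (rule sum_abs)
      also have "\<dots> \<le> (\<Sum>j=1..m. K * ((G i (c x))\<^sup>2 + (G j (c x))\<^sup>2))"
      proof (rule sum_mono)
        fix j assume j: "j \<in> {1..m}"
        have "\<bar>2 * G i (c x) * (h i j (c x) * G j (c x))\<bar> = \<bar>h i j (c x)\<bar> * (2 * \<bar>G i (c x)\<bar> * \<bar>G j (c x)\<bar>)"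
          by (simp add: abs_mult)
        also have "\<dots> \<le> K * ((G i (c x))\<^sup>2 + (G j (c x))\<^sup>2)"
          using MK[OF i j x] sum_squares_bound[of "\<bar>G i (c x)\<bar>" "\<bar>G j (c x)\<bar>"]
          by (intro mult_mono) auto
        finally show "\<bar>2 * G i (c x) * (h i j (c x) * G j (c x))\<bar> \<le> K * ((G i (c x))\<^sup>2 + (G j (c x))\<^sup>2)" .
      qed
      finally show "\<bar>2 * G i (c x) * - (\<Sum>j=1..m. h i j (c x) * G j (c x))\<bar> \<le>
          (\<Sum>j=1..m. K * ((G i (c x))\<^sup>2 + (G j (c x))\<^sup>2))" .
    qed
    \<comment> \<open>After \<open>2 * \<bar>a\<bar> * \<bar>b\<bar> \<le> a\<^sup>2 +
      b\<^sup>2\<close>, each square is counted \<open>m\<close> times through \<open>i\<close> and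
      \<open>m\<close> times through \<open>j\<close>.\<close>
    also have "\<dots> = 2 * m * K * u x"
      by (simp add: u_def sum.distrib distrib_left sum_distrib_left[symmetric] mult_ac)
    finally show "\<bar>u' x\<bar> \<le> 2 * m * K * u x" .
    show "u x \<ge> 0" unfolding u_def by (intro sum_nonneg) simp
  next
    show "u s = 0" using s(2) by (simp add: u_def vanishing_set_iff)
  qed (auto simp: a_def b_def)
  then show ?thesis
    unfolding u_def vanishing_set_iff by (subst (asm) sum_nonneg_eq_0_iff) auto
qed

text \<open>\<open>B F H z\<close> is the derivative of \<open>F\<close> along the integral curve of
  the Hamiltonian field of \<open>H\<close> through \<open>z\<close>. This curve remains in
  \<open>N\<close>, so it sees only the restriction of \<open>F\<close> near
  \<open>z\<close>.\<close>

lemma bracket_depends_on_restriction: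
  assumes F: "F1 \<in> \<F>" "F2 \<in> \<F>" "H \<in> \<F>" and z: "z \<in> N" and U: "open U" "z \<in> U" "\<And>x. x \<in> U \<inter> N \<Longrightarrow> F1 x = F2 x"
  shows "B F1 H z = B F2 H z"
proof -
  obtain J c where c: "integral_curve UNIV \<F> (hamiltonian_field B H) J c" "0 \<in> J" "c 0 = z"
    using integral_curve_exists[OF hamiltonian_vector_field[OF F(3)]] by blast
  have cN: "c t \<in> N" if "t \<in> J" for t
    using vanishing_set_invariant[OF F(3) c(1,2) _ that] c(3) z by simp
  have D: "((\<lambda>s. F (c s)) has_real_derivative B F H z) (at 0)" if "F \<in> \<F>" for F
    using c that unfolding integral_curve_def hamiltonian_field_def by fastforce
  have "((\<lambda>s. F2 (c s)) has_real_derivative B F1 H z) (at 0)"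
    by (rule has_field_derivative_transform_within_open[OF D[OF F(1)] integral_curve_preimage_open[OF c(1) U(1)]])
      (use c U cN in auto)
  then show ?thesis using D[OF F(2)] DERIV_unique by blast
qed

text \<open>The extensions are exchanged one argument at a time: directly in the first slot, and in
  the second after a flip by skew symmetry.\<close>

lemma reduced_bracket_eq:
  assumes z: "z \<in> N" and F: "local_extension A N f z F" and G: "local_extension A N g z G'"
  shows "reduced_bracket A B N f g z = B F G' z"
  unfolding reduced_bracket_def
proof (rule the_equality)
  show "\<exists>F' G''. local_extension A N f z F' \<and> local_extension A N g z G'' \<and> B F G' z = B F' G'' z"
    using F G by blast
  fix r assume "\<exists>F' G''. local_extension A N f z F' \<and> local_extension A N g z G'' \<and> r = B F' G'' z"
  then obtain F' G'' where F': "local_extension A N f z F'" and G'': "local_extension A N g z G''"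
    and r: "r = B F' G'' z" by blast
  have eq: "B F1 K z = B F2 K z"
    if F1: "local_extension A N k z F1" and F2: "local_extension A N k z F2" and K: "K \<in> \<F>" for F1 F2 K k
  proof -
    obtain U1 where U1: "open U1" "z \<in> U1" "\<And>x. x \<in> U1 \<inter> N \<Longrightarrow> F1 x = k x"
      using F1 by (auto simp: local_extension_def)
    obtain U2 where U2: "open U2" "z \<in> U2" "\<And>x. x \<in> U2 \<inter> N \<Longrightarrow> F2 x = k x"
      using F2 by (auto simp: local_extension_def)
    show ?thesis
    proof (rule bracket_depends_on_restriction[OF _ _ K z])
      show "F1 \<in> \<F>" "F2 \<in> \<F>" using F1 F2 by (auto simp: local_extension_def)
      show "open (U1 \<inter> U2)" "z \<in> U1 \<inter> U2" using U1 U2 by auto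
      show "F1 x = F2 x" if "x \<in> U1 \<inter> U2 \<inter> N" for x using that U1(3) U2(3) by auto
    qed
  qed
  have sm: "F \<in> \<F>" "G' \<in> \<F>" "F' \<in> \<F>" "G'' \<in> \<F>"
    using F G F' G'' by (auto simp: local_extension_def)
  have "r = B F G'' z" unfolding r using eq[OF F' F sm(4)] .
  also have "\<dots> = - B G'' F z" by (rule bracket_skew[OF sm(1,4)])
  also have "\<dots> = - B G' F z" using eq[OF G'' G sm(1)] by simp
  also have "\<dots> = B F G' z" using bracket_skew[OF sm(1,2)] by simp
  finally show "r = B F G' z" .
qed

section \<open>Comparison of the reduced dynamics with the ambient one\<close>

lemma local_extension_self: "f \<in> \<F> \<Longrightarrow> local_extension A N f z f"
  by (auto simp: local_extension_def)

lemma smooth_imp_smooth_on: "f \<in> \<F> \<Longrightarrow> f \<in> smooth_functions_on A N"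
  using local_extension_self by (auto simp: smooth_functions_on_def)

text \<open>An ambient smooth function is its own extension, which gives one direction. For the
  other, a function on \<open>N\<close> coincides near each time with an ambient extension along the
  curve, because the curve lies in \<open>N\<close>.\<close>

lemma reduced_integral_curve_iff:
  assumes H: "H \<in> \<F>"
  shows "integral_curve N (smooth_functions_on A N) (hamiltonian_field (reduced_bracket A B N) H) J c \<longleftrightarrow>
    integral_curve UNIV \<F> (hamiltonian_field B H) J c \<and> c ` J \<subseteq> N" (is "?L \<longleftrightarrow> ?R")
proof
  assume L: ?L
  then have cN: "c ` J \<subseteq> N" by (simp add: integral_curve_def)
  have "((\<lambda>s. f (c s)) has_real_derivative hamiltonian_field B H f (c t)) (at t)" if f: "f \<in> \<F>" and t: "t \<in> J" for f t
  proof -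
    have "((\<lambda>s. f (c s)) has_real_derivative hamiltonian_field (reduced_bracket A B N) H f (c t)) (at t)"
      using L smooth_imp_smooth_on[OF f] t unfolding integral_curve_def by blast
    moreover have "reduced_bracket A B N f H (c t) = B f H (c t)"
      using cN t by (intro reduced_bracket_eq local_extension_self f H) auto
    ultimately show ?thesis by (simp add: hamiltonian_field_def)
  qed
  then show ?R using L cN by (simp add: integral_curve_def)
next
  assume R: ?R
  then have ic: "integral_curve UNIV \<F> (hamiltonian_field B H) J c" and cN: "\<And>t. t \<in> J \<Longrightarrow> c t \<in> N" by auto
  have "((\<lambda>s. f (c s)) has_real_derivative hamiltonian_field (reduced_bracket A B N) H f (c t)) (at t)"
    if f: "f \<in> smooth_functions_on A N" and t: "t \<in> J" for f t
  proof -
    obtain F where F: "local_extension A N f (c t) F"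
      using f cN[OF t] by (auto simp: smooth_functions_on_def)
    then obtain U where U: "F \<in> \<F>" "open U" "c t \<in> U" "\<And>x. x \<in> U \<inter> N \<Longrightarrow> F x = f x"
      by (auto simp: local_extension_def)
    have "((\<lambda>s. F (c s)) has_real_derivative B F H (c t)) (at t)"
      using ic U(1) t unfolding integral_curve_def hamiltonian_field_def by blast
    then have "((\<lambda>s. f (c s)) has_real_derivative B F H (c t)) (at t)"
      by (rule has_field_derivative_transform_within_open[OF _ integral_curve_preimage_open[OF ic U(2)]])
        (use t U cN in auto)
    then show ?thesis
      unfolding hamiltonian_field_def reduced_bracket_eq[OF cN[OF t] F local_extension_self[OF H]] .
  qed
  then show ?L using R by (simp add: integral_curve_def)
qed

lemma reduced_flow_eq:
  assumes H: "H \<in> \<F>" and c: "integral_curve UNIV \<F> (hamiltonian_field B H) J c" "0 \<in> J" "c 0 \<in> N" "t \<in> J"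
  shows "flow_defined N (smooth_functions_on A N) (hamiltonian_field (reduced_bracket A B N) H) (c 0) t"
    and "flow N (smooth_functions_on A N) (hamiltonian_field (reduced_bracket A B N) H) t (c 0) = c t"
    and "c t \<in> N"
proof -
  have inN: "c s \<in> N" if "s \<in> J" for s
    by (rule vanishing_set_invariant[OF H c(1-3) that])
  then show "c t \<in> N" using c(4) .
  have cN: "c ` J \<subseteq> N" using inN by blast
  show "flow_defined N (smooth_functions_on A N) (hamiltonian_field (reduced_bracket A B N) H) (c 0) t"
    unfolding flow_defined_def reduced_integral_curve_iff[OF H] using c cN by blast
  show "flow N (smooth_functions_on A N) (hamiltonian_field (reduced_bracket A B N) H) t (c 0) = c t"
    unfolding flow_def reduced_integral_curve_iff[OF H]
  proof (rule the_equality)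
    show "\<exists>J' c'. (integral_curve UNIV \<F> (hamiltonian_field B H) J' c' \<and> c' ` J' \<subseteq> N) \<and> 0 \<in> J' \<and> t \<in> J' \<and> c' 0 = c 0 \<and> c' t = c t"
      using c cN by blast
    show "w = c t" if "\<exists>J' c'. (integral_curve UNIV \<F> (hamiltonian_field B H) J' c' \<and> c' ` J' \<subseteq> N) \<and> 0 \<in> J' \<and> t \<in> J' \<and> c' 0 = c 0 \<and> c' t = w" for w
      using that integral_curve_unique[OF hamiltonian_vector_field[OF H] _ c(1) _ c(2) _ _ c(4)] by blast
  qed
qed

text \<open>The derivative of \<open>F\<close> along the curve is \<open>B F H\<close>, which on
  \<open>N\<close> equals the reduced bracket and therefore vanishes. Invariance of \<open>N\<close>
  keeps the whole curve where this holds.\<close>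

lemma sub_casimir_constant:
  assumes H: "H \<in> \<F>" and F: "sub_casimir A B (generated_ideal A m G) F"
    and c: "integral_curve UNIV \<F> (hamiltonian_field B H) J c" "s \<in> J" "c s \<in> N" "t \<in> J"
  shows "F (c t) = F (c s)"
proof -
  have FF: "F \<in> \<F>" using F by (simp add: sub_casimir_def)
  have "((\<lambda>s. F (c s)) has_derivative (\<lambda>h. 0)) (at x)" if x: "x \<in> J" for x
  proof -
    have xN: "c x \<in> N" by (rule vanishing_set_invariant[OF H c(1-3) x])
    have "B F H (c x) = reduced_bracket A B N F H (c x)"
      by (rule reduced_bracket_eq[OF xN local_extension_self[OF FF] local_extension_self[OF H], symmetric])
    also have "\<dots> = 0" using F smooth_imp_smooth_on[OF H] xN by (simp add: sub_casimir_def)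
    finally have "B F H (c x) = 0" .
    moreover have "((\<lambda>s. F (c s)) has_real_derivative B F H (c x)) (at x)"
      using c(1) FF x unfolding integral_curve_def hamiltonian_field_def by blast
    ultimately show ?thesis by (simp add: has_field_derivative_def lambda_zero)
  qed
  moreover have "open J" "connected J" using c(1) by (auto simp: integral_curve_def is_interval_connected_1)
  ultimately show ?thesis
    using has_derivative_zero_unique_connected[of J "\<lambda>s. F (c s)"] c(2,4) by blast
qed

lemma conserved_constant:
  assumes H: "H \<in> \<F>" and f: "conserved UNIV \<F> (hamiltonian_field B H) f"
    and c: "integral_curve UNIV \<F> (hamiltonian_field B H) J c" "0 \<in> J" "t \<in> J"
  shows "f (c t) = f (c 0)"
  using f flow_eq[OF hamiltonian_vector_field[OF H] c] unfolding conserved_def by (metis UNIV_I)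

lemma ideal_stableI:
  assumes H: "H \<in> \<F>" and eq: "equilibrium \<F> (hamiltonian_field B H) ze" and ze: "ze \<in> N"
    and trap: "\<And>O'. open O' \<Longrightarrow> ze \<in> O' \<Longrightarrow> \<exists>V. open V \<and> ze \<in> V \<and>
      (\<forall>x\<in>V \<inter> N. \<exists>c. integral_curve UNIV \<F> (hamiltonian_field B H) UNIV c \<and> c 0 = x \<and> (\<forall>t. c t \<in> O'))"
  shows "ideal_stable A B H (generated_ideal A m G) ze"
  unfolding ideal_stable_def lyapunov_stable_def
proof (intro conjI allI impI)
  show "equilibrium \<F> (hamiltonian_field B H) ze" "ze \<in> N" by fact+
  show "equilibrium (smooth_functions_on A N) (hamiltonian_field (reduced_bracket A B N) H) ze"
    unfolding equilibrium_def hamiltonian_field_def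
  proof
    fix f assume "f \<in> smooth_functions_on A N"
    then obtain F where F: "local_extension A N f ze F" using ze by (auto simp: smooth_functions_on_def)
    have "reduced_bracket A B N f H ze = B F H ze"
      by (rule reduced_bracket_eq[OF ze F local_extension_self[OF H]])
    then show "reduced_bracket A B N f H ze = 0"
      using eq F by (simp add: equilibrium_def hamiltonian_field_def local_extension_def)
  qed
  fix U assume "openin (top_of_set N) U \<and> ze \<in> U"
  then obtain O' where O: "open O'" "U = N \<inter> O'" "ze \<in> O'" by (auto simp: openin_open)
  obtain V where V: "open V" "ze \<in> V"
      "\<And>x. x \<in> V \<inter> N \<Longrightarrow> \<exists>c. integral_curve UNIV \<F> (hamiltonian_field B H) UNIV c \<and> c 0 = x \<and> (\<forall>t. c t \<in> O')"
    using trap[OF O(1,3)] by blast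
  show "\<exists>V. openin (top_of_set N) V \<and> ze \<in> V \<and> (\<forall>x\<in>V. \<forall>t>0.
      flow_defined N (smooth_functions_on A N) (hamiltonian_field (reduced_bracket A B N) H) x t \<and>
      flow N (smooth_functions_on A N) (hamiltonian_field (reduced_bracket A B N) H) t x \<in> U)"
  proof (intro exI[of _ "N \<inter> V"] conjI ballI allI impI)
    show "openin (top_of_set N) (N \<inter> V)" using V(1) by (auto simp: openin_open)
    show "ze \<in> N \<inter> V" using ze V(2) by blast
    fix x and t :: real assume x: "x \<in> N \<inter> V"
    then obtain c where c: "integral_curve UNIV \<F> (hamiltonian_field B H) UNIV c" "c 0 = x" "\<And>t. c t \<in> O'"
      using V(3) by blast
    note fl = reduced_flow_eq[OF H c(1) UNIV_I _ UNIV_I, of t, unfolded c(2)]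
    show "flow_defined N (smooth_functions_on A N) (hamiltonian_field (reduced_bracket A B N) H) x t"
      using fl(1) x by blast
    show "flow N (smooth_functions_on A N) (hamiltonian_field (reduced_bracket A B N) H) t x \<in> U"
      using fl(2,3) x c(3)[of t] O(2) by auto
  qed
qed

end

theorem theorem2p10:
  fixes E :: "'e::euclidean_space set"
    and A :: "('a::{t2_space,second_countable_topology}, 'e) chart set"
    and B :: "('a \<Rightarrow> real) \<Rightarrow> ('a \<Rightarrow> real) \<Rightarrow> 'a \<Rightarrow> real"
    and H :: "'a \<Rightarrow> real"
    and ze :: 'a
    and m r n :: nat
    and G F C :: "nat \<Rightarrow> 'a \<Rightarrow> real"
    and I :: "('a \<Rightarrow> real) set"
    and lam mu nu :: "nat \<Rightarrow> real"
    and H1 :: "'a \<Rightarrow> real"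
    and W :: "(('a \<Rightarrow> real) \<Rightarrow> real) set"
  assumes "poisson_manifold E A B"
    and "H \<in> smooth_functions A"
    and "equilibrium (smooth_functions A) (hamiltonian_field B H) ze"
    and "generates_poisson_ideal A B m G"
    and "I = generated_ideal A m G"
    and "regular_ideal E A I"
    and "\<forall>j\<in>{1..r}. sub_casimir A B I (F j)"
    and "ze \<in> vanishing_set I"
    and "C 0 = H"
    and "\<forall>i\<in>{0..n}. C i \<in> smooth_functions A"
    and "\<forall>i\<in>{0..n}. conserved UNIV (smooth_functions A) (hamiltonian_field B H) (C i)"
    and "H1 = (\<lambda>z. (\<Sum>i=0..n. lam i * C i z) + (\<Sum>j=1..r. mu j * F j z) + (\<Sum>k=1..m. nu k * G k z))"
    and "critical_point A H1 ze"
    and "W = (\<Inter>i\<in>{0..n}. ker_differential A (C i) ze) \<inter>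
             (\<Inter>j\<in>{1..r}. ker_differential A (F j) ze) \<inter>
             (\<Inter>k\<in>{1..m}. ker_differential A (G k) ze)"
    and "\<forall>v\<in>W. v \<noteq> (\<lambda>f. 0) \<longrightarrow> hessian A H1 ze v v > 0"
  shows "ideal_stable A B H I ze"
proof -
  have "smooth_manifold E A"
    using assms(1) unfolding poisson_manifold_def by (elim conjE)
  then interpret poisson_ideal E A B m G
    using assms(1,4) by unfold_locales
  define K where "K = C ` {0..n} \<union> F ` {1..r} \<union> G ` {1..m}"
  have K: "finite K" "K \<subseteq> smooth_functions A"
    using assms(7,10) G_smooth by (auto simp: K_def sub_casimir_def)
  have H1: "H1 \<in> smooth_functions A"
    unfolding assms(12) using K(2)
    by (intro smooth_add smooth_sum smooth_mult smooth_const) (auto simp: K_def)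
  \<comment> \<open>\<open>H1\<close> is a fixed linear combination of members of \<open>K\<close>,
    so it is constant on their common level set.\<close>
  have level: "H1 x = H1 ze" if "\<forall>k\<in>K. k x = k ze" for x
    using that unfolding assms(12) K_def
    by (intro arg_cong2[where f = "(+)"] sum.cong) auto
  have pos: "hessian A H1 ze v v > 0"
    if "v \<in> tangent_space A ze" "v \<noteq> (\<lambda>f. 0)" "\<forall>k\<in>K. v k = 0" for v
    using that assms(15) unfolding assms(14) K_def ker_differential_def by blast
  obtain S where S: "open S" "ze \<in> S" "\<And>x. x \<in> S \<Longrightarrow> \<forall>k\<in>K. k x = k ze \<Longrightarrow> x = ze"
    using isolated_in_level_set[OF K(2) H1 assms(13) level pos] by blast
  \<comment> \<open>Each summand is constant along curves in the vanishing set and nonnegative, so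
    \<open>\<Psi> x = 0\<close> says exactly that \<open>x\<close> is on the common level of
    \<open>ze\<close>. Within \<open>S\<close> this leaves only \<open>ze\<close> itself.\<close>
  define \<Psi> where "\<Psi> x = (\<Sum>k\<in>K. \<bar>k x - k ze\<bar>)" for x
  have \<Psi>0: "\<forall>k\<in>K. k x = k ze" if "\<Psi> x = 0" for x
    using that K(1) by (simp add: \<Psi>_def sum_nonneg_eq_0_iff)
  have const: "k (c t) = k (c 0)"
    if c: "integral_curve UNIV (smooth_functions A) (hamiltonian_field B H) J c" "0 \<in> J" "c 0 \<in> vanishing_set I" "t \<in> J"
      and k: "k \<in> K" for J c t k
  proof -
    note c' = c[unfolded assms(5)]
    have "k \<in> G ` {1..m} \<Longrightarrow> k (c t) = k (c 0)"
      using c'(3) vanishing_set_invariant[OF assms(2) c'] unfolding vanishing_set_iff by auto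
    moreover have "k \<in> F ` {1..r} \<Longrightarrow> k (c t) = k (c 0)"
      using sub_casimir_constant[OF assms(2) _ c'] assms(5,7) by auto
    moreover have "k \<in> C ` {0..n} \<Longrightarrow> k (c t) = k (c 0)"
      using conserved_constant[OF assms(2) _ c(1,2,4)] assms(11) by auto
    ultimately show ?thesis using k by (auto simp: K_def)
  qed
  have \<Psi>c: "continuous_on UNIV \<Psi>"
    unfolding \<Psi>_def using K(2) by (intro continuous_intros smooth_continuous) auto
  show ?thesis
    unfolding assms(5)
  proof (rule ideal_stableI[OF assms(2,3) assms(8)[unfolded assms(5)]])
    fix O' assume O: "open O'" "ze \<in> O'"
    show "\<exists>V. open V \<and> ze \<in> V \<and> (\<forall>x\<in>V \<inter> N. \<exists>c. integral_curve UNIV (smooth_functions A) (hamiltonian_field B H) UNIV c \<and> c 0 = x \<and> (\<forall>t. c t \<in> O'))"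
    proof (rule trapped_integral_curves[OF hamiltonian_vector_field[OF assms(2)] \<Psi>c _ _ S(1,2) _ _ O])
      show "\<Psi> ze = 0" "\<And>x. \<Psi> x \<ge> 0" by (auto simp: \<Psi>_def sum_nonneg)
      show "x = ze" if "x \<in> S" "\<Psi> x = 0" for x using S(3)[OF that(1) \<Psi>0[OF that(2)]] .
      show "\<Psi> (c t) = \<Psi> (c 0)"
        if "integral_curve UNIV (smooth_functions A) (hamiltonian_field B H) J c" "0 \<in> J" "c 0 \<in> N" "t \<in> J" for J c t
        unfolding \<Psi>_def
      proof (rule sum.cong[OF refl])
        fix k assume "k \<in> K"
        then have "k (c t) = k (c 0)" using const that unfolding assms(5) by blast
        then show "\<bar>k (c t) - k ze\<bar> = \<bar>k (c 0) - k ze\<bar>" by simp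
      qed
    qed
  qed
qed

end
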